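(* Let $p$ be a prime and let $D$ be an integrally closed subring of $\overline{\mathbb{Z}_{(p)}}$ containing $\mathbb{Z}_{(p)}$. The following conditions are equivalent. (1) $\mathrm{Int}_{\mathbb{Q}}(D)$ is a Prüfer domain. (2) $\mathrm{Int}_{\mathbb{Q}}(D)$ is nontrivial, i.e. $\mathbb{Z}_{(p)}[X] \subsetneq \mathrm{Int}_{\mathbb{Q}}(D)$. (3) The sets $F_{D,p}$ and $E_{D,p}$ are bounded.
   Context: $\overline{\mathbb{Z}_{(p)}}$ is the integral closure of $\mathbb{Z}_{(p)}$ (localization of $\mathbb{Z}$ at $p\mathbb{Z}$) in a fixed algebraic closure $\overline{\mathbb{Q}}$ of $\mathbb{Q}$. $D$ is integrally closed in its fraction field $K$ (so $D$ is the integral closure of $\mathbb{Z}_{(p)}$ in the algebraic extension $K$ of $\mathbb{Q}$). $\mathrm{Int}_{\mathbb{Q}}(D)=\{f\in\mathbb{Q}[X]\mid f(D)\subseteq D\}$. $E_{D,p}=\{e(P|p)\}$ and $F_{D,p}=\{f(P|p)\}$, where $P$ ranges over the prime ideals of $D$ containing $p$, $e(P|p)$ is the ramification index (the index of the value group of $v_p$ on $\mathbb{Q}$ in the value group of the valuation of $K$ with valuation ring $D_P$) and $f(P|p)=[D/P:\mathbb{F}_p]$ is the residue field degree; both may be infinite. Such a set is bounded if there is a (finite) natural number bounding all its elements. *)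

theory Defs
  imports
    "HOL-Algebra.Algebra"
    "HOL-Algebra.Algebraic_Closure_Type"
    "HOL-Computational_Algebra.Computational_Algebra"
    "HOL-Library.Extended_Nat"
begin

text \<open>
  All rings are subsets of an ambient field given by a type; \<open>ring_on R\<close> is the
  corresponding ring record, to which the locales and constants of HOL-Algebra apply.
\<close>

abbreviation ring_on :: "'k::field set \<Rightarrow> 'k ring" where
  "ring_on R \<equiv> ring_of_type_algebra\<lparr>carrier := R\<rparr>"

definition fraction_field :: "'k::field set \<Rightarrow> 'k set" where
  "fraction_field R = {x / y | x y. x \<in> R \<and> y \<in> R \<and> y \<noteq> 0}"

definition integral_over :: "'k::field set \<Rightarrow> 'k \<Rightarrow> bool" where
  "integral_over R x \<longleftrightarrow>
     (\<exists>q. lead_coeff q = 1 \<and> (\<forall>i. Polynomial.coeff q i \<in> R) \<and> poly q x = 0)"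

definition integrally_closed :: "'k::field set \<Rightarrow> bool" where
  "integrally_closed R \<longleftrightarrow> (\<forall>x\<in>fraction_field R. integral_over R x \<longrightarrow> x \<in> R)"

definition localization_at_prime :: "'k::field set \<Rightarrow> 'k set \<Rightarrow> 'k set" where
  "localization_at_prime R P = {x / y | x y. x \<in> R \<and> y \<in> R - P}"


subsection \<open>Pruefer domains\<close>

definition fractional_inverse :: "'k::field set \<Rightarrow> 'k set \<Rightarrow> 'k set" where
  "fractional_inverse R I = {x \<in> fraction_field R. \<forall>a\<in>I. x * a \<in> R}"

text \<open>
  The product of \<open>I\<close> and its fractional inverse is taken in the ambient field: \<^const>\<open>ideal_prod\<close>
  is the set of finite sums of products, for arbitrary factors.
\<close>

definition invertible_ideal :: "'k::field set \<Rightarrow> 'k set \<Rightarrow> bool" where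
  "invertible_ideal R I \<longleftrightarrow>
     ideal_prod (ring_of_type_algebra :: 'k ring) I (fractional_inverse R I) = R"

definition pruefer_domain :: "'k::field set \<Rightarrow> bool" where
  "pruefer_domain R \<longleftrightarrow> subring R ring_of_type_algebra \<and>
     (\<forall>S. finite S \<and> S \<subseteq> R \<and> genideal (ring_on R) S \<noteq> {0}
        \<longrightarrow> invertible_ideal R (genideal (ring_on R) S))"


subsection \<open>Integer-valued polynomials\<close>

definition Z_loc :: "nat \<Rightarrow> 'k::field_char_0 set" where
  "Z_loc p = {of_int a / of_int b | a b. \<not> int p dvd b}"

text \<open>
  If \<open>'k\<close> is algebraically closed of characteristic \<open>0\<close>, then \<open>{x::'k. algebraic x}\<close>
  is an algebraic closure of the rationals, and every algebraic closure arises in this way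
  (up to isomorphism).
\<close>

definition Z_loc_bar :: "nat \<Rightarrow> 'k::{alg_closed_field, field_char_0} set" where
  "Z_loc_bar p = {x. algebraic x \<and> integral_over (Z_loc p) x}"

definition Int_Q :: "'k::field_char_0 set \<Rightarrow> rat poly set" where
  "Int_Q D = {f. \<forall>d\<in>D. poly (map_poly of_rat f) d \<in> D}"

definition Z_loc_polys :: "nat \<Rightarrow> rat poly set" where
  "Z_loc_polys p = {f. \<forall>i. Polynomial.coeff f i \<in> Z_loc p}"


subsection \<open>Ramification indices and residue degrees\<close>

definition group_index :: "('g, 'm) monoid_scheme \<Rightarrow> 'g set \<Rightarrow> enat" where
  "group_index G H =
     (if finite (rcosets\<^bsub>G\<^esub> H) then enat (card (rcosets\<^bsub>G\<^esub> H)) else \<infinity>)"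

text \<open>
  The valuation with valuation ring \<open>V\<close> is the projection from the multiplicative group of
  the fraction field onto its quotient by the units of \<open>V\<close>.
\<close>

definition value_group :: "'k::field set \<Rightarrow> 'k set monoid" where
  "value_group V = units_of (ring_on (fraction_field V)) Mod Units (ring_on V)"

definition valuation :: "'k::field set \<Rightarrow> 'k \<Rightarrow> 'k set" where
  "valuation V x = Units (ring_on V) #>\<^bsub>units_of (ring_on (fraction_field V))\<^esub> x"

text \<open>
  The value group of the restriction to the rationals of the valuation of \<open>D\<^sub>P\<close> is
  the image of the nonzero rationals; for \<open>p \<in> P\<close> that restriction is \<open>v\<^sub>p\<close>.
\<close>

definition ramification_index :: "'k::field_char_0 set \<Rightarrow> 'k set \<Rightarrow> enat" where
  "ramification_index D P =
     group_index (value_group (localization_at_prime D P))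
       {valuation (localization_at_prime D P) (of_rat q) | q. q \<noteq> 0}"

text \<open>
  For \<open>p \<in> P\<close> the integer multiples of \<open>1\<close> in \<open>D/P\<close> are the copy of the field with \<open>p\<close> elements.
\<close>

definition residue_degree :: "'k::field set \<Rightarrow> 'k set \<Rightarrow> enat" where
  "residue_degree D P =
     (let R = ring_on D Quot P; F = range (\<lambda>n::int. [n] \<cdot>\<^bsub>R\<^esub> \<one>\<^bsub>R\<^esub>)
      in if ring.finite_dimension R F (carrier R)
         then enat (ring.dim R F (carrier R)) else \<infinity>)"

definition primes_above :: "'k::field set \<Rightarrow> nat \<Rightarrow> 'k set set" where
  "primes_above D p = {P. primeideal P (ring_on D) \<and> of_nat p \<in> P}"

definition E_set :: "'k::field_char_0 set \<Rightarrow> nat \<Rightarrow> enat set" where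
  "E_set D p = ramification_index D ` primes_above D p"

definition F_set :: "'k::field set \<Rightarrow> nat \<Rightarrow> enat set" where
  "F_set D p = residue_degree D ` primes_above D p"

definition bounded_enat :: "enat set \<Rightarrow> bool" where
  "bounded_enat A \<longleftrightarrow> (\<exists>B::nat. \<forall>a\<in>A. a \<le> enat B)"

end

theory Submission
  imports Defs
begin

text \<open>
  Let \<open>V = D\<^sub>P\<close> for a prime \<open>P\<close> of \<open>D\<close> above \<open>p\<close>. A polynomial \<open>f\<close> satisfies \<open>f(D) \<subseteq> D\<close> if
  \<open>f(d)\<close> lies in all these rings \<open>V\<close> for every \<open>d \<in> D\<close> (\<open>mem_D_if_mem_localizations\<close>), and each
  \<open>V\<close> is a valuation ring (\<open>V_or_inverse\<close>), because an element of the fraction field of \<open>D\<close> is a root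
  of a primitive polynomial over \<open>\<int>\<^bsub>(p)\<^esub>\<close>.

  A nontrivial \<open>Int\<^sub>\<rat>(D)\<close> bounds both sets. Clearing denominators gives a polynomial \<open>g\<close> over
  \<open>\<int>\<^bsub>(p)\<^esub>\<close> of some degree \<open>n\<close>, not divisible by \<open>p\<close>, with \<open>g(D) \<subseteq> pD\<close>. All the residues modulo \<open>P\<close> are
  roots of \<open>g\<close>, so there are at most \<open>n\<close> of them. If some nonunit \<open>t\<close> had \<open>v(t\<^sup>n) < v(p)\<close>, then the first
  coefficient of \<open>g\<close> that is not divisible by \<open>p\<close> would force \<open>v(g(t)) < v(p)\<close>. So \<open>p\<close> divides \<open>t\<^sup>n\<close>
  for all nonunits \<open>t\<close>; then \<open>V\<close> is discrete and its ramification index is at most \<open>n\<close>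
  (\<open>bounded_if_nontrivial\<close>).

  Conversely, bounds for both sets give exponents \<open>\<kappa>\<close> and \<open>E\<close> with \<open>x\<^sup>\<kappa> \<equiv> 1\<close> modulo \<open>P\<close> for \<open>x \<notin> P\<close>, and
  with \<open>x\<^sup>E\<close> a power of \<open>p\<close> times a unit of \<open>V\<close> for \<open>x \<noteq> 0\<close>, uniformly in \<open>P\<close>
  (\<open>uniform_exponents_if_bounded\<close>). Then \<open>(X\<^bsup>\<kappa>+1\<^esup> - X)\<^sup>E / p\<close> is integer-valued, so the ring is
  nontrivial.

  The same exponents make the ring a Pruefer domain. Dividing the generators of an ideal by their
  greatest common divisor in \<open>\<rat>[X]\<close>, one may assume that the ideal contains a power of \<open>p\<close>. The
  ring is root closed in \<open>\<rat>[X]\<close>, which allows one to replace the generators by their \<open>E\<close>-th powers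
  (\<open>inverse_if_contains_p_power\<close>); then all their nonzero values are powers of \<open>p\<close> up to units.
  The polynomial \<open>\<epsilon> = \<Prod> (1 - s\<^sub>i\<^bsup>\<kappa>l\<^esup>)\<^bsup>El\<^esup>\<close> is close to \<open>1\<close> where all the generators \<open>s\<^sub>i\<close> are divisible by
  \<open>p\<close>, and close to \<open>0\<close> where one of them is a unit. It serves to divide the ideal by \<open>p\<close> in the first
  region only, which lowers the power of \<open>p\<close> that is contained in the ideal, and an induction
  produces an explicit inverse (\<open>inverse_if_discrete_values\<close>).

  Finally \<open>\<int>\<^bsub>(p)\<^esub>[X]\<close> is not a Pruefer domain, since the ideal \<open>(p, X)\<close> is not invertible.
\<close>

section \<open>Subrings of a commutative ring type\<close>

text \<open>
  The membership form of the notion of a subring of a ring given by a type. It is used for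
  \<open>D\<close>, its fraction field, its localizations, the ring of integer-valued polynomials and the
  image of the latter in a field of fractions.
\<close>

locale type_subring =
  fixes R :: "'a::comm_ring_1 set"
  assumes zero_mem [simp, intro]: "0 \<in> R"
    and one_mem [simp, intro]: "1 \<in> R"
    and add_mem [intro]: "x \<in> R \<Longrightarrow> y \<in> R \<Longrightarrow> x + y \<in> R"
    and minus_mem [intro]: "x \<in> R \<Longrightarrow> - x \<in> R"
    and mult_mem [intro]: "x \<in> R \<Longrightarrow> y \<in> R \<Longrightarrow> x * y \<in> R"
begin

lemma diff_mem [intro]: "x \<in> R \<Longrightarrow> y \<in> R \<Longrightarrow> x - y \<in> R"
  using add_mem[of x "- y"] minus_mem by auto

lemma power_mem [intro]: "x \<in> R \<Longrightarrow> x ^ n \<in> R"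
  by (induction n) auto

lemma sum_mem [intro]: "(\<And>i. i \<in> A \<Longrightarrow> f i \<in> R) \<Longrightarrow> sum f A \<in> R"
  by (induction A rule: infinite_finite_induct) auto

lemma prod_mem [intro]: "(\<And>i. i \<in> A \<Longrightarrow> f i \<in> R) \<Longrightarrow> prod f A \<in> R"
  by (induction A rule: infinite_finite_induct) auto

lemma of_nat_mem [simp, intro]: "of_nat n \<in> R"
  by (induction n) auto

lemma of_int_mem [simp, intro]: "of_int n \<in> R"
  by (cases n) auto

lemma poly_mem: "(\<And>i. Polynomial.coeff f i \<in> R) \<Longrightarrow> x \<in> R \<Longrightarrow> poly f x \<in> R"
  unfolding poly_altdef by auto

end

lemma subring_iff_type_subring:
  "subring (R :: 'a::comm_ring_1 set) ring_of_type_algebra \<longleftrightarrow> type_subring R"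
proof -
  interpret T: cring "ring_of_type_algebra :: 'a ring" by rule
  have neg: "\<ominus>\<^bsub>ring_of_type_algebra\<^esub> x = - x" for x :: 'a
    by (rule sym, rule T.sum_zero_eq_neg) (auto simp: ring_of_type_algebra_def)
  show ?thesis
  proof
    assume "subring R ring_of_type_algebra"
    note s = subringE[OF this]
    show "type_subring R"
      using s(2,3,5,6,7) unfolding neg
      by unfold_locales (auto simp: ring_of_type_algebra_def)
  next
    assume "type_subring R"
    then interpret type_subring R .
    show "subring R ring_of_type_algebra"
      by (rule T.subringI) (auto simp: neg, auto simp: ring_of_type_algebra_def)
  qed
qed

context
  fixes R :: "'k::field set"
  assumes R: "type_subring R"
begin

interpretation type_subring R by (rule R)

lemma cring_ring_on: "cring (ring_on R)"
proof (rule cringI)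
  show "abelian_group (ring_on R)"
  proof (rule abelian_groupI)
    fix x assume "x \<in> carrier (ring_on R)"
    then show "\<exists>y\<in>carrier (ring_on R). y \<oplus>\<^bsub>ring_on R\<^esub> x = \<zero>\<^bsub>ring_on R\<^esub>"
      by (intro bexI[of _ "- x"]) (auto simp: ring_of_type_algebra_def)
  qed (auto simp: ring_of_type_algebra_def)
  show "comm_monoid (ring_on R)"
    by (rule comm_monoidI) (auto simp: ring_of_type_algebra_def)
qed (auto simp: ring_of_type_algebra_def algebra_simps)

lemma ideal_ring_on_iff:
  "ideal I (ring_on R) \<longleftrightarrow>
     I \<subseteq> R \<and> 0 \<in> I \<and> (\<forall>x\<in>I. \<forall>y\<in>I. x + y \<in> I) \<and> (\<forall>r\<in>R. \<forall>x\<in>I. r * x \<in> I)"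
proof -
  interpret T: cring "ring_on R" by (rule cring_ring_on)
  have neg: "\<ominus>\<^bsub>ring_on R\<^esub> x = - x" if "x \<in> R" for x
    by (rule sym, rule T.sum_zero_eq_neg) (use that in \<open>auto simp: ring_of_type_algebra_def\<close>)
  show ?thesis
  proof
    assume "ideal I (ring_on R)"
    then interpret I: ideal I "ring_on R" .
    show "I \<subseteq> R \<and> 0 \<in> I \<and> (\<forall>x\<in>I. \<forall>y\<in>I. x + y \<in> I) \<and> (\<forall>r\<in>R. \<forall>x\<in>I. r * x \<in> I)"
      using I.a_subset I.zero_closed I.a_closed I.I_l_closed
      by (auto simp: ring_of_type_algebra_def)
  next
    assume A: "I \<subseteq> R \<and> 0 \<in> I \<and> (\<forall>x\<in>I. \<forall>y\<in>I. x + y \<in> I) \<and> (\<forall>r\<in>R. \<forall>x\<in>I. r * x \<in> I)"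
    show "ideal I (ring_on R)"
    proof (rule idealI)
      show "ring (ring_on R)" by (rule T.ring_axioms)
      have "- x \<in> I" if "x \<in> I" for x
        using A minus_mem[OF one_mem] that by (metis mult_minus1)
      with A show "subgroup I (add_monoid (ring_on R))"
        using neg unfolding a_inv_def
        by unfold_locales (auto simp: ring_of_type_algebra_def subset_iff)
      show "x \<otimes>\<^bsub>ring_on R\<^esub> a \<in> I" "a \<otimes>\<^bsub>ring_on R\<^esub> x \<in> I"
        if "a \<in> I" "x \<in> carrier (ring_on R)" for a x
        using A that by (auto simp: ring_of_type_algebra_def mult.commute[of a x])
    qed
  qed
qed

lemma primeideal_ring_on_iff:
  "primeideal P (ring_on R) \<longleftrightarrow>
     ideal P (ring_on R) \<and> 1 \<notin> P \<and> (\<forall>a\<in>R. \<forall>b\<in>R. a * b \<in> P \<longrightarrow> a \<in> P \<or> b \<in> P)"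
proof
  assume "primeideal P (ring_on R)"
  then interpret P: primeideal P "ring_on R" .
  have "1 \<notin> P"
    using P.I_notcarr P.one_imp_carrier by (auto simp: ring_of_type_algebra_def)
  then show "ideal P (ring_on R) \<and> 1 \<notin> P \<and> (\<forall>a\<in>R. \<forall>b\<in>R. a * b \<in> P \<longrightarrow> a \<in> P \<or> b \<in> P)"
    using P.I_prime P.ideal_axioms by (auto simp: ring_of_type_algebra_def)
next
  assume A: "ideal P (ring_on R) \<and> 1 \<notin> P \<and> (\<forall>a\<in>R. \<forall>b\<in>R. a * b \<in> P \<longrightarrow> a \<in> P \<or> b \<in> P)"
  show "primeideal P (ring_on R)"
    by (rule primeidealI) (use A cring_ring_on in \<open>auto simp: ring_of_type_algebra_def\<close>)
qed

lemma Units_ring_on: "Units (ring_on R) = {x \<in> R. x \<noteq> 0 \<and> inverse x \<in> R}"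
proof -
  have "x \<noteq> 0 \<and> inverse x \<in> R" if "x \<in> R" "y \<in> R" "y * x = 1" for x y
  proof -
    have "x \<noteq> 0" using that by auto
    moreover have "y = inverse x" using that(3) by (metis inverse_unique mult.commute)
    ultimately show ?thesis using that by auto
  qed
  moreover have "\<exists>y\<in>R. y * x = 1 \<and> x * y = 1" if "x \<noteq> 0" "inverse x \<in> R" for x
    using that by (intro bexI[of _ "inverse x"]) auto
  ultimately show ?thesis
    by (auto simp: Units_def ring_of_type_algebra_def)
qed

text \<open>
  By Zorn's lemma there is an ideal that is maximal among those avoiding \<open>1\<close>, and such an
  ideal is prime. Its maximality serves to show that it contains the elements of the Jacobson
  radical.
\<close>

lemma proper_ideal_le_prime:
  assumes "ideal I (ring_on R)" "1 \<notin> I"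
  obtains P where "primeideal P (ring_on R)" "I \<subseteq> P"
    "\<And>J. ideal J (ring_on R) \<Longrightarrow> P \<subseteq> J \<Longrightarrow> 1 \<notin> J \<Longrightarrow> J = P"
proof -
  let ?F = "{J. ideal J (ring_on R) \<and> I \<subseteq> J \<and> 1 \<notin> J}"
  have "\<exists>M\<in>?F. \<forall>J\<in>?F. M \<subseteq> J \<longrightarrow> J = M"
  proof (rule subset_Zorn_nonempty)
    show "?F \<noteq> {}" using assms by auto
    fix C assume ne: "C \<noteq> {}" and ch: "subset.chain ?F C"
    have CA: "\<And>J. J \<in> C \<Longrightarrow> J \<in> ?F" using ch by (auto simp: subset.chain_def)
    have "x + y \<in> \<Union>C" if x: "x \<in> \<Union>C" and y: "y \<in> \<Union>C" for x y
    proof -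
      obtain J K where JK: "J \<in> C" "K \<in> C" "x \<in> J" "y \<in> K" using x y by auto
      then have "J \<subseteq> K \<or> K \<subseteq> J" using ch by (auto simp: subset.chain_def)
      then obtain Z where "Z \<in> C" "x \<in> Z" "y \<in> Z" using JK by auto
      then show ?thesis using CA[of Z] by (auto simp: ideal_ring_on_iff)
    qed
    moreover have "\<Union>C \<subseteq> R"
    proof
      fix x assume "x \<in> \<Union>C"
      then obtain J where "J \<in> C" "x \<in> J" by auto
      then show "x \<in> R" using CA[of J] by (auto simp: ideal_ring_on_iff)
    qed
    moreover have "0 \<in> \<Union>C" using CA ne by (auto simp: ideal_ring_on_iff)
    moreover have "r * x \<in> \<Union>C" if r: "r \<in> R" and x: "x \<in> \<Union>C" for r x
    proof -
      obtain J where "J \<in> C" "x \<in> J" using x by auto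
      then have "r * x \<in> J" using CA[of J] r by (auto simp: ideal_ring_on_iff)
      then show ?thesis using \<open>J \<in> C\<close> by auto
    qed
    ultimately have "ideal (\<Union>C) (ring_on R)"
      unfolding ideal_ring_on_iff by blast
    then show "\<Union>C \<in> ?F" using CA ne by auto
  qed
  then obtain P where PF: "P \<in> ?F" and mx: "\<forall>J\<in>?F. P \<subseteq> J \<longrightarrow> J = P" by (rule bexE)
  then have P: "ideal P (ring_on R)" "I \<subseteq> P" "1 \<notin> P" by auto
  have max: "J = P" if "ideal J (ring_on R)" "P \<subseteq> J" "1 \<notin> J" for J
    using mx that P(2) by auto
  have "a \<in> P \<or> b \<in> P" if ab: "a \<in> R" "b \<in> R" "a * b \<in> P" for a b
  proof (rule ccontr)
    assume n: "\<not> (a \<in> P \<or> b \<in> P)"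
    note Pi = P(1)[unfolded ideal_ring_on_iff]
    have one: "\<exists>r\<in>R. \<exists>y\<in>P. 1 = r * c + y" if c: "c \<in> R" "c \<notin> P" for c
    proof -
      let ?J = "{r * c + y | r y. r \<in> R \<and> y \<in> P}"
      have "ideal ?J (ring_on R)"
        unfolding ideal_ring_on_iff
      proof (intro conjI ballI)
        show "?J \<subseteq> R" using Pi c by auto
        show "0 \<in> ?J" using Pi by (intro CollectI exI[of _ 0]) auto
        fix x y assume "x \<in> ?J" "y \<in> ?J"
        then obtain r y' r' y'' where "x = r * c + y'" "y = r' * c + y''"
          "r \<in> R" "r' \<in> R" "y' \<in> P" "y'' \<in> P" by auto
        then show "x + y \<in> ?J"
          using Pi by (intro CollectI exI[of _ "r + r'"] exI[of _ "y' + y''"])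
            (auto simp: algebra_simps)
      next
        fix s x assume "s \<in> R" "x \<in> ?J"
        then obtain r y where "x = r * c + y" "r \<in> R" "y \<in> P" by auto
        then show "s * x \<in> ?J"
          using Pi \<open>s \<in> R\<close> by (intro CollectI exI[of _ "s * r"] exI[of _ "s * y"])
            (auto simp: algebra_simps)
      qed
      note Ji = this
      have PJ: "P \<subseteq> ?J"
      proof
        fix y assume "y \<in> P"
        then show "y \<in> ?J" by (intro CollectI exI[of _ 0] exI[of _ y]) auto
      qed
      have cJ: "c \<in> ?J" using Pi by (intro CollectI exI[of _ 1] exI[of _ 0]) auto
      have "1 \<in> ?J"
      proof (rule ccontr)
        assume "1 \<notin> ?J"
        from max[OF Ji PJ this] cJ c(2) show False by simp
      qed
      then show ?thesis by (elim CollectE exE conjE) auto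
    qed
    obtain r y where r: "r \<in> R" "y \<in> P" "1 = r * a + y" using one[of a] n ab by auto
    obtain s z where s: "s \<in> R" "z \<in> P" "1 = s * b + z" using one[of b] n ab by auto
    have "1 = (r * a + y) * (s * b + z)" using r s by simp
    also have "\<dots> = (r * s) * (a * b) + (s * b + z) * y + (r * a) * z"
      by (simp add: algebra_simps)
    also have "\<dots> \<in> P"
    proof -
      have "y \<in> R" "z \<in> R" using Pi r s by auto
      then have "r * s \<in> R" "s * b + z \<in> R" "r * a \<in> R" using r s ab by auto
      then show ?thesis using Pi r(2) s(2) ab(3) by simp
    qed
    finally show False using P by simp
  qed
  then have "primeideal P (ring_on R)"
    using P by (auto simp: primeideal_ring_on_iff)
  then show ?thesis using P(2) max by (rule that)
qed

end

lemma fraction_fieldI: "x \<in> R \<Longrightarrow> y \<in> R \<Longrightarrow> y \<noteq> 0 \<Longrightarrow> x / y \<in> fraction_field R"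
  unfolding fraction_field_def by auto

lemma type_subring_fraction_field:
  assumes "type_subring R"
  shows "type_subring (fraction_field R)" "R \<subseteq> fraction_field R"
    "x \<in> fraction_field R \<Longrightarrow> inverse x \<in> fraction_field R"
proof -
  interpret type_subring R by (rule assms)
  note I = fraction_fieldI[of _ R]
  have E: "\<exists>x\<in>R. \<exists>y\<in>R. y \<noteq> 0 \<and> a = x / y" if "a \<in> fraction_field R" for a
    using that unfolding fraction_field_def by auto
  show sub: "R \<subseteq> fraction_field R"
    using I[of _ 1] by auto
  show "type_subring (fraction_field R)"
  proof
    show "0 \<in> fraction_field R" "1 \<in> fraction_field R" using sub by auto
    fix a b assume "a \<in> fraction_field R" "b \<in> fraction_field R"
    with E obtain x y z w where d: "x \<in> R" "y \<in> R" "y \<noteq> 0" "a = x / y"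
      "z \<in> R" "w \<in> R" "w \<noteq> 0" "b = z / w" by metis
    have "a + b = (x * w + z * y) / (y * w)" "a * b = (x * z) / (y * w)"
      using d by (auto simp: field_simps)
    moreover have "x * w + z * y \<in> R" "x * z \<in> R" "y * w \<in> R" "y * w \<noteq> 0"
      using d by auto
    ultimately show "a + b \<in> fraction_field R" "a * b \<in> fraction_field R"
      using I by metis+
  next
    fix a assume "a \<in> fraction_field R"
    with E obtain x y where d: "x \<in> R" "y \<in> R" "y \<noteq> 0" "a = x / y" by metis
    then have "- a = (- x) / y" by simp
    then show "- a \<in> fraction_field R" using I[of "- x" y] d minus_mem by auto
  qed
  show "inverse x \<in> fraction_field R" if "x \<in> fraction_field R" for x
  proof (cases "x = 0")
    case False
    then show ?thesis using E[OF that] I by auto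
  qed (use that in auto)
qed

section \<open>The localization of the integers at a prime\<close>

context
  fixes p :: nat
  assumes p: "Factorial_Ring.prime p"
begin

lemma Z_loc_I: "\<not> int p dvd b \<Longrightarrow> of_int a / of_int b \<in> Z_loc p"
  unfolding Z_loc_def by auto

lemma Z_loc_E:
  assumes "x \<in> Z_loc p"
  obtains a b where "\<not> int p dvd b" "b \<noteq> 0" "x = of_int a / of_int b"
proof -
  from assms obtain a b where ab: "x = of_int a / of_int b" "\<not> int p dvd b"
    unfolding Z_loc_def by auto
  then have "b \<noteq> 0" by auto
  then show ?thesis using ab that by metis
qed

lemma prime_int_p: "Factorial_Ring.prime (int p)"
  using p by simp

lemma type_subring_Z_loc: "type_subring (Z_loc p :: 'k::field_char_0 set)"
proof
  have ndvd1: "\<not> int p dvd 1" using prime_int_p by (metis not_prime_unit)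
  show "0 \<in> (Z_loc p :: 'k set)" using Z_loc_I[OF ndvd1, of 0] by simp
  show "1 \<in> (Z_loc p :: 'k set)" using Z_loc_I[OF ndvd1, of 1] by simp
  fix x :: 'k assume "x \<in> Z_loc p"
  then obtain a b where x: "\<not> int p dvd b" "b \<noteq> 0" "x = of_int a / of_int b" by (rule Z_loc_E)
  have "- x = of_int (- a) / of_int b" using x by simp
  then show "- x \<in> Z_loc p" using Z_loc_I[OF x(1)] by metis
  fix y :: 'k assume "y \<in> Z_loc p"
  then obtain c d where y: "\<not> int p dvd d" "d \<noteq> 0" "y = of_int c / of_int d" by (rule Z_loc_E)
  have nd: "\<not> int p dvd b * d" using x y prime_int_p by (simp add: prime_dvd_mult_iff)
  have "x + y = of_int (a * d + c * b) / of_int (b * d)"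
    "x * y = of_int (a * c) / of_int (b * d)" using x y by (simp_all add: field_simps)
  then show "x + y \<in> Z_loc p" "x * y \<in> Z_loc p" using Z_loc_I[OF nd] by metis+
qed

lemma Z_loc_divide_p_or_unit:
  assumes "x \<in> (Z_loc p :: 'k::field_char_0 set)"
  shows "x / of_nat p \<in> Z_loc p \<or> inverse x \<in> Z_loc p"
proof -
  obtain a b where x: "\<not> int p dvd b" "b \<noteq> 0" "x = of_int a / of_int b"
    using assms by (rule Z_loc_E)
  show ?thesis
  proof (cases "int p dvd a")
    case True
    then obtain c where "a = int p * c" by auto
    then have "x / of_nat p = of_int c / of_int b"
      using x p by (auto simp: field_simps)
    then show ?thesis using Z_loc_I[OF x(1)] by metis
  next
    case False
    have "inverse x = of_int b / of_int a" using x by simp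
    then show ?thesis using Z_loc_I[OF False] by metis
  qed
qed

lemma inverse_p_notin_Z_loc: "inverse (of_nat p) \<notin> (Z_loc p :: 'k::field_char_0 set)"
proof
  assume "inverse (of_nat p) \<in> (Z_loc p :: 'k set)"
  then obtain a b where x: "\<not> int p dvd b" "b \<noteq> 0" "inverse (of_nat p) = (of_int a / of_int b :: 'k)"
    by (rule Z_loc_E)
  then have "(of_int b :: 'k) = of_int (int p * a)"
    using p by (auto simp: field_simps)
  then have "b = int p * a" unfolding of_int_eq_iff .
  then show False using x by simp
qed

lemma of_rat_mem_Z_loc_iff:
  "(of_rat q :: 'k::field_char_0) \<in> Z_loc p \<longleftrightarrow> q \<in> Z_loc p"
proof
  assume "(of_rat q :: 'k) \<in> Z_loc p"
  then obtain a b where x: "\<not> int p dvd b" "b \<noteq> 0" "(of_rat q :: 'k) = of_int a / of_int b"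
    by (rule Z_loc_E)
  then have "(of_rat q :: 'k) = of_rat (of_int a / of_int b)" by (simp add: of_rat_divide)
  then have "q = of_int a / of_int b" unfolding of_rat_eq_iff .
  then show "q \<in> Z_loc p" using Z_loc_I[OF x(1)] by metis
next
  assume "q \<in> Z_loc p"
  then obtain a b where x: "\<not> int p dvd b" "b \<noteq> 0" "q = of_int a / of_int b"
    by (rule Z_loc_E)
  then have "(of_rat q :: 'k) = of_int a / of_int b" by (simp add: of_rat_divide)
  then show "(of_rat q :: 'k) \<in> Z_loc p" using Z_loc_I[OF x(1)] by metis
qed

lemma Z_loc_eq_of_rat: "(Z_loc p :: 'k::field_char_0 set) = of_rat ` Z_loc p"
proof -
  have "x \<in> of_rat ` Z_loc p" if "x \<in> Z_loc p" for x :: 'k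
  proof -
    obtain a b where x: "\<not> int p dvd b" "b \<noteq> 0" "x = of_int a / of_int b"
      using \<open>x \<in> Z_loc p\<close> by (rule Z_loc_E)
    then have "x = of_rat (of_int a / of_int b)" by (simp add: of_rat_divide)
    then show ?thesis using Z_loc_I[OF x(1)] by blast
  qed
  then show ?thesis using of_rat_mem_Z_loc_iff by auto
qed

lemma rat_p_part:
  assumes "q \<noteq> (0 :: rat)"
  obtains i j u where "q * of_nat p ^ i = of_nat p ^ j * u" "u \<in> Z_loc p" "inverse u \<in> Z_loc p" "u \<noteq> 0"
proof -
  obtain a b where q: "quotient_of q = (a, b)" by (cases "quotient_of q")
  have ab: "q = of_int a / of_int b" "b \<noteq> 0"
    using quotient_of_div[OF q] quotient_of_denom_pos[OF q] by auto
  then have a: "a \<noteq> 0" using assms by auto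
  have npu: "\<not> is_unit (int p)" using prime_int_p by auto
  obtain a' where a': "a = int p ^ multiplicity (int p) a * a'" "\<not> int p dvd a'"
    using multiplicity_decompose'[OF a npu] by metis
  obtain b' where b': "b = int p ^ multiplicity (int p) b * b'" "\<not> int p dvd b'"
    using multiplicity_decompose'[OF ab(2) npu] by metis
  have nz: "a' \<noteq> 0" "b' \<noteq> 0" using a' b' by auto
  have "(of_int a :: rat) = of_nat p ^ multiplicity (int p) a * of_int a'"
    by (subst a') simp
  moreover have "(of_int b :: rat) = of_nat p ^ multiplicity (int p) b * of_int b'"
    by (subst b') simp
  ultimately have e: "q * of_nat p ^ multiplicity (int p) b
      = of_nat p ^ multiplicity (int p) a * (of_int a' / of_int b')"
    using nz p by (simp add: ab field_simps)
  have m: "of_int a' / of_int b' \<in> (Z_loc p :: rat set)"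
    "inverse (of_int a' / of_int b') \<in> (Z_loc p :: rat set)"
    using Z_loc_I[OF b'(2), of a'] Z_loc_I[OF a'(2), of b'] by simp_all
  show ?thesis by (rule that[OF e m]) (use nz in simp)
qed

lemma Z_loc_p_part:
  assumes "c \<in> (Z_loc p :: 'k::field_char_0 set)" "c \<noteq> 0"
  obtains j u where "c = of_nat p ^ j * u" "u \<in> Z_loc p" "inverse u \<in> Z_loc p" "u \<noteq> 0"
proof -
  interpret Z: type_subring "Z_loc p :: 'k set" by (rule type_subring_Z_loc)
  obtain q where q: "q \<in> Z_loc p" "c = of_rat q" using assms Z_loc_eq_of_rat by blast
  have "q \<noteq> 0" using assms q by auto
  then obtain i j u where u: "q * of_nat p ^ i = of_nat p ^ j * u" "u \<in> Z_loc p"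
    "inverse u \<in> Z_loc p" "u \<noteq> 0" by (rule rat_p_part)
  have u': "(of_rat u :: 'k) \<in> Z_loc p" "inverse (of_rat u :: 'k) \<in> Z_loc p" "(of_rat u :: 'k) \<noteq> 0"
    using u of_rat_mem_Z_loc_iff[of u] of_rat_mem_Z_loc_iff[of "inverse u"] by (auto simp: of_rat_inverse)
  have "(of_rat (q * of_nat p ^ i) :: 'k) = of_rat (of_nat p ^ j * u)" using u by simp
  then have e: "c * of_nat p ^ i = of_nat p ^ j * of_rat u"
    by (simp add: of_rat_mult of_rat_power q)
  have p0: "(of_nat p :: 'k) \<noteq> 0" using p by auto
  have "i \<le> j"
  proof (rule ccontr)
    assume "\<not> i \<le> j"
    then obtain k where k: "i = Suc (j + k)" by (metis less_imp_Suc_add not_le_imp_less)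
    have "of_nat p ^ j * (c * of_nat p ^ k * of_nat p) = of_nat p ^ j * of_rat u"
      using e by (simp add: k power_add mult_ac)
    then have "c * of_nat p ^ k * of_nat p = of_rat u" using p0 by simp
    then have "inverse (of_nat p) = c * of_nat p ^ k * inverse (of_rat u)"
      using p0 u'(3) by (simp add: field_simps)
    also have "\<dots> \<in> Z_loc p" using assms u' by auto
    finally show False using inverse_p_notin_Z_loc by blast
  qed
  then obtain k where k: "j = i + k" by (metis le_Suc_ex)
  have "c = of_nat p ^ k * of_rat u"
    using e p0 by (simp add: k power_add mult_ac)
  then show ?thesis using that u' by blast
qed

end

section \<open>Integrally closed rings\<close>

lemma integrally_closedD:
  assumes "integrally_closed D" "type_subring D" "x \<in> fraction_field D"
    and "\<And>i. i < k \<Longrightarrow> c i \<in> D" "x ^ k + (\<Sum>i<k. c i * x ^ i) = 0"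
  shows "x \<in> D"
proof -
  interpret type_subring D by (rule assms)
  define q where "q = Polynomial.monom 1 k + (\<Sum>i<k. Polynomial.monom (c i) i)"
  have co: "Polynomial.coeff q i = (if i = k then 1 else if i < k then c i else 0)" for i
    by (auto simp: q_def coeff_sum sum.delta' cong: if_cong)
  have "Polynomial.degree q = k"
    by (rule antisym) (auto intro!: degree_le le_degree simp: co)
  then have "lead_coeff q = 1" by (simp add: co)
  moreover have "\<forall>i. Polynomial.coeff q i \<in> D" using assms(4) by (auto simp: co)
  moreover have "poly q x = 0"
    using assms(5) by (simp add: q_def poly_sum poly_monom)
  ultimately show ?thesis using assms(1,3) unfolding integrally_closed_def integral_over_def by blast
qed

text \<open>
  The Horner values \<open>b\<^sub>k = \<Sum>\<^bsub>i\<ge>k\<^esub> a\<^sub>i t\<^bsup>i-k\<^esup>\<close> of a relation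
  \<open>\<Sum> a\<^sub>i t\<^sup>i = 0\<close> lie in \<open>D\<close> together with \<open>b\<^sub>k t\<close>: multiplying the relation by a power of
  \<open>b\<^sub>k\<close> shows that \<open>b\<^sub>k t\<close> is integral over \<open>D\<close>.
\<close>

lemma integrally_closed_horner:
  assumes ic: "integrally_closed D" and D: "type_subring D" and t: "t \<in> fraction_field D"
    and a: "\<And>i. a i \<in> D" and rel: "(\<Sum>i\<le>n. a i * t ^ i) = 0"
  obtains b where "\<And>i. i \<le> Suc n \<Longrightarrow> b i \<in> D" "\<And>i. i \<le> Suc n \<Longrightarrow> b i * t \<in> D"
    "\<And>i. i \<le> n \<Longrightarrow> a i = b i - b (Suc i) * t"
proof -
  interpret type_subring D by (rule D)
  interpret K: type_subring "fraction_field D" by (rule type_subring_fraction_field[OF D])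
  define b where "b k = (\<Sum>i\<in>{k..n}. a i * t ^ (i - k))" for k
  have step: "b k = b (Suc k) * t + a k" if "k \<le> n" for k
  proof -
    have "b k = (\<Sum>i\<in>{Suc k..n}. a i * t ^ (i - k)) + a k"
      unfolding b_def using that by (subst sum.atLeast_Suc_atMost) (auto simp: add_ac)
    also have "(\<Sum>i\<in>{Suc k..n}. a i * t ^ (i - k)) = b (Suc k) * t"
      unfolding b_def sum_distrib_right
    proof (rule sum.cong)
      fix i assume "i \<in> {Suc k..n}"
      then have "i - k = Suc (i - Suc k)" by auto
      then show "a i * t ^ (i - k) = a i * t ^ (i - Suc k) * t" by (simp add: mult_ac)
    qed simp
    finally show ?thesis .
  qed
  have rel': "b k * t ^ k + (\<Sum>i<k. a i * t ^ i) = 0" if "k \<le> Suc n" for k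
    using that
  proof (induction k)
    case 0
    then show ?case using rel by (simp add: b_def atMost_atLeast0)
  next
    case (Suc k)
    then show ?case using step[of k] by (simp add: algebra_simps)
  qed
  have bt: "b k * t \<in> D" if k: "k \<le> Suc n" and b: "b k \<in> D" for k
  proof (cases k)
    case 0
    then show ?thesis using rel'[of 0] by simp
  next
    case (Suc m)
    show ?thesis
    proof (rule integrally_closedD[OF ic D, of _ k "\<lambda>i. a i * b k ^ (m - i)"])
      show "b k * t \<in> fraction_field D"
        using b t type_subring_fraction_field(2)[OF D] by auto
      show "a i * b k ^ (m - i) \<in> D" for i using a b by auto
      have "(b k * t) ^ k + (\<Sum>i<k. a i * b k ^ (m - i) * (b k * t) ^ i)
          = b k ^ m * (b k * t ^ k + (\<Sum>i<k. a i * t ^ i))"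
      proof -
        have "a i * b k ^ (m - i) * (b k * t) ^ i = b k ^ m * (a i * t ^ i)" if "i < k" for i
        proof -
          have "b k ^ m = b k ^ (m - i) * b k ^ i"
            using that Suc by (simp flip: power_add)
          then show ?thesis by (simp add: power_mult_distrib mult_ac)
        qed
        moreover have "(b k * t) ^ k = b k ^ m * (b k * t ^ k)"
          by (simp add: Suc power_mult_distrib mult_ac)
        moreover have "(\<Sum>i<k. a i * b k ^ (m - i) * (b k * t) ^ i)
            = (\<Sum>i<k. b k ^ m * (a i * t ^ i))"
          by (rule sum.cong) (use calculation in blast)+
        ultimately show ?thesis by (simp only: distrib_left sum_distrib_left)
      qed
      then show "(b k * t) ^ k + (\<Sum>i<k. a i * b k ^ (m - i) * (b k * t) ^ i) = 0"
        using rel'[OF k] by simp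
    qed
  qed
  have mem: "b (Suc n - j) \<in> D" for j
  proof (induction j)
    case 0
    then show ?case by (simp add: b_def)
  next
    case (Suc j)
    show ?case
    proof (cases "j \<le> n")
      case True
      then have "Suc n - j = Suc (n - j)" "Suc n - Suc j = n - j" by auto
      then show ?thesis using step[of "n - j"] bt[of "Suc n - j"] Suc a by auto
    next
      case False
      then show ?thesis using Suc by simp
    qed
  qed
  have mem': "b i \<in> D" if "i \<le> Suc n" for i
    using mem[of "Suc n - i"] that by simp
  show ?thesis
    by (rule that[of b]) (use mem' bt step in auto)
qed

section \<open>Rings integral over the localization of the integers\<close>

locale integral_over_Z_loc = type_subring D for D :: "'k::field_char_0 set" +
  fixes p :: nat
  assumes prime_p: "Factorial_Ring.prime p"
    and closed_D: "integrally_closed D"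
    and Z_loc_subset: "Z_loc p \<subseteq> D"
    and integral_D: "x \<in> D \<Longrightarrow> integral_over (Z_loc p) x"
begin

sublocale Z: type_subring "Z_loc p :: 'k set"
  by (rule type_subring_Z_loc[OF prime_p])

sublocale K: type_subring "fraction_field D"
  by (rule type_subring_fraction_field[OF type_subring_axioms])

lemmas D_subset_K = type_subring_fraction_field(2)[OF type_subring_axioms]
lemmas inverse_mem_K = type_subring_fraction_field(3)[OF type_subring_axioms]

lemma p_nonzero [simp]: "p \<noteq> 0" "of_nat p \<noteq> (0 :: 'k)"
  using prime_p by auto

lemma inverse_p_notin_Z: "inverse (of_nat p) \<notin> (Z_loc p :: 'k set)"
  by (rule inverse_p_notin_Z_loc[OF prime_p])

text \<open>
  The element \<open>p\<close> lies in the Jacobson radical of \<open>D\<close>: rewriting an integral equation of \<open>a\<close> in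
  terms of \<open>y = 1 - p a\<close> gives an equation whose constant term is \<open>1\<close> modulo \<open>p\<close>.
\<close>

lemma one_minus_p_unit:
  assumes a: "a \<in> D"
  shows "1 - of_nat p * a \<noteq> 0" "inverse (1 - of_nat p * a) \<in> D"
proof -
  obtain q where q: "lead_coeff q = 1" "\<And>i. Polynomial.coeff q i \<in> Z_loc p" "poly q a = 0"
    using integral_D[OF a] unfolding integral_over_def by blast
  define n where "n = Polynomial.degree q"
  define c where "c i = Polynomial.coeff q i" for i
  have c: "c i \<in> Z_loc p" "c i \<in> D" "c n = 1" for i
    using q Z_loc_subset by (auto simp: c_def n_def)
  define P where "P = (of_nat p :: 'k)"
  have P: "P \<in> D" "P \<in> Z_loc p" "P \<noteq> 0" by (auto simp: P_def)
  define y where "y = 1 - P * a"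
  define G where "G = (\<Sum>i\<le>n. c i * P ^ (n - i) * (\<Sum>j<i. (1 - y) ^ j))"
  define w where "w = (\<Sum>i\<le>n. c i * P ^ (n - i))"
  have "0 = P ^ n * (\<Sum>i\<le>n. c i * a ^ i)"
    using q(3) by (simp add: poly_altdef c_def n_def)
  also have "\<dots> = (\<Sum>i\<le>n. c i * P ^ (n - i) * (1 - y) ^ i)"
    unfolding sum_distrib_left
  proof (rule sum.cong)
    fix i assume "i \<in> {..n}"
    then have "P ^ n = P ^ (n - i) * P ^ i" by (simp flip: power_add)
    then show "P ^ n * (c i * a ^ i) = c i * P ^ (n - i) * (1 - y) ^ i"
      by (simp add: y_def power_mult_distrib)
  qed simp
  also have "\<dots> = (\<Sum>i\<le>n. c i * P ^ (n - i) - y * (c i * P ^ (n - i) * (\<Sum>j<i. (1 - y) ^ j)))"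
  proof (rule sum.cong)
    fix i
    have "1 - (1 - y) ^ i = y * (\<Sum>j<i. (1 - y) ^ j)"
      using one_diff_power_eq[of "1 - y" i] by simp
    then have e: "(1 - y) ^ i = 1 - y * (\<Sum>j<i. (1 - y) ^ j)" by (simp add: algebra_simps)
    show "c i * P ^ (n - i) * (1 - y) ^ i
        = c i * P ^ (n - i) - y * (c i * P ^ (n - i) * (\<Sum>j<i. (1 - y) ^ j))"
      by (subst e) (simp add: algebra_simps)
  qed simp
  also have "\<dots> = w - y * G" by (simp add: w_def G_def sum_subtractf sum_distrib_left)
  finally have wG: "w = y * G" by simp
  have yD: "y \<in> D" using a P by (auto simp: y_def)
  then have GD: "G \<in> D"
    unfolding G_def using c P by (intro sum_mem mult_mem power_mem diff_mem) auto
  have wZ: "w \<in> Z_loc p" using c P by (auto simp: w_def)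
  have w1: "(w - 1) / P \<in> Z_loc p"
  proof -
    have "w = 1 + (\<Sum>i<n. c i * P ^ (n - i))"
      using c(3) by (simp add: w_def atMost_Suc_eq_insert_0 flip: lessThan_Suc_atMost)
    also have "(\<Sum>i<n. c i * P ^ (n - i)) = (\<Sum>i<n. c i * P ^ (n - Suc i)) * P"
      unfolding sum_distrib_right
    proof (rule sum.cong)
      fix i assume "i \<in> {..<n}"
      then have "n - i = Suc (n - Suc i)" by auto
      then show "c i * P ^ (n - i) = c i * P ^ (n - Suc i) * P" by simp
    qed simp
    finally have "(w - 1) / P = (\<Sum>i<n. c i * P ^ (n - Suc i))" using P by simp
    then show ?thesis using c P by auto
  qed
  have wu: "inverse w \<in> Z_loc p"
  proof (rule ccontr)
    assume "inverse w \<notin> Z_loc p"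
    then have "w / P \<in> Z_loc p"
      using Z_loc_divide_p_or_unit[OF prime_p wZ] by (auto simp: P_def)
    then have "w / P - (w - 1) / P \<in> Z_loc p" using w1 by (rule Z.diff_mem)
    then show False
      using inverse_p_notin_Z P by (simp add: P_def field_simps)
  qed
  have w0: "w \<noteq> 0"
  proof
    assume "w = 0"
    then have "- ((w - 1) / P) = inverse P" by (simp add: field_simps)
    then show False
      using inverse_p_notin_Z Z.minus_mem[OF w1] by (simp add: P_def)
  qed
  show "1 - of_nat p * a \<noteq> 0"
    using w0 wG by (auto simp: y_def P_def)
  have "inverse y = G * inverse w" using w0 wG by (auto simp: field_simps)
  moreover have "inverse w \<in> D" using wu Z_loc_subset by auto
  ultimately show "inverse (1 - of_nat p * a) \<in> D"
    using GD by (auto simp: y_def P_def)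
qed

text \<open>
  A nonzero element divides the constant term of one of its integral equations with nonzero
  constant term, and such a constant is a power of \<open>p\<close> up to a unit.
\<close>

lemma divides_p_power:
  assumes y: "y \<in> D" "y \<noteq> 0"
  obtains z j where "z \<in> D" "y * z = of_nat p ^ j"
proof -
  have "\<exists>z\<in>D. \<exists>c\<in>Z_loc p. c \<noteq> 0 \<and> y * z = c"
    if "lead_coeff q = 1" "\<And>i. Polynomial.coeff q i \<in> Z_loc p" "poly q y = 0" for q
    using that
  proof (induction q)
    case 0
    then show ?case by simp
  next
    case (pCons a q)
    have co: "Polynomial.coeff q i \<in> Z_loc p" for i
      using pCons.prems(2)[of "Suc i"] by simp
    have a: "a \<in> Z_loc p" using pCons.prems(2)[of 0] by simp
    show ?case
    proof (cases "a = 0")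
      case True
      then have "q \<noteq> 0" using pCons.hyps by simp
      then have "lead_coeff q = 1" using pCons.prems(1) by simp
      moreover have "poly q y = 0" using pCons.prems(3) True y by simp
      ultimately show ?thesis using pCons.IH co by blast
    next
      case False
      have "poly q y \<in> D" using co Z_loc_subset y by (intro poly_mem) auto
      moreover have "y * - poly q y = a" using pCons.prems(3) by (simp add: add_eq_0_iff)
      ultimately show ?thesis using a False minus_mem by blast
    qed
  qed
  then obtain z c where z: "z \<in> D" "c \<in> Z_loc p" "c \<noteq> 0" "y * z = c"
    using integral_D[OF y(1)] unfolding integral_over_def by blast
  obtain j u where u: "c = of_nat p ^ j * u" "inverse u \<in> Z_loc p" "u \<noteq> 0"
    using Z_loc_p_part[OF prime_p z(2,3)] by metis
  show ?thesis
  proof (rule that)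
    show "z * inverse u \<in> D" using z u Z_loc_subset by auto
    show "y * (z * inverse u) = of_nat p ^ j" using z u by (simp add: field_simps)
  qed
qed

text \<open>
  The denominator of \<open>t\<close> divides some \<open>p\<^sup>j\<close>. Substituting \<open>p\<^sup>j t\<close> into an integral equation of it and
  dividing the coefficients by the largest possible power of \<open>p\<close> gives a relation with a unit
  among its coefficients.
\<close>

lemma primitive_relation:
  assumes t: "t \<in> fraction_field D"
  obtains a n where "\<And>i. a i \<in> Z_loc p" "(\<Sum>i\<le>n. a i * t ^ i) = 0"
    "\<exists>i\<le>n. a i / of_nat p \<notin> Z_loc p"
proof -
  define P where "P = (of_nat p :: 'k)"
  have P: "P \<in> Z_loc p" "P \<in> D" "P \<noteq> 0" by (auto simp: P_def)
  obtain x y where xy: "x \<in> D" "y \<in> D" "y \<noteq> 0" "t = x / y"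
    using t unfolding fraction_field_def by auto
  obtain z j where z: "z \<in> D" "y * z = P ^ j"
    using divides_p_power[OF xy(2,3)] unfolding P_def by blast
  have "P ^ j * t \<in> D"
    using xy z(1) by (simp flip: z(2)) auto
  then obtain q where q: "lead_coeff q = 1" "\<And>i. Polynomial.coeff q i \<in> Z_loc p" "poly q (P ^ j * t) = 0"
    using integral_D unfolding integral_over_def by blast
  define n where "n = Polynomial.degree q"
  define c where "c i = Polynomial.coeff q i * (P ^ j) ^ i" for i
  have rel: "(\<Sum>i\<le>n. c i * t ^ i) = 0"
    using q(3) by (simp add: poly_altdef n_def c_def power_mult_distrib mult_ac)
  have c: "c i \<in> Z_loc p" for i using q(2) P by (auto simp: c_def)
  define A where "A = {m. \<forall>i. c i / P ^ m \<in> Z_loc p}"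
  have "0 \<in> A" using c by (auto simp: A_def)
  have "m \<le> j * n" if "m \<in> A" for m
  proof (rule ccontr)
    assume "\<not> m \<le> j * n"
    then obtain k where k: "m = Suc (j * n + k)" by (metis less_imp_Suc_add not_le_imp_less)
    have "c n / P ^ m = inverse (P ^ Suc k)"
      using q(1) P by (simp add: c_def n_def k power_add power_mult field_simps)
    then have "inverse (P ^ Suc k) * P ^ k \<in> Z_loc p"
      using that P by (metis (mono_tags, lifting) A_def Z.mult_mem Z.power_mem mem_Collect_eq)
    then show False using inverse_p_notin_Z P by (simp add: P_def field_simps)
  qed
  then have "finite A" by (meson finite_nat_set_iff_bounded_le)
  define m where "m = Max A"
  have m: "m \<in> A" unfolding m_def using \<open>finite A\<close> \<open>0 \<in> A\<close> by (intro Max_in) auto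
  have "Suc m \<notin> A"
    using Max_ge[OF \<open>finite A\<close>, of "Suc m"] by (auto simp: m_def)
  then obtain i where i: "c i / P ^ m / P \<notin> Z_loc p" by (auto simp: A_def mult.commute)
  show ?thesis
  proof (rule that)
    show "c i / P ^ m \<in> Z_loc p" for i using m by (auto simp: A_def)
    show "(\<Sum>i\<le>n. c i / P ^ m * t ^ i) = 0"
      using rel by (simp flip: sum_divide_distrib)
    have "i \<le> n"
    proof (rule ccontr)
      assume "\<not> i \<le> n"
      then have "c i = 0" by (simp add: c_def n_def coeff_eq_0)
      then show False using i by simp
    qed
    then show "\<exists>i\<le>n. c i / P ^ m / of_nat p \<notin> Z_loc p" using i by (auto simp: P_def)
  qed
qed

end

section \<open>The localization at a prime above \<open>p\<close>\<close>

locale prime_above = integral_over_Z_loc D p for D :: "'k::field_char_0 set" and p +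
  fixes P :: "'k set"
  assumes prime_above: "P \<in> primes_above D p"
begin

lemma P_subset: "P \<subseteq> D" and P_zero: "0 \<in> P"
  and P_add: "x \<in> P \<Longrightarrow> y \<in> P \<Longrightarrow> x + y \<in> P"
  and P_mult: "x \<in> D \<Longrightarrow> y \<in> P \<Longrightarrow> x * y \<in> P"
  and one_notin_P: "1 \<notin> P"
  and P_prime: "x \<in> D \<Longrightarrow> y \<in> D \<Longrightarrow> x * y \<in> P \<Longrightarrow> x \<in> P \<or> y \<in> P"
  and p_in_P: "of_nat p \<in> P"
  using prime_above
  by (auto simp: primes_above_def primeideal_ring_on_iff[OF type_subring_axioms]
      ideal_ring_on_iff[OF type_subring_axioms])

lemma P_minus: "x \<in> P \<Longrightarrow> - x \<in> P"
  using P_mult[of "- 1" x] by auto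

lemma P_mult': "x \<in> P \<Longrightarrow> y \<in> D \<Longrightarrow> x * y \<in> P"
  using P_mult[of y x] by (simp add: mult.commute)

lemma P_diff: "x \<in> P \<Longrightarrow> y \<in> P \<Longrightarrow> x - y \<in> P"
  using P_add[of x "- y"] P_minus by simp

lemma P_prime_power: "x \<in> D \<Longrightarrow> x ^ n \<in> P \<Longrightarrow> x \<in> P"
  by (induction n) (use one_notin_P P_prime in auto)

definition V :: "'k set" where "V = localization_at_prime D P"

text \<open>The maximal ideal of \<^term>\<open>V\<close>.\<close>

definition M :: "'k set" where "M = {x / y | x y. x \<in> P \<and> y \<in> D - P}"

lemma V_I: "x \<in> D \<Longrightarrow> y \<in> D \<Longrightarrow> y \<notin> P \<Longrightarrow> x / y \<in> V"
  unfolding V_def localization_at_prime_def by auto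

lemma V_E:
  assumes "t \<in> V"
  obtains x y where "x \<in> D" "y \<in> D" "y \<notin> P" "y \<noteq> 0" "t = x / y"
  using assms P_zero unfolding V_def localization_at_prime_def by auto

lemma M_I: "x \<in> P \<Longrightarrow> y \<in> D \<Longrightarrow> y \<notin> P \<Longrightarrow> x / y \<in> M"
  unfolding M_def by auto

lemma M_E:
  assumes "t \<in> M"
  obtains x y where "x \<in> P" "y \<in> D" "y \<notin> P" "y \<noteq> 0" "t = x / y"
  using assms P_zero unfolding M_def by auto

lemma D_subset_V: "D \<subseteq> V"
  using V_I[of _ 1] one_notin_P by auto

lemma M_subset_V: "M \<subseteq> V"
  using P_subset by (auto elim!: M_E intro: V_I)

sublocale V: type_subring V
proof
  show "0 \<in> V" "1 \<in> V" using D_subset_V by auto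
  fix a b assume "a \<in> V" "b \<in> V"
  then obtain x y z w where d: "x \<in> D" "y \<in> D" "y \<notin> P" "y \<noteq> 0" "a = x / y"
      "z \<in> D" "w \<in> D" "w \<notin> P" "w \<noteq> 0" "b = z / w" by (metis V_E)
  have "y * w \<in> D" "y * w \<notin> P" using d P_prime by auto
  moreover have "a + b = (x * w + z * y) / (y * w)" "a * b = (x * z) / (y * w)"
    using d by (auto simp: field_simps)
  moreover have "x * w + z * y \<in> D" "x * z \<in> D" using d by auto
  ultimately show "a + b \<in> V" "a * b \<in> V" using V_I by metis+
next
  fix a assume "a \<in> V"
  then obtain x y where d: "x \<in> D" "y \<in> D" "y \<notin> P" "y \<noteq> 0" "a = x / y" by (metis V_E)
  then have "- a = (- x) / y" by simp
  then show "- a \<in> V" using V_I d minus_mem by metis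
qed

lemma M_add: "a \<in> M \<Longrightarrow> b \<in> M \<Longrightarrow> a + b \<in> M"
proof -
  assume "a \<in> M" "b \<in> M"
  then obtain x y z w where d: "x \<in> P" "y \<in> D" "y \<notin> P" "y \<noteq> 0" "a = x / y"
      "z \<in> P" "w \<in> D" "w \<notin> P" "w \<noteq> 0" "b = z / w" by (metis M_E)
  have "y * w \<in> D" "y * w \<notin> P" using d P_prime by auto
  moreover have "a + b = (x * w + z * y) / (y * w)" using d by (auto simp: field_simps)
  moreover have "x * w + z * y \<in> P" using d by (intro P_add P_mult')
  ultimately show "a + b \<in> M" using M_I by metis
qed

lemma M_mult: "a \<in> V \<Longrightarrow> b \<in> M \<Longrightarrow> a * b \<in> M"
proof -
  assume "a \<in> V" "b \<in> M"
  then obtain x y z w where d: "x \<in> D" "y \<in> D" "y \<notin> P" "y \<noteq> 0" "a = x / y"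
      "z \<in> P" "w \<in> D" "w \<notin> P" "w \<noteq> 0" "b = z / w" by (metis M_E V_E)
  have "y * w \<in> D" "y * w \<notin> P" using d P_prime by auto
  moreover have "a * b = (x * z) / (y * w)" using d by (auto simp: field_simps)
  moreover have "x * z \<in> P" using d by (intro P_mult)
  ultimately show "a * b \<in> M" using M_I by metis
qed

lemma M_mult': "a \<in> M \<Longrightarrow> b \<in> V \<Longrightarrow> a * b \<in> M"
  using M_mult[of b a] by (simp add: mult.commute)

lemma mem_M_iff: "x \<in> D \<Longrightarrow> x \<in> M \<longleftrightarrow> x \<in> P"
proof
  assume "x \<in> D" "x \<in> M"
  then obtain a b where "a \<in> P" "b \<in> D" "b \<notin> P" "b \<noteq> 0" "x = a / b" by (metis M_E)
  then show "x \<in> P" using P_prime[of x b] \<open>x \<in> D\<close> by (auto simp: field_simps)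
next
  assume "x \<in> P"
  then show "x \<in> M" using M_I[of x 1] one_notin_P by auto
qed

lemma one_notin_M: "1 \<notin> M"
  using mem_M_iff[of 1] one_notin_P by auto

lemma p_in_M: "of_nat p \<in> M"
  using mem_M_iff p_in_P by auto

lemma zero_in_M: "0 \<in> M"
  using mem_M_iff P_zero by auto

text \<open>The unit group of \<^term>\<open>V\<close>.\<close>

definition U :: "'k set" where "U = V - M"

lemma U_I: "t \<in> V \<Longrightarrow> t \<notin> M \<Longrightarrow> t \<in> U" by (simp add: U_def)

lemma U_D: assumes "t \<in> U" shows "t \<in> V" "t \<notin> M" "t \<noteq> 0"
  using assms zero_in_M by (auto simp: U_def)

lemma U_inverse_mem_V: "t \<in> U \<Longrightarrow> inverse t \<in> V"
proof -
  assume t: "t \<in> U"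
  then obtain x y where d: "x \<in> D" "y \<in> D" "y \<notin> P" "y \<noteq> 0" "t = x / y" using U_D by (metis V_E)
  then have "x \<notin> P" using M_I U_D(2)[OF t] by metis
  then show "inverse t \<in> V" using d V_I[of y x] by simp
qed

lemma U_iff: "t \<in> U \<longleftrightarrow> t \<in> V \<and> t \<noteq> 0 \<and> inverse t \<in> V"
  using U_D U_inverse_mem_V one_notin_M M_mult[of "inverse t" t] by (auto intro!: U_I)

lemma one_in_U: "1 \<in> U" by (simp add: U_iff)

lemma U_inverse: "t \<in> U \<Longrightarrow> inverse t \<in> U" by (auto simp: U_iff)

lemma U_mult: "s \<in> U \<Longrightarrow> t \<in> U \<Longrightarrow> s * t \<in> U" by (auto simp: U_iff)

lemma U_power: "t \<in> U \<Longrightarrow> t ^ n \<in> U"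
  by (induction n) (auto simp: one_in_U U_mult)

lemma M_power: "t \<in> M \<Longrightarrow> n > 0 \<Longrightarrow> t ^ n \<in> M"
  using M_mult'[of t "t ^ (n - 1)"] M_subset_V by (cases n) auto

lemma Z_loc_unit_in_U: "u \<in> Z_loc p \<Longrightarrow> inverse u \<in> Z_loc p \<Longrightarrow> u \<noteq> 0 \<Longrightarrow> u \<in> U"
  using Z_loc_subset D_subset_V by (auto simp: U_iff)

text \<open>
  \<^term>\<open>V\<close> is a valuation ring: a primitive relation \<open>\<Sum> a\<^sub>i t\<^sup>i = 0\<close> has a coefficient
  \<open>a\<^sub>i = b\<^sub>i - b\<^bsub>i+1\<^esub> t\<close> outside \<open>P\<close>, so that one of the two terms is a unit of \<^term>\<open>V\<close>.
\<close>

lemma V_or_inverse: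
  assumes t: "t \<in> fraction_field D"
  shows "t \<in> V \<or> inverse t \<in> V"
proof -
  obtain a n where a: "\<And>i. a i \<in> Z_loc p" "(\<Sum>i\<le>n. a i * t ^ i) = 0"
    "\<exists>i\<le>n. a i / of_nat p \<notin> Z_loc p" using primitive_relation[OF t] by metis
  obtain b where b: "\<And>i. i \<le> Suc n \<Longrightarrow> b i \<in> D" "\<And>i. i \<le> Suc n \<Longrightarrow> b i * t \<in> D"
    "\<And>i. i \<le> n \<Longrightarrow> a i = b i - b (Suc i) * t"
    using integrally_closed_horner[OF closed_D type_subring_axioms t _ a(2)] a(1) Z_loc_subset by blast
  obtain i where i: "i \<le> n" "a i / of_nat p \<notin> Z_loc p" using a(3) by auto
  have u: "inverse (a i) \<in> Z_loc p"
    using Z_loc_divide_p_or_unit[OF prime_p a(1)] i by blast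
  have "a i \<noteq> 0" using i by auto
  then have "a i \<in> U" using Z_loc_unit_in_U a(1) u by auto
  then have "a i \<notin> P" using U_D(2) mem_M_iff P_subset by blast
  then consider "b i \<notin> P" | "b (Suc i) * t \<notin> P" using b(3)[OF i(1)] P_diff by auto
  then show ?thesis
  proof cases
    case 1
    then have "b i * t / b i \<in> V" using b i by (intro V_I) auto
    moreover have "b i \<noteq> 0" using 1 P_zero by auto
    ultimately show ?thesis by simp
  next
    case 2
    then have "b (Suc i) / (b (Suc i) * t) \<in> V" using b i by (intro V_I) auto
    moreover have "b (Suc i) * t \<noteq> 0" using 2 P_zero by auto
    ultimately show ?thesis by (simp add: field_simps)
  qed
qed

lemma V_subset_K: "V \<subseteq> fraction_field D"
  using P_zero by (auto elim!: V_E simp: fraction_field_def)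

lemma fraction_field_V: "fraction_field V = fraction_field D"
proof
  show "fraction_field D \<subseteq> fraction_field V"
    using D_subset_V unfolding fraction_field_def by blast
  show "fraction_field V \<subseteq> fraction_field D"
  proof
    fix x assume "x \<in> fraction_field V"
    then obtain a b where "a \<in> V" "b \<in> V" "x = a / b"
      unfolding fraction_field_def by auto
    then show "x \<in> fraction_field D"
      using V_subset_K inverse_mem_K[of b] by (auto simp: divide_inverse)
  qed
qed

end

context integral_over_Z_loc
begin

text \<open>
  The denominators of an element that lies in all the localizations form an ideal which is
  contained in no prime above \<open>p\<close>; all maximal ideals of \<open>D\<close> contain \<open>p\<close>.
\<close>

lemma mem_D_if_mem_localizations:
  assumes x: "\<And>P. P \<in> primes_above D p \<Longrightarrow> x \<in> localization_at_prime D P"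
  shows "x \<in> D"
proof (rule ccontr)
  assume xD: "x \<notin> D"
  define I where "I = {z \<in> D. z * x \<in> D}"
  have "ideal I (ring_on D)"
    unfolding ideal_ring_on_iff[OF type_subring_axioms] I_def
    by (auto simp: distrib_right mult.assoc)
  moreover have "1 \<notin> I" using xD by (auto simp: I_def)
  ultimately obtain P where P: "primeideal P (ring_on D)" "I \<subseteq> P"
    and max: "\<And>J. ideal J (ring_on D) \<Longrightarrow> P \<subseteq> J \<Longrightarrow> 1 \<notin> J \<Longrightarrow> J = P"
    using proper_ideal_le_prime[OF type_subring_axioms] by metis
  note Pi = P(1)[unfolded primeideal_ring_on_iff[OF type_subring_axioms]
      ideal_ring_on_iff[OF type_subring_axioms]]
  define J where "J = {y + of_nat p * a | y a. y \<in> P \<and> a \<in> D}"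
  have "ideal J (ring_on D)"
    unfolding ideal_ring_on_iff[OF type_subring_axioms]
  proof (intro conjI ballI)
    show "J \<subseteq> D" using Pi by (auto simp: J_def)
    show "0 \<in> J" using Pi unfolding J_def by (intro CollectI exI[of _ 0]) auto
  next
    fix a b assume "a \<in> J" "b \<in> J"
    then obtain y c z d where d: "a = y + of_nat p * c" "b = z + of_nat p * d"
      "y \<in> P" "z \<in> P" "c \<in> D" "d \<in> D" by (auto simp: J_def)
    then have "a + b = (y + z) + of_nat p * (c + d)" by (simp add: algebra_simps)
    moreover have "y + z \<in> P" "c + d \<in> D" using d Pi by auto
    ultimately show "a + b \<in> J" unfolding J_def by blast
  next
    fix r a assume "r \<in> D" "a \<in> J"
    then obtain y c where d: "a = y + of_nat p * c" "y \<in> P" "c \<in> D" "r \<in> D" by (auto simp: J_def)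
    then have "r * a = r * y + of_nat p * (r * c)" by (simp add: algebra_simps)
    moreover have "r * y \<in> P" "r * c \<in> D" using d Pi by auto
    ultimately show "r * a \<in> J" unfolding J_def by blast
  qed
  moreover have "P \<subseteq> J"
  proof
    fix y assume "y \<in> P"
    then show "y \<in> J" unfolding J_def by (intro CollectI exI[of _ y] exI[of _ 0]) auto
  qed
  moreover have "1 \<notin> J"
  proof
    assume "1 \<in> J"
    then obtain y a where ya: "1 = y + of_nat p * a" "y \<in> P" "a \<in> D" by (auto simp: J_def)
    then have "y = 1 - of_nat p * a" by (simp add: algebra_simps)
    then have "inverse y \<in> D" "y \<noteq> 0" using one_minus_p_unit ya by auto
    then have "inverse y * y \<in> P" using ya Pi by blast
    then show False using Pi \<open>y \<noteq> 0\<close> by simp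
  qed
  ultimately have "J = P" by (rule max)
  moreover have "of_nat p \<in> J"
    using Pi unfolding J_def by (intro CollectI exI[of _ 0] exI[of _ 1]) auto
  ultimately have Pp: "P \<in> primes_above D p" using P by (auto simp: primes_above_def)
  then interpret prime_above D p P by unfold_locales
  have "x \<in> V" using x[OF Pp] by (simp add: V_def)
  then obtain a b where "a \<in> D" "b \<in> D" "b \<notin> P" "b \<noteq> 0" "x = a / b" by (rule V_E)
  then have "b \<in> I" by (auto simp: I_def)
  then show False using P \<open>b \<notin> P\<close> by auto
qed

end

section \<open>Residue degrees and the size of residue rings\<close>

lemma (in ring) dimension_finite_card_le:
  assumes "dimension n K E" "finite K"
  shows "finite E \<and> card E \<le> card K ^ n"
  using assms
proof (induction n K E rule: dimension.induct)
  case (zero_dim K)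
  then show ?case by simp
next
  case (Suc_dim v E n K)
  then have fin: "finite (K \<times> E)" and c: "card (K \<times> E) \<le> card K * card K ^ n"
    by (auto simp: card_cartesian_product)
  have sub: "line_extension K v E \<subseteq> (\<lambda>(k, e). k \<otimes> v \<oplus> e) ` (K \<times> E)"
  proof
    fix u assume "u \<in> line_extension K v E"
    then obtain k e where "k \<in> K" "e \<in> E" "u = k \<otimes> v \<oplus> e"
      unfolding line_extension_mem_iff by blast
    then show "u \<in> (\<lambda>(k, e). k \<otimes> v \<oplus> e) ` (K \<times> E)"
      by (intro image_eqI[of _ _ "(k, e)"]) simp_all
  qed
  have "card (line_extension K v E) \<le> card (K \<times> E)"
    by (rule surj_card_le[OF fin sub])
  with c have "card (line_extension K v E) \<le> card K ^ Suc n" by simp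
  then show ?case using finite_surj[OF fin sub] by blast
qed

lemma (in ring) finite_carrier_dimension:
  assumes K: "subfield K R" and fin: "finite (carrier R)"
  obtains n where "dimension n K (carrier R)" "n \<le> card (carrier R)"
proof -
  obtain Us where Us: "set Us = carrier R" using fin finite_list by blast
  obtain Vs where Vs: "set Vs \<subseteq> carrier R" "independent K Vs" "Span K Vs = Span K Us"
    using filter_base[OF K, of Us] Us by blast
  have "Span K Us = carrier R"
    using Span_base_incl[OF K, of Us] Span_in_carrier[of K Us] subfieldE(3)[OF K] Us by auto
  then have "dimension (length Vs) K (carrier R)"
    using dimension_independent[OF Vs(2)] Vs(3) by simp
  moreover have "length Vs \<le> card (carrier R)"
    using independent_distinct[OF K Vs(2)] Vs(1) fin
    by (metis card_mono distinct_card)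
  ultimately show ?thesis by (rule that)
qed

context prime_above
begin

lemma ideal_P: "ideal P (ring_on D)"
  using prime_above by (simp add: primes_above_def primeideal.axioms)

abbreviation residue_class :: "'k \<Rightarrow> 'k set" where
  "residue_class x \<equiv> P +>\<^bsub>ring_on D\<^esub> x"

abbreviation residue_ring :: "'k set ring" where
  "residue_ring \<equiv> ring_on D Quot P"

lemma residue_class_eq: "residue_class x = {y + x | y. y \<in> P}"
  by (auto simp: a_r_coset_def' ring_of_type_algebra_def)

lemma residue_class_eq_iff: "residue_class x = residue_class y \<longleftrightarrow> x - y \<in> P"
proof
  assume "residue_class x = residue_class y"
  moreover have "x \<in> residue_class x" using P_zero by (force simp: residue_class_eq)
  ultimately have "x \<in> residue_class y" by simp
  then show "x - y \<in> P" by (auto simp: residue_class_eq)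
next
  assume xy: "x - y \<in> P"
  have "residue_class a \<subseteq> residue_class b" if "a - b \<in> P" for a b
  proof
    fix z assume "z \<in> residue_class a"
    then obtain c where c: "c \<in> P" "z = c + a" by (auto simp: residue_class_eq)
    then have "z = (c + (a - b)) + b" "c + (a - b) \<in> P" using that P_add by auto
    then show "z \<in> residue_class b" unfolding residue_class_eq by blast
  qed
  from this[OF xy] this[of y x] P_minus[OF xy] show "residue_class x = residue_class y" by auto
qed

interpretation resdom: domain residue_ring
  using prime_above by (simp add: primes_above_def primeideal.quotient_is_domain)

interpretation res: ring_hom_ring "ring_on D" residue_ring residue_class
  by (rule ideal.rcos_ring_hom_ring[OF ideal_P])

lemma carrier_residue_ring: "carrier residue_ring = residue_class ` D"
  by (auto simp: FactRing_def A_RCOSETS_def')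

lemma residue_class_add:
  "x \<in> D \<Longrightarrow> y \<in> D \<Longrightarrow> residue_class x \<oplus>\<^bsub>residue_ring\<^esub> residue_class y = residue_class (x + y)"
  using res.hom_add[of x y] by (simp add: ring_of_type_algebra_def)

lemma residue_class_mult:
  "x \<in> D \<Longrightarrow> y \<in> D \<Longrightarrow> residue_class x \<otimes>\<^bsub>residue_ring\<^esub> residue_class y = residue_class (x * y)"
  using res.hom_mult[of x y] by (simp add: ring_of_type_algebra_def)

lemma residue_class_one: "residue_class 1 = \<one>\<^bsub>residue_ring\<^esub>"
  using res.hom_one by (simp add: ring_of_type_algebra_def)

lemma residue_class_zero: "residue_class 0 = \<zero>\<^bsub>residue_ring\<^esub>"
  by (simp add: FactRing_def residue_class_eq)

lemma residue_class_minus: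
  assumes "x \<in> D"
  shows "\<ominus>\<^bsub>residue_ring\<^esub> residue_class x = residue_class (- x)"
proof (rule sym, rule resdom.sum_zero_eq_neg)
  show "residue_class (- x) \<oplus>\<^bsub>residue_ring\<^esub> residue_class x = \<zero>\<^bsub>residue_ring\<^esub>"
    using assms by (simp add: residue_class_add residue_class_zero minus_mem)
qed (use assms in \<open>auto simp: carrier_residue_ring\<close>)

definition prime_subfield :: "'k set set" where
  "prime_subfield = range (\<lambda>n::int. [n] \<cdot>\<^bsub>residue_ring\<^esub> \<one>\<^bsub>residue_ring\<^esub>)"

lemma prime_subfield_eq: "prime_subfield = range (\<lambda>n::int. residue_class (of_int n))"
proof -
  have nat: "[n] \<cdot>\<^bsub>residue_ring\<^esub> \<one>\<^bsub>residue_ring\<^esub> = residue_class (of_nat n)" for n :: nat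
  proof (induction n)
    case 0
    then show ?case by (simp add: residue_class_zero)
  next
    case (Suc n)
    then show ?case
      by (simp add: residue_class_add add.commute flip: residue_class_one)
  qed
  have "[n] \<cdot>\<^bsub>residue_ring\<^esub> \<one>\<^bsub>residue_ring\<^esub> = residue_class (of_int n)" for n :: int
  proof (cases "n < 0")
    case True
    have "residue_class (- of_nat (nat (- n))) = residue_class (of_int n)" using True by simp
    then show ?thesis using True
      by (simp only: add_pow_int_lt nat residue_class_minus of_nat_mem)
  next
    case False
    then have "residue_class (of_nat (nat n)) = residue_class (of_int n)" by simp
    then show ?thesis using False
      by (simp only: add_pow_int_ge not_less nat)
  qed
  then show ?thesis by (simp add: prime_subfield_def)
qed

lemma finite_prime_subfield: "finite prime_subfield" "card prime_subfield \<le> p"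
proof -
  have sub: "prime_subfield \<subseteq> (\<lambda>k. residue_class (of_nat k)) ` {..<p}"
  proof
    fix z assume "z \<in> prime_subfield"
    then obtain n :: int where n: "z = residue_class (of_int n)" by (auto simp: prime_subfield_eq)
    have "n = int (nat (n mod int p)) + int p * (n div int p)"
    proof -
      have "int p > 0" using p_nonzero(1) by linarith
      then have "0 \<le> n mod int p" by (rule pos_mod_sign)
      then show ?thesis by simp
    qed
    then have "(of_int n :: 'k) = of_int (int (nat (n mod int p)) + int p * (n div int p))"
      by (rule arg_cong)
    then have "of_int n - of_nat (nat (n mod int p)) = of_int (n div int p) * (of_nat p :: 'k)"
      by (simp add: mult.commute)
    then have "of_int n - of_nat (nat (n mod int p)) \<in> P"
      using P_mult[OF of_int_mem p_in_P] by simp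
    then have "z = residue_class (of_nat (nat (n mod int p)))"
      by (simp add: n residue_class_eq_iff)
    moreover have "nat (n mod int p) < p"
    proof -
      have "int p > 0" using p_nonzero(1) by linarith
      then have "n mod int p < int p" by (rule pos_mod_bound)
      then show ?thesis using \<open>int p > 0\<close> by linarith
    qed
    ultimately show "z \<in> (\<lambda>k. residue_class (of_nat k)) ` {..<p}" by blast
  qed
  show "finite prime_subfield" using sub finite_surj by blast
  have "card prime_subfield \<le> card ((\<lambda>k. residue_class (of_nat k)) ` {..<p})"
    using sub by (intro card_mono) auto
  also have "\<dots> \<le> p" using card_image_le[of "{..<p}"] by simp
  finally show "card prime_subfield \<le> p" .
qed

text \<open>
  An integer that is not divisible by \<open>p\<close> has an inverse modulo \<open>p\<close>, hence modulo \<open>P\<close>. That the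
  integers form a subfield makes the dimension over them well defined.
\<close>

lemma subfield_prime_subfield: "subfield prime_subfield residue_ring"
proof (rule resdom.subfieldI)
  have mem: "residue_class (of_int n) \<in> prime_subfield" for n by (simp add: prime_subfield_eq)
  have sub: "subring prime_subfield residue_ring"
  proof (rule resdom.subringI)
    show "prime_subfield \<subseteq> carrier residue_ring"
      by (auto simp: prime_subfield_eq carrier_residue_ring)
    show "\<one>\<^bsub>residue_ring\<^esub> \<in> prime_subfield" using mem[of 1] by (simp add: residue_class_one)
    fix h assume "h \<in> prime_subfield"
    then obtain m where m: "h = residue_class (of_int m)" by (auto simp: prime_subfield_eq)
    show "\<ominus>\<^bsub>residue_ring\<^esub> h \<in> prime_subfield"
      using mem[of "- m"] by (simp add: m residue_class_minus)
    fix k assume "k \<in> prime_subfield"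
    then obtain n where n: "k = residue_class (of_int n)" by (auto simp: prime_subfield_eq)
    show "h \<otimes>\<^bsub>residue_ring\<^esub> k \<in> prime_subfield"
      using mem[of "m * n"] by (simp add: m n residue_class_mult)
    show "h \<oplus>\<^bsub>residue_ring\<^esub> k \<in> prime_subfield"
      using mem[of "m + n"] by (simp add: m n residue_class_add)
  qed
  show "subcring prime_subfield residue_ring"
    using sub resdom.subcringI' by blast
  have "\<exists>l\<in>prime_subfield. l \<otimes>\<^bsub>residue_ring\<^esub> k = \<one>\<^bsub>residue_ring\<^esub> \<and> k \<otimes>\<^bsub>residue_ring\<^esub> l = \<one>\<^bsub>residue_ring\<^esub>"
    if k: "k \<in> prime_subfield" "k \<noteq> \<zero>\<^bsub>residue_ring\<^esub>" for k
  proof -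
    obtain n where n: "k = residue_class (of_int n)"
      using k(1) unfolding prime_subfield_eq by blast
    have "\<not> int p dvd n"
    proof
      assume "int p dvd n"
      then obtain m where "n = int p * m" by auto
      then have "(of_int n :: 'k) = of_int m * of_nat p" by simp
      then have "(of_int n :: 'k) - 0 \<in> P" using P_mult[OF of_int_mem p_in_P] by simp
      then have "k = \<zero>\<^bsub>residue_ring\<^esub>" using residue_class_eq_iff n residue_class_zero by metis
      then show False using k(2) by simp
    qed
    then have "coprime (int p) n" using prime_p by (simp add: prime_imp_coprime)
    then obtain u v where uv: "u * int p + v * n = 1"
      using bezout_int[of "int p" n] by (auto simp: coprime_iff_gcd_eq_1)
    have "(of_int (u * int p + v * n) :: 'k) = of_int 1" using uv by (rule arg_cong)
    then have "of_int v * of_int n - 1 = - of_int u * (of_nat p :: 'k)" by (simp add: algebra_simps)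
    then have "of_int v * of_int n - 1 \<in> P" using P_mult[OF minus_mem[OF of_int_mem] p_in_P] by simp
    then have "residue_class (of_int v * of_int n) = \<one>\<^bsub>residue_ring\<^esub>"
      by (simp add: residue_class_eq_iff flip: residue_class_one)
    then show ?thesis
      by (intro bexI[OF _ mem[of v]]) (simp_all add: n residue_class_mult mult.commute)
  qed
  moreover have "l \<otimes>\<^bsub>residue_ring\<^esub> \<zero>\<^bsub>residue_ring\<^esub> \<noteq> \<one>\<^bsub>residue_ring\<^esub>"
    if "l \<in> prime_subfield" for l
  proof -
    have "l \<in> carrier residue_ring" using that subringE(1)[OF sub] by blast
    then have "l \<otimes>\<^bsub>residue_ring\<^esub> \<zero>\<^bsub>residue_ring\<^esub> = \<zero>\<^bsub>residue_ring\<^esub>" by (rule resdom.r_null)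
    then show ?thesis using resdom.one_not_zero by simp
  qed
  ultimately show "Units (residue_ring \<lparr>carrier := prime_subfield\<rparr>) = prime_subfield - {\<zero>\<^bsub>residue_ring\<^esub>}"
    by (auto simp: Units_def)
qed

lemma residue_degree_eq:
  "residue_degree D P =
     (if resdom.finite_dimension prime_subfield (carrier residue_ring)
      then enat (resdom.dim prime_subfield (carrier residue_ring)) else \<infinity>)"
  by (simp add: residue_degree_def prime_subfield_def Let_def)

lemma card_residues_if_residue_degree_le:
  assumes "residue_degree D P \<le> enat B"
  shows "finite (residue_class ` D)" "card (residue_class ` D) \<le> p ^ B"
proof -
  have fd: "resdom.finite_dimension prime_subfield (carrier residue_ring)"
    and le: "resdom.dim prime_subfield (carrier residue_ring) \<le> B"
    using assms by (auto simp: residue_degree_eq split: if_splits)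
  have "resdom.dimension (resdom.dim prime_subfield (carrier residue_ring)) prime_subfield (carrier residue_ring)"
    using resdom.finite_dimensionE[OF subfield_prime_subfield fd] by (simp add: over_def)
  from resdom.dimension_finite_card_le[OF this finite_prime_subfield(1)]
  have c: "finite (residue_class ` D)"
    "card (residue_class ` D) \<le> card prime_subfield ^ resdom.dim prime_subfield (carrier residue_ring)"
    by (auto simp: carrier_residue_ring)
  show "finite (residue_class ` D)" by (rule c)
  note c(2)
  also have "card prime_subfield ^ resdom.dim prime_subfield (carrier residue_ring)
      \<le> p ^ resdom.dim prime_subfield (carrier residue_ring)"
    by (rule power_mono) (use finite_prime_subfield in auto)
  also have "\<dots> \<le> p ^ B" using le p_nonzero(1) by (intro power_increasing) linarith+
  finally show "card (residue_class ` D) \<le> p ^ B" .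
qed

lemma residue_degree_le_if_card_residues:
  assumes "finite (residue_class ` D)" "card (residue_class ` D) \<le> n"
  shows "residue_degree D P \<le> enat n"
proof -
  obtain m where m: "resdom.dimension m prime_subfield (carrier residue_ring)"
    "m \<le> card (carrier residue_ring)"
    by (rule resdom.finite_carrier_dimension[OF subfield_prime_subfield])
      (use assms in \<open>auto simp: carrier_residue_ring\<close>)
  have "resdom.dim prime_subfield (carrier residue_ring) = m"
    using resdom.dimI[OF subfield_prime_subfield m(1)] by (simp add: over_def)
  then show ?thesis
    using m assms resdom.finite_dimensionI[OF m(1)]
    by (auto simp: residue_degree_eq carrier_residue_ring)
qed

text \<open>
  Two of the powers \<open>1, x, \<dots>, x\<^sup>C\<close> are congruent, so that \<open>x\<^sup>d\<close> is congruent to \<open>1\<close> for some positive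
  \<open>d \<le> C\<close>, and \<open>d\<close> divides \<open>C!\<close>.
\<close>

lemma power_fact_congruent_one:
  assumes fin: "finite (residue_class ` D)" and card: "card (residue_class ` D) \<le> C"
    and x: "x \<in> D" "x \<notin> P"
  shows "x ^ fact C - 1 \<in> P"
proof -
  have "\<not> inj_on (\<lambda>i. residue_class (x ^ i)) {..C}"
  proof
    assume "inj_on (\<lambda>i. residue_class (x ^ i)) {..C}"
    then have "card {..C} \<le> card (residue_class ` D)"
      by (rule card_inj_on_le) (use fin x in auto)
    then show False using card by simp
  qed
  then obtain i j where ij: "i < j" "j \<le> C" "residue_class (x ^ i) = residue_class (x ^ j)"
    unfolding inj_on_def by (metis atMost_iff linorder_neqE_nat)
  then have "x ^ j - x ^ i \<in> P" using residue_class_eq_iff by metis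
  moreover have "x ^ j - x ^ i = x ^ i * (x ^ (j - i) - 1)"
    using ij by (simp add: right_diff_distrib flip: power_add)
  ultimately have d: "x ^ (j - i) - 1 \<in> P"
    using P_prime[of "x ^ i" "x ^ (j - i) - 1"] P_prime_power x by auto
  have "j - i dvd fact C" using ij by (intro dvd_fact) auto
  then obtain m where m: "fact C = (j - i) * m" by auto
  have "x ^ fact C - 1 = (x ^ (j - i)) ^ m - 1" by (simp add: m power_mult)
  also have "\<dots> = (x ^ (j - i) - 1) * (\<Sum>k<m. (x ^ (j - i)) ^ k)" by (rule power_diff_1_eq)
  also have "\<dots> \<in> P" using d x by (intro P_mult') auto
  finally show ?thesis .
qed

end

section \<open>Ramification indices\<close>

context prime_above
begin

text \<open>The concrete form of \<^term>\<open>valuation V\<close>.\<close>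

definition v :: "'k \<Rightarrow> 'k set" where "v x = (\<lambda>u. u * x) ` U"

lemma v_eq_iff: "v x = v y \<longleftrightarrow> (\<exists>u\<in>U. x = u * y)"
proof
  assume "v x = v y"
  moreover have "x \<in> v x" using one_in_U unfolding v_def by force
  ultimately show "\<exists>u\<in>U. x = u * y" by (auto simp: v_def)
next
  assume "\<exists>u\<in>U. x = u * y"
  then obtain u where u: "u \<in> U" "x = u * y" by auto
  have "w * y \<in> v x" if "w \<in> U" for w
  proof -
    have "w * y = (w * inverse u) * x" using u U_D(3)[OF u(1)] by simp
    moreover have "w * inverse u \<in> U" using that u U_mult U_inverse by auto
    ultimately show ?thesis unfolding v_def by blast
  qed
  then show "v x = v y" using u U_mult by (auto simp: v_def mult.assoc[symmetric])
qed

lemma Units_V: "Units (ring_on V) = U"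
  unfolding Units_ring_on[OF V.type_subring_axioms] by (auto simp: U_iff)

lemma Units_K: "Units (ring_on (fraction_field D)) = fraction_field D - {0}"
  unfolding Units_ring_on[OF K.type_subring_axioms] using inverse_mem_K by auto

lemma valuation_V: "valuation V x = v x"
proof -
  have "valuation V x = (\<Union>u\<in>U. {u * x})"
    unfolding valuation_def Units_V r_coset_def units_of_def
    by (simp add: ring_of_type_algebra_def)
  then show ?thesis by (auto simp: v_def)
qed

lemma carrier_value_group: "carrier (value_group V) = v ` (fraction_field D - {0})"
proof -
  have "carrier (value_group V) = (\<Union>x\<in>fraction_field D - {0}. {valuation V x})"
    by (simp add: value_group_def FactGroup_def RCOSETS_def valuation_def fraction_field_V
        units_of_carrier Units_K)
  then show ?thesis by (auto simp: valuation_V)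
qed

lemma mult_value_group: "v x \<otimes>\<^bsub>value_group V\<^esub> v y = v (x * y)"
proof -
  have "v x \<otimes>\<^bsub>value_group V\<^esub> v y = (\<Union>a\<in>v x. \<Union>b\<in>v y. {a * b})"
    by (simp add: value_group_def FactGroup_def set_mult_def units_of_def ring_of_type_algebra_def)
  also have "\<dots> = v (x * y)"
  proof
    show "(\<Union>a\<in>v x. \<Union>b\<in>v y. {a * b}) \<subseteq> v (x * y)"
    proof
      fix z assume "z \<in> (\<Union>a\<in>v x. \<Union>b\<in>v y. {a * b})"
      then obtain s t where st: "s \<in> U" "t \<in> U" "z = (s * x) * (t * y)" by (auto simp: v_def)
      then have "z = (s * t) * (x * y)" by (simp add: mult_ac)
      then show "z \<in> v (x * y)" using U_mult st unfolding v_def by blast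
    qed
    show "v (x * y) \<subseteq> (\<Union>a\<in>v x. \<Union>b\<in>v y. {a * b})"
    proof
      fix z assume "z \<in> v (x * y)"
      then obtain s where s: "s \<in> U" "z = (s * x) * (1 * y)" by (auto simp: v_def mult.assoc)
      then show "z \<in> (\<Union>a\<in>v x. \<Union>b\<in>v y. {a * b})" using one_in_U unfolding v_def by blast
    qed
  qed
  finally show ?thesis .
qed

text \<open>The coset of \<open>v x\<close> modulo the value group of the rationals.\<close>

definition rational_coset :: "'k \<Rightarrow> 'k set set" where
  "rational_coset x = {v (of_rat q * x) | q. q \<noteq> 0}"

lemma rational_coset_memI: "q \<noteq> 0 \<Longrightarrow> v (of_rat q * x) \<in> rational_coset x"
  unfolding rational_coset_def by (rule CollectI, rule exI[of _ q]) simp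

lemma rational_coset_memE:
  assumes "z \<in> rational_coset x"
  obtains q where "q \<noteq> 0" "z = v (of_rat q * x)"
  using assms unfolding rational_coset_def by (elim CollectE exE conjE)

lemma ramification_index_eq:
  "ramification_index D P =
     (let A = rational_coset ` (fraction_field D - {0})
      in if finite A then enat (card A) else \<infinity>)"
proof -
  have "{v (of_rat q) |q. q \<noteq> 0} #>\<^bsub>value_group V\<^esub> v x = rational_coset x" for x
  proof -
    have "{v (of_rat q) |q. q \<noteq> 0} #>\<^bsub>value_group V\<^esub> v x
        = {v (of_rat q) \<otimes>\<^bsub>value_group V\<^esub> v x |q. q \<noteq> 0}"
      unfolding r_coset_def by blast
    then show ?thesis by (simp only: mult_value_group rational_coset_def)
  qed
  then have "rcosets\<^bsub>value_group V\<^esub> {v (of_rat q) |q. q \<noteq> 0}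
      = rational_coset ` (fraction_field D - {0})"
    by (auto simp: RCOSETS_def carrier_value_group)
  then show ?thesis
    unfolding ramification_index_def V_def[symmetric] valuation_V group_index_def Let_def by simp
qed

lemma rational_coset_eqD:
  assumes "rational_coset x = rational_coset y"
  obtains q u where "q \<noteq> 0" "u \<in> U" "x = u * of_rat q * y"
proof -
  have "v (of_rat 1 * x) \<in> rational_coset x" by (rule rational_coset_memI) simp
  then have "v x \<in> rational_coset y" using assms by simp
  then obtain q where "q \<noteq> 0" "v x = v (of_rat q * y)" by (rule rational_coset_memE)
  then show ?thesis using that by (auto simp: v_eq_iff mult.assoc)
qed

lemma rational_coset_eqI:
  assumes q: "q \<noteq> 0" and u: "u \<in> U" and x: "x = u * of_rat q * y"
  shows "rational_coset x = rational_coset y"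
proof -
  have e: "v (of_rat r * x) = v (of_rat (r * q) * y)" for r
  proof -
    have "of_rat r * x = u * (of_rat (r * q) * y)" unfolding x of_rat_mult by (simp only: mult_ac)
    then show ?thesis unfolding v_eq_iff using u by (rule bexI)
  qed
  show ?thesis
  proof
    show "rational_coset x \<subseteq> rational_coset y"
    proof
      fix z assume "z \<in> rational_coset x"
      then obtain r where r: "r \<noteq> 0" "z = v (of_rat r * x)" by (rule rational_coset_memE)
      then show "z \<in> rational_coset y"
        using q by (simp only: e) (rule rational_coset_memI, simp)
    qed
    show "rational_coset y \<subseteq> rational_coset x"
    proof
      fix z assume "z \<in> rational_coset y"
      then obtain r where r: "r \<noteq> 0" "z = v (of_rat r * y)" by (rule rational_coset_memE)
      then have z: "z = v (of_rat (r / q) * x)" using q e[of "r / q"] by simp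
      show "z \<in> rational_coset x"
        unfolding z by (rule rational_coset_memI) (use r q in simp)
    qed
  qed
qed

lemma of_rat_p_part:
  assumes "q \<noteq> 0"
  obtains i j u where "of_rat q * of_nat p ^ i = of_nat p ^ j * u" "u \<in> U"
proof -
  obtain i j u where u: "q * of_nat p ^ i = of_nat p ^ j * u" "u \<in> Z_loc p"
    "inverse u \<in> Z_loc p" "u \<noteq> 0" by (rule rat_p_part[OF prime_p assms])
  have "(of_rat (q * of_nat p ^ i) :: 'k) = of_rat (of_nat p ^ j * u)" using u by simp
  then have "of_rat q * of_nat p ^ i = of_nat p ^ j * (of_rat u :: 'k)"
    by (simp add: of_rat_mult of_rat_power)
  moreover have "(of_rat u :: 'k) \<in> U"
    using u of_rat_mem_Z_loc_iff[OF prime_p, of u, where 'k = 'k]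
      of_rat_mem_Z_loc_iff[OF prime_p, of "inverse u", where 'k = 'k]
    by (intro Z_loc_unit_in_U) (auto simp: of_rat_inverse)
  ultimately show ?thesis by (rule that)
qed

text \<open>
  Two of the cosets of \<open>1, x, \<dots>, x\<^sup>B\<close> agree, so that some \<open>x\<^sup>d\<close> with \<open>0 < d \<le> B\<close> has the value of a
  rational number. The exponent of \<open>p\<close> is not negative because \<open>x\<close> lies in \<open>D\<close>.
\<close>

lemma power_fact_if_ramification_index_le:
  assumes "ramification_index D P \<le> enat B" and x: "x \<in> D" "x \<noteq> 0"
  obtains k u where "x ^ fact B = of_nat p ^ k * u" "u \<in> U"
proof -
  let ?A = "rational_coset ` (fraction_field D - {0})"
  have fin: "finite ?A" and card: "card ?A \<le> B"
    using assms(1) by (auto simp: ramification_index_eq Let_def split: if_splits)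
  have "\<not> inj_on (\<lambda>i. rational_coset (x ^ i)) {..B}"
  proof
    assume "inj_on (\<lambda>i. rational_coset (x ^ i)) {..B}"
    then have "card {..B} \<le> card ?A"
      by (rule card_inj_on_le) (use fin x D_subset_K in \<open>auto intro!: imageI\<close>)
    then show False using card by simp
  qed
  then obtain i j where ij: "i < j" "j \<le> B" "rational_coset (x ^ j) = rational_coset (x ^ i)"
    unfolding inj_on_def by (metis atMost_iff linorder_neqE_nat)
  obtain q u where q: "q \<noteq> 0" "u \<in> U" "x ^ j = u * of_rat q * x ^ i"
    by (rule rational_coset_eqD[OF ij(3)])
  have "x ^ j = x ^ (j - i) * x ^ i" using ij by (simp flip: power_add)
  then have e: "x ^ (j - i) = u * of_rat q" using q x by simp
  have "j - i dvd fact B" using ij by (intro dvd_fact) auto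
  then obtain m where m: "fact B = (j - i) * m" by auto
  have e': "x ^ fact B = u ^ m * of_rat (q ^ m)"
    by (simp add: m power_mult e power_mult_distrib of_rat_power)
  obtain a b w where w: "of_rat (q ^ m) * of_nat p ^ a = of_nat p ^ b * w" "w \<in> U"
    using of_rat_p_part[of "q ^ m"] q(1) by auto
  have U: "u ^ m * w \<in> U" using q w U_mult U_power by auto
  have e'': "x ^ fact B * of_nat p ^ a = of_nat p ^ b * (u ^ m * w)"
    using w(1) by (simp add: e' mult_ac)
  have "a \<le> b"
  proof (rule ccontr)
    assume "\<not> a \<le> b"
    then obtain k where k: "a = b + Suc k" by (metis less_imp_Suc_add add_Suc_right not_le_imp_less)
    have "of_nat p ^ b * (x ^ fact B * of_nat p ^ Suc k) = of_nat p ^ b * (u ^ m * w)"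
      using e'' by (simp add: k power_add mult_ac)
    then have "x ^ fact B * of_nat p ^ Suc k = u ^ m * w" by simp
    moreover have "x ^ fact B * of_nat p ^ Suc k \<in> M"
      using x D_subset_V by (intro M_mult V.power_mem M_power p_in_M) auto
    ultimately show False using U U_D by metis
  qed
  then obtain k where k: "b = a + k" by (metis le_Suc_ex)
  have "of_nat p ^ a * x ^ fact B = of_nat p ^ a * (of_nat p ^ k * (u ^ m * w))"
    using e'' by (simp add: k power_add mult_ac)
  then have "x ^ fact B = of_nat p ^ k * (u ^ m * w)" by simp
  then show ?thesis using U that by blast
qed

text \<open>
  If \<open>p\<close> divides the \<open>n\<close>-th power of every nonunit, then a nonunit \<open>\<pi>\<close> for which
  \<open>\<pi>\<^sup>k\<close> divides \<open>p\<close> with \<open>k\<close> as large as possible generates the maximal ideal: otherwise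
  \<open>\<pi>\<close> would be divisible by the square of a nonunit.
\<close>

lemma uniformizer_if_p_divides_powers:
  assumes n: "\<And>t. t \<in> M \<Longrightarrow> t ^ n / of_nat p \<in> V"
  obtains \<pi> k u where "\<pi> \<in> M" "\<pi> \<noteq> 0" "k > 0" "k \<le> n" "u \<in> U" "of_nat p = \<pi> ^ k * u"
    "\<And>t. t \<in> M \<Longrightarrow> t / \<pi> \<in> V"
proof -
  define A where "A = {k. \<exists>t\<in>M. t \<noteq> 0 \<and> of_nat p / t ^ k \<in> V}"
  have A1: "1 \<in> A" unfolding A_def using p_in_M by (intro CollectI bexI[of _ "of_nat p"]) auto
  have An: "k \<le> n" if kA: "k \<in> A" for k
  proof (rule ccontr)
    assume "\<not> k \<le> n"
    then obtain j where j: "k = n + Suc j" by (metis less_imp_Suc_add add_Suc_right not_le_imp_less)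
    obtain t where t: "t \<in> M" "t \<noteq> 0" "of_nat p / t ^ k \<in> V" using kA by (auto simp: A_def)
    have "t ^ n / of_nat p * (of_nat p / t ^ k) \<in> V" using n t by blast
    also have "t ^ n / of_nat p * (of_nat p / t ^ k) = inverse (t ^ Suc j)"
    proof -
      have "t ^ k = t ^ n * t ^ Suc j" by (simp only: j power_add)
      then show ?thesis using t by (simp add: divide_simps del: power_Suc)
    qed
    finally have "inverse (t ^ Suc j) * t ^ Suc j \<in> M"
      using t by (intro M_mult M_power) auto
    then show False using t one_notin_M by (simp del: power_Suc)
  qed
  have fin: "finite A" using An by (meson finite_nat_set_iff_bounded_le)
  define k where "k = Max A"
  have kA: "k \<in> A" and kmax: "\<And>j. j \<in> A \<Longrightarrow> j \<le> k"
    unfolding k_def using fin A1 by (auto intro!: Max_in)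
  have k0: "k > 0" using kmax[OF A1] by simp
  obtain \<pi> where \<pi>: "\<pi> \<in> M" "\<pi> \<noteq> 0" "of_nat p / \<pi> ^ k \<in> V" using kA by (auto simp: A_def)
  have gen: "t / \<pi> \<in> V" if t: "t \<in> M" for t
  proof (rule ccontr)
    assume nt: "t / \<pi> \<notin> V"
    then have t0: "t \<noteq> 0" by auto
    have K: "s \<in> fraction_field D" if "s \<in> M" for s using that M_subset_V V_subset_K by blast
    have "t / \<pi> \<in> fraction_field D"
      using K[OF t] K[OF \<pi>(1)] inverse_mem_K by (auto simp: divide_inverse)
    then have "inverse (t / \<pi>) \<in> V" using V_or_inverse nt by blast
    then have sV: "\<pi> / t \<in> V" by simp
    define s where "s = \<pi> / t"
    have s: "s \<in> M" "s \<noteq> 0" "\<pi> = s * t"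
      using sV U_inverse_mem_V[of s] nt U_I[of s] t0 \<pi> by (auto simp: s_def)
    have "s / t \<in> fraction_field D"
      using K[OF t] K[OF s(1)] inverse_mem_K by (auto simp: divide_inverse)
    then have "s / t \<in> V \<or> inverse (s / t) \<in> V" by (rule V_or_inverse)
    then obtain r where r: "r \<in> M" "r \<noteq> 0" "\<pi> / r ^ 2 \<in> V"
    proof
      assume "s / t \<in> V"
      then show ?thesis using t t0 s by (intro that[of t]) (auto simp: power2_eq_square)
    next
      assume "inverse (s / t) \<in> V"
      then show ?thesis using t t0 s by (intro that[of s]) (auto simp: power2_eq_square)
    qed
    have "of_nat p / \<pi> ^ k * (\<pi> / r ^ 2) ^ k \<in> V" using r \<pi> by blast
    also have "of_nat p / \<pi> ^ k * (\<pi> / r ^ 2) ^ k = of_nat p / r ^ (2 * k)"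
      using \<pi> r by (simp add: power_divide power_mult)
    finally have "2 * k \<in> A" using r by (auto simp: A_def)
    then show False using kmax[of "2 * k"] k0 by simp
  qed
  have U: "of_nat p / \<pi> ^ k \<in> U"
  proof (rule U_I[OF \<pi>(3)])
    show "of_nat p / \<pi> ^ k \<notin> M"
    proof
      assume "of_nat p / \<pi> ^ k \<in> M"
      then have "of_nat p / \<pi> ^ k / \<pi> \<in> V" by (rule gen)
      then have "Suc k \<in> A" using \<pi> by (auto simp: A_def mult.commute)
      then show False using kmax by force
    qed
  qed
  show ?thesis
    by (rule that[OF \<pi>(1,2) k0 An[OF kA] U _ gen]) (use \<pi> in auto)
qed

lemma divides_p_power_V:
  assumes x: "x \<in> V" "x \<noteq> 0"
  obtains m where "of_nat p ^ m / x \<in> V"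
proof -
  obtain a b where ab: "a \<in> D" "b \<in> D" "b \<notin> P" "b \<noteq> 0" "x = a / b" using x(1) by (rule V_E)
  then have "a \<noteq> 0" using x by auto
  then obtain z m where z: "z \<in> D" "a * z = of_nat p ^ m" using divides_p_power[OF ab(1)] by metis
  have "of_nat p ^ m / x = b * z" using \<open>a \<noteq> 0\<close> ab by (simp flip: z(2))
  then show ?thesis using that[of m] ab z D_subset_V by auto
qed

text \<open>
  Every element is a unit times a power of the uniformizer \<open>\<pi>\<close>, after multiplication by a power
  of \<open>p\<close>. Since \<open>\<pi>\<^sup>k\<close> is \<open>p\<close> up to a unit, the cosets of \<open>1, \<pi>, \<dots>, \<pi>\<^bsup>k-1\<^esup>\<close> are all the cosets.
\<close>

lemma ramification_index_le_if_p_divides_powers: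
  assumes n: "\<And>t. t \<in> M \<Longrightarrow> t ^ n / of_nat p \<in> V"
  shows "ramification_index D P \<le> enat n"
proof -
  obtain \<pi> k u where \<pi>: "\<pi> \<in> M" "\<pi> \<noteq> 0" and k: "k > 0" "k \<le> n" and u: "u \<in> U"
    and p: "of_nat p = \<pi> ^ k * u" and gen: "\<And>t. t \<in> M \<Longrightarrow> t / \<pi> \<in> V"
    using uniformizer_if_p_divides_powers[OF n] by metis
  have power: "\<exists>j. x / \<pi> ^ j \<in> U" if x: "x \<in> V" "x \<noteq> 0" for x
  proof -
    obtain m where m: "of_nat p ^ m / x \<in> V" using divides_p_power_V[OF x] .
    define B where "B = {j. x / \<pi> ^ j \<in> V}"
    have "j \<le> k * m" if "j \<in> B" for j
    proof (rule ccontr)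
      assume "\<not> j \<le> k * m"
      then obtain i where i: "j = k * m + Suc i"
        by (metis less_imp_Suc_add add_Suc_right not_le_imp_less)
      have "x / \<pi> ^ j \<in> V" using that by (simp add: B_def)
      then have "x / \<pi> ^ j * (of_nat p ^ m / x) \<in> V" using m by (rule V.mult_mem)
      also have "x / \<pi> ^ j * (of_nat p ^ m / x) = u ^ m / \<pi> ^ Suc i"
      proof -
        have "\<pi> ^ j = (\<pi> ^ k) ^ m * \<pi> ^ Suc i" by (simp only: i power_add power_mult)
        moreover have "of_nat p ^ m = (\<pi> ^ k) ^ m * u ^ m" by (simp only: p power_mult_distrib)
        ultimately show ?thesis using x \<pi> by (simp del: power_Suc)
      qed
      finally have "u ^ m / \<pi> ^ Suc i * \<pi> ^ Suc i \<in> M"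
        using \<pi> by (intro M_mult M_power) auto
      then have "u ^ m \<in> M" using \<pi> by (simp del: power_Suc)
      then show False using U_power[OF u, of m] U_D by blast
    qed
    then have fin: "finite B" by (meson finite_nat_set_iff_bounded_le)
    have "0 \<in> B" using x by (simp add: B_def)
    define j where "j = Max B"
    have j: "j \<in> B" "\<And>i. i \<in> B \<Longrightarrow> i \<le> j"
      unfolding j_def using fin \<open>0 \<in> B\<close> by (auto intro!: Max_in)
    have "x / \<pi> ^ j \<notin> M"
    proof
      assume "x / \<pi> ^ j \<in> M"
      then have "x / \<pi> ^ j / \<pi> \<in> V" by (rule gen)
      then have "Suc j \<in> B" by (simp add: B_def mult.commute)
      then show False using j(2) by force
    qed
    then show ?thesis using U_I j(1) by (auto simp: B_def)
  qed
  have sub: "rational_coset ` (fraction_field D - {0}) \<subseteq> (\<lambda>i. rational_coset (\<pi> ^ i)) ` {..<k}"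
  proof (rule image_subsetI)
    fix x assume "x \<in> fraction_field D - {0}"
    then have x: "x \<in> fraction_field D" "x \<noteq> 0" by auto
    obtain m where m: "of_nat p ^ m * x \<in> V"
    proof (cases "x \<in> V")
      case True
      then show ?thesis by (intro that[of 0]) auto
    next
      case False
      then have "inverse x \<in> V" using V_or_inverse x by blast
      moreover have "inverse x \<noteq> 0" using x by simp
      ultimately obtain m where "of_nat p ^ m / inverse x \<in> V" by (rule divides_p_power_V)
      then show ?thesis by (intro that[of m]) (simp add: divide_inverse)
    qed
    have "of_nat p ^ m * x \<noteq> 0" using x by simp
    then obtain j where j: "of_nat p ^ m * x / \<pi> ^ j \<in> U" using power[OF m] by blast
    define w where "w = of_nat p ^ m * x / \<pi> ^ j"
    define a where "a = j div k"
    define i where "i = j mod k"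
    have "i < k" using k by (simp add: i_def)
    have "j = k * a + i" by (simp add: a_def i_def)
    then have "\<pi> ^ j = (\<pi> ^ k) ^ a * \<pi> ^ i" by (simp only: power_add power_mult)
    moreover have "of_nat p ^ a = (\<pi> ^ k) ^ a * u ^ a" by (simp only: p power_mult_distrib)
    ultimately have "\<pi> ^ j * u ^ a = of_nat p ^ a * \<pi> ^ i" by (simp only: mult_ac)
    then have \<pi>j: "\<pi> ^ j = inverse (u ^ a) * of_nat p ^ a * \<pi> ^ i"
      using U_D(3)[OF u] by (simp add: field_simps)
    have "x = w * \<pi> ^ j / of_nat p ^ m" using \<pi> by (simp add: w_def)
    also have "\<dots> = (w * inverse (u ^ a)) * of_rat (of_nat p ^ a / of_nat p ^ m) * \<pi> ^ i"
      by (simp add: \<pi>j of_rat_divide of_rat_power)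
    finally have x_eq: "x = (w * inverse (u ^ a)) * of_rat (of_nat p ^ a / of_nat p ^ m) * \<pi> ^ i" .
    have "w \<in> U" using j by (simp add: w_def)
    then have "w * inverse (u ^ a) \<in> U" using u by (intro U_mult U_inverse U_power)
    then have "rational_coset x = rational_coset (\<pi> ^ i)"
      by (rule rational_coset_eqI[OF _ _ x_eq, rotated]) simp
    then show "rational_coset x \<in> (\<lambda>i. rational_coset (\<pi> ^ i)) ` {..<k}" using \<open>i < k\<close> by auto
  qed
  then have "finite (rational_coset ` (fraction_field D - {0}))" using finite_surj by blast
  moreover have "card (rational_coset ` (fraction_field D - {0})) \<le> card {..<k}"
    using sub by (intro surj_card_le) auto
  ultimately show ?thesis using k by (simp add: ramification_index_eq)
qed

end

section \<open>Integer-valued polynomials\<close>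

definition ev :: "rat poly \<Rightarrow> 'k::field_char_0 \<Rightarrow> 'k" where
  "ev f d = poly (map_poly of_rat f) d"

lemma ev_pCons [simp]: "ev (pCons a f) d = of_rat a + d * ev f d"
  by (simp add: ev_def map_poly_pCons)

lemma ev_0 [simp]: "ev 0 d = 0"
  by (simp add: ev_def)

lemma ev_1 [simp]: "ev 1 d = 1"
  by (simp add: one_pCons)

lemma ev_add [simp]: "ev (f + g) d = ev f d + ev g d"
proof -
  have "map_poly of_rat (f + g) = map_poly of_rat f + (map_poly of_rat g :: 'a poly)"
    by (rule poly_eqI) (simp add: coeff_map_poly of_rat_add)
  then show ?thesis by (simp add: ev_def)
qed

lemma ev_smult [simp]: "ev (Polynomial.smult c f) d = of_rat c * ev f d"
proof -
  have "map_poly of_rat (Polynomial.smult c f) = Polynomial.smult (of_rat c) (map_poly of_rat f :: 'a poly)"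
    by (rule poly_eqI) (simp add: coeff_map_poly of_rat_mult)
  then show ?thesis by (simp add: ev_def)
qed

lemma ev_mult [simp]: "ev (f * g) d = ev f d * ev g d"
  by (induction f) (simp_all add: algebra_simps)

lemma ev_minus [simp]: "ev (- f) d = - ev f d"
  using ev_smult[of "- 1" f d] by (simp add: of_rat_minus)

lemma ev_diff [simp]: "ev (f - g) d = ev f d - ev g d"
  using ev_add[of f "- g" d] by simp

lemma ev_power [simp]: "ev (f ^ n) d = ev f d ^ n"
  by (induction n) simp_all

lemma ev_prod: "ev (prod f A) d = (\<Prod>i\<in>A. ev (f i) d)"
  by (induction A rule: infinite_finite_induct) simp_all

lemma ev_monom: "ev (Polynomial.monom 1 n) d = d ^ n"
  by (simp add: ev_def map_poly_monom poly_monom)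

lemma ev_eq_sum: "Polynomial.degree f \<le> n \<Longrightarrow> ev f d = (\<Sum>i\<le>n. of_rat (Polynomial.coeff f i) * d ^ i)"
proof -
  assume n: "Polynomial.degree f \<le> n"
  have "ev f d = (\<Sum>i\<le>Polynomial.degree f. of_rat (Polynomial.coeff f i) * d ^ i)"
    by (simp add: ev_def poly_altdef coeff_map_poly degree_map_poly)
  also have "\<dots> = (\<Sum>i\<le>n. of_rat (Polynomial.coeff f i) * d ^ i)"
    using n by (intro sum.mono_neutral_left) (auto simp: coeff_eq_0)
  finally show ?thesis .
qed

lemma Int_Q_iff: "f \<in> Int_Q D \<longleftrightarrow> (\<forall>d\<in>D. ev f d \<in> D)"
  by (simp add: Int_Q_def ev_def)

lemma type_subring_Int_Q:
  assumes "type_subring D" shows "type_subring (Int_Q D)"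
proof -
  interpret type_subring D by (rule assms)
  show ?thesis by unfold_locales (auto simp: Int_Q_iff)
qed

context integral_over_Z_loc
begin

sublocale R: type_subring "Int_Q D"
  by (rule type_subring_Int_Q[OF type_subring_axioms])

lemma of_rat_mem_D: "q \<in> Z_loc p \<Longrightarrow> of_rat q \<in> D"
  using of_rat_mem_Z_loc_iff[OF prime_p, of q] Z_loc_subset by auto

lemma Z_loc_polys_subset: "Z_loc_polys p \<subseteq> Int_Q D"
proof
  fix f assume "f \<in> Z_loc_polys p"
  then have "of_rat (Polynomial.coeff f i) \<in> D" for i
    using of_rat_mem_D by (auto simp: Z_loc_polys_def)
  then show "f \<in> Int_Q D"
    unfolding Int_Q_iff ev_eq_sum[OF order.refl] by auto
qed

lemma Int_Q_divide_p_powerI: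
  assumes "\<And>d P. d \<in> D \<Longrightarrow> P \<in> primes_above D p \<Longrightarrow> ev f d / of_nat p ^ j \<in> localization_at_prime D P"
  shows "Polynomial.smult (1 / of_nat p ^ j) f \<in> Int_Q D"
  unfolding Int_Q_iff
proof
  fix d assume d: "d \<in> D"
  have e: "ev (Polynomial.smult (1 / of_nat p ^ j) f) d = ev f d / of_nat p ^ j"
    by (simp add: of_rat_divide of_rat_power)
  show "ev (Polynomial.smult (1 / of_nat p ^ j) f) d \<in> D"
    unfolding e by (rule mem_D_if_mem_localizations) (rule assms[OF d])
qed

end

section \<open>Bounded residue degrees and ramification indices\<close>

text \<open>
  What the bounds are used for: common exponents, \<open>\<kappa>\<close> for the multiplicative groups of the
  residue fields and \<open>E\<close> for the value groups modulo the value group of the rationals.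
\<close>

locale uniform_exponents = integral_over_Z_loc D p for D :: "'k::field_char_0 set" and p +
  fixes \<kappa> E :: nat
  assumes pos: "\<kappa> > 0" "E > 0"
    and residue_exponent: "prime_above D p P \<Longrightarrow> x \<in> D \<Longrightarrow> x \<notin> P \<Longrightarrow> x ^ \<kappa> - 1 \<in> P"
    and value_exponent: "prime_above D p P \<Longrightarrow> x \<in> D \<Longrightarrow> x \<noteq> 0 \<Longrightarrow>
      \<exists>k. \<exists>u\<in>prime_above.U D P. x ^ E = of_nat p ^ k * u"

lemma (in integral_over_Z_loc) uniform_exponents_if_bounded:
  assumes "bounded_enat (F_set D p)" "bounded_enat (E_set D p)"
  obtains \<kappa> E where "uniform_exponents D p \<kappa> E"
proof -
  obtain B where B: "\<And>P. P \<in> primes_above D p \<Longrightarrow> residue_degree D P \<le> enat B"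
    using assms(1) by (auto simp: bounded_enat_def F_set_def)
  obtain C where C: "\<And>P. P \<in> primes_above D p \<Longrightarrow> ramification_index D P \<le> enat C"
    using assms(2) by (auto simp: bounded_enat_def E_set_def)
  \<comment> \<open>A residue ring of dimension at most \<open>B\<close> has at most \<open>p\<^sup>B\<close> elements.\<close>
  have "uniform_exponents D p (fact (p ^ B)) (fact C)"
  proof
    fix P x assume P: "prime_above D p P" and x: "x \<in> D"
    interpret prime_above D p P by (rule P)
    show "x ^ fact (p ^ B) - 1 \<in> P" if "x \<notin> P"
      using card_residues_if_residue_degree_le[OF B[OF prime_above]] x that
      by (intro power_fact_congruent_one)
    show "\<exists>k. \<exists>u\<in>U. x ^ fact C = of_nat p ^ k * u" if "x \<noteq> 0"
      using power_fact_if_ramification_index_le[OF C[OF prime_above] x that] by metis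
  qed simp_all
  then show ?thesis by (rule that)
qed

locale uniform_prime_above = uniform_exponents D p \<kappa> E + prime_above D p P
  for D :: "'k::field_char_0 set" and p \<kappa> E P
begin

lemma exponents:
  "x \<in> D \<Longrightarrow> x \<notin> P \<Longrightarrow> x ^ \<kappa> - 1 \<in> P"
  "x \<in> D \<Longrightarrow> x \<noteq> 0 \<Longrightarrow> \<exists>k. \<exists>u\<in>U. x ^ E = of_nat p ^ k * u"
  using residue_exponent[OF prime_above_axioms] value_exponent[OF prime_above_axioms] by auto

lemma p_divides_power:
  assumes x: "x \<in> P"
  shows "x ^ E / of_nat p \<in> V"
proof (cases "x = 0")
  case True
  then show ?thesis using pos by (simp add: power_0_left)
next
  case False
  then obtain k u where u: "u \<in> U" "x ^ E = of_nat p ^ k * u" using exponents(2) x P_subset by blast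
  have "x ^ E \<in> M" using x mem_M_iff P_subset pos by (intro M_power) auto
  then have "k \<noteq> 0" using u U_D(2)[OF u(1)] by (cases k) auto
  then obtain j where "k = Suc j" by (cases k) auto
  then have "x ^ E / of_nat p = of_nat p ^ j * u" using u by simp
  then show ?thesis using u U_D(1) by auto
qed

end

context uniform_exponents
begin

lemma uniform_prime_aboveI: "P \<in> primes_above D p \<Longrightarrow> uniform_prime_above D p \<kappa> E P"
  by unfold_locales

text \<open>
  The values of \<open>X\<^bsup>\<kappa>+1\<^esup> - X\<close> lie in every prime above \<open>p\<close>, so that \<open>p\<close> divides their \<open>E\<close>-th
  powers in every localization. Hence \<open>(X\<^bsup>\<kappa>+1\<^esup> - X)\<^sup>E / p\<close> is integer-valued.
\<close>

lemma Int_Q_nontrivial: "Z_loc_polys p \<subset> Int_Q D"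
proof -
  let ?g = "Polynomial.monom 1 (Suc \<kappa>) - Polynomial.monom 1 1 :: rat poly"
  let ?f = "Polynomial.smult (1 / of_nat p ^ 1) (?g ^ E)"
  have "?f \<in> Int_Q D"
  proof (rule Int_Q_divide_p_powerI)
    fix d P assume d: "d \<in> D" and P: "P \<in> primes_above D p"
    interpret uniform_prime_above D p \<kappa> E P using uniform_prime_aboveI[OF P] .
    have "d ^ Suc \<kappa> - d = d * (d ^ \<kappa> - 1)" by (simp add: algebra_simps)
    also have "\<dots> \<in> P"
    proof (cases "d \<in> P")
      case True
      then show ?thesis using d by (intro P_mult') auto
    next
      case False
      then show ?thesis using d exponents(1) by (intro P_mult) auto
    qed
    finally have "d ^ Suc \<kappa> - d \<in> P" .
    then have "(d ^ Suc \<kappa> - d) ^ E / of_nat p \<in> V" by (rule p_divides_power)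
    then show "ev (?g ^ E) d / of_nat p ^ 1 \<in> localization_at_prime D P"
      by (simp add: V_def ev_monom)
  qed
  moreover have "?f \<notin> Z_loc_polys p"
  proof
    assume f: "?f \<in> Z_loc_polys p"
    have "Polynomial.degree ?g = Suc \<kappa>"
      using pos by (intro antisym degree_le le_degree) auto
    then have "lead_coeff ?g = 1" using pos by simp
    then have "lead_coeff (?g ^ E) = 1" by (simp only: lead_coeff_power power_one)
    then have "Polynomial.coeff ?f (Polynomial.degree (?g ^ E)) = inverse (of_nat p)"
      by (simp add: divide_inverse)
    then have "inverse (of_nat p) \<in> (Z_loc p :: rat set)"
      using f unfolding Z_loc_polys_def by (metis (mono_tags, lifting) mem_Collect_eq)
    then show False using inverse_p_notin_Z_loc[OF prime_p, where 'k = rat] by simp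
  qed
  ultimately show ?thesis using Z_loc_polys_subset by blast
qed

end

section \<open>Nontrivial rings of integer-valued polynomials\<close>

text \<open>
  Splitting off a linear factor at one root modulo \<open>P\<close> keeps the other roots, since \<open>P\<close> is prime
  and the roots are incongruent.
\<close>

lemma (in prime_above) coeffs_in_P_if_many_roots:
  assumes "finite S" "S \<subseteq> D" "\<And>x y. x \<in> S \<Longrightarrow> y \<in> S \<Longrightarrow> x \<noteq> y \<Longrightarrow> x - y \<notin> P"
    and "\<And>i. Polynomial.coeff G i \<in> D" "Polynomial.degree G < card S"
    and "\<And>s. s \<in> S \<Longrightarrow> poly G s \<in> P"
  shows "Polynomial.coeff G i \<in> P"
  using assms
proof (induction S arbitrary: G i rule: finite_induct)
  case empty
  then show ?case by simp
next
  case (insert s S)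
  show ?case
  proof (cases "Polynomial.degree G = 0")
    case True
    then obtain c where c: "G = [:c:]" by (rule degree_eq_zeroE)
    then show ?thesis using insert.prems(5)[of s] P_zero by (cases i) simp_all
  next
    case False
    define h where "h = synthetic_div G s"
    have coh: "\<And>i. Polynomial.coeff h i \<in> D"
    proof -
      have s: "s \<in> D" using insert.prems by auto
      have "\<forall>i. Polynomial.coeff (synthetic_div F s) i \<in> D" if "\<And>i. Polynomial.coeff F i \<in> D" for F
        using that
      proof (induction F)
        case 0
        then show ?case by simp
      next
        case (pCons a F)
        have co: "Polynomial.coeff F i \<in> D" for i using pCons.prems[of "Suc i"] by simp
        then have "poly F s \<in> D" using s by (rule poly_mem)
        then show ?case using pCons.IH[OF co] by (auto simp: coeff_pCons split: nat.split)
      qed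
      then show "Polynomial.coeff h i \<in> D" for i using insert.prems(3) by (auto simp: h_def)
    qed
    have G: "G = [:- s, 1:] * h + [:poly G s:]"
      unfolding h_def by (rule synthetic_div_correct'[symmetric])
    have "Polynomial.coeff h i \<in> P" for i
    proof (rule insert.IH)
      show "S \<subseteq> D" "\<And>x y. x \<in> S \<Longrightarrow> y \<in> S \<Longrightarrow> x \<noteq> y \<Longrightarrow> x - y \<notin> P"
        using insert.prems by auto
      show "Polynomial.degree h < card S"
        using insert.prems(4) insert.hyps False by (simp add: h_def degree_synthetic_div)
      fix t assume t: "t \<in> S"
      have "poly G t = poly ([:- s, 1:] * h + [:poly G s:]) t" using G by simp
      then have "(t - s) * poly h t = poly G t - poly G s" by (simp add: algebra_simps)
      then have "(t - s) * poly h t \<in> P" using insert.prems(5) t P_diff by auto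
      moreover have "t - s \<notin> P" using insert.prems(2)[of t s] insert.hyps t by auto
      moreover have "t - s \<in> D" "poly h t \<in> D"
        using t insert.prems(1) coh poly_mem by auto
      ultimately show "poly h t \<in> P" using P_prime by blast
    qed (rule coh)
    moreover have "Polynomial.coeff G i
        = - s * Polynomial.coeff h i + (case i of 0 \<Rightarrow> poly G s | Suc j \<Rightarrow> Polynomial.coeff h j)"
      by (subst G) (simp add: coeff_pCons split: nat.split)
    ultimately show ?thesis
      using insert.prems(1,5) by (auto intro!: P_diff P_mult split: nat.split)
  qed
qed

lemma ex_smult_p_power_mem_Z_loc_polys:
  assumes p: "Factorial_Ring.prime p"
  shows "\<exists>j. Polynomial.smult (of_nat p ^ j) f \<in> Z_loc_polys p"
proof -
  interpret ZQ: type_subring "Z_loc p :: rat set" by (rule type_subring_Z_loc[OF p])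
  have "\<exists>j. \<forall>i. of_nat p ^ j * Polynomial.coeff f i \<in> Z_loc p"
  proof (induction f)
    case 0
    then show ?case by simp
  next
    case (pCons a f)
    then obtain j where j: "\<And>i. of_nat p ^ j * Polynomial.coeff f i \<in> Z_loc p" by auto
    obtain k where k: "of_nat p ^ k * a \<in> Z_loc p"
    proof (cases "a = 0")
      case False
      then obtain i j u where "a * of_nat p ^ i = of_nat p ^ j * u" "u \<in> Z_loc p"
        by (rule rat_p_part[OF p])
      then show ?thesis by (intro that[of i]) (auto simp: mult.commute)
    qed (auto intro: that[of 0])
    have "of_nat p ^ (j + k) * Polynomial.coeff (pCons a f) i \<in> Z_loc p" for i
    proof (cases i)
      case 0
      have "of_nat p ^ j * (of_nat p ^ k * a) \<in> Z_loc p" using k by blast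
      then show ?thesis using 0 by (simp add: power_add mult_ac)
    next
      case (Suc m)
      have "of_nat p ^ k * (of_nat p ^ j * Polynomial.coeff f m) \<in> Z_loc p" using j by blast
      then show ?thesis using Suc by (simp add: power_add mult_ac)
    qed
    then show ?case by blast
  qed
  then show ?thesis by (simp add: Z_loc_polys_def)
qed

text \<open>
  The least power of \<open>p\<close> that clears the denominators of an integer-valued polynomial leaves a
  coefficient that is not divisible by \<open>p\<close>.
\<close>

lemma (in integral_over_Z_loc) witness_if_nontrivial:
  assumes "Z_loc_polys p \<subset> Int_Q D"
  obtains g i where "g \<in> Z_loc_polys p" "\<And>d. d \<in> D \<Longrightarrow> ev g d / of_nat p \<in> D"
    "Polynomial.coeff g i / of_nat p \<notin> Z_loc p"
proof -
  obtain f where f: "f \<in> Int_Q D" "f \<notin> Z_loc_polys p" using assms by auto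
  let ?Q = "\<lambda>j. Polynomial.smult (of_nat p ^ j) f \<in> Z_loc_polys p"
  have ex: "\<exists>j. ?Q j" by (rule ex_smult_p_power_mem_Z_loc_polys[OF prime_p])
  define j where "j = (LEAST j. ?Q j)"
  have j: "?Q j" unfolding j_def using ex by (rule LeastI_ex)
  have "j \<noteq> 0" using j f by (intro notI) simp
  then obtain m where m: "j = Suc m" by (cases j) auto
  then have "\<not> ?Q m" unfolding j_def by (intro not_less_Least) simp
  then obtain i where i: "of_nat p ^ m * Polynomial.coeff f i \<notin> Z_loc p"
    by (auto simp: Z_loc_polys_def)
  show ?thesis
  proof (rule that[OF j])
    show "ev (Polynomial.smult (of_nat p ^ j) f) d / of_nat p \<in> D" if "d \<in> D" for d
    proof -
      have "ev (Polynomial.smult (of_nat p ^ j) f) d / of_nat p = of_nat p ^ m * ev f d"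
        by (simp add: m of_rat_power of_rat_mult)
      then show ?thesis using f that by (auto simp: Int_Q_iff)
    qed
    show "Polynomial.coeff (Polynomial.smult (of_nat p ^ j) f) i / of_nat p \<notin> Z_loc p"
      using i p_nonzero(1) by (simp add: m)
  qed
qed

context prime_above
begin

context
  fixes g :: "rat poly" and i\<^sub>0 :: nat
  assumes g: "g \<in> Z_loc_polys p" and gD: "\<And>d. d \<in> D \<Longrightarrow> ev g d / of_nat p \<in> D"
    and i\<^sub>0: "Polynomial.coeff g i\<^sub>0 / of_nat p \<notin> Z_loc p"
begin

lemma coeff_unit_in_U:
  assumes "Polynomial.coeff g i / of_nat p \<notin> Z_loc p"
  shows "of_rat (Polynomial.coeff g i) \<in> U"
proof -
  let ?a = "Polynomial.coeff g i"
  have a: "?a \<in> Z_loc p" using g by (simp add: Z_loc_polys_def)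
  then have "inverse ?a \<in> Z_loc p" using Z_loc_divide_p_or_unit[OF prime_p a] assms by blast
  moreover have "0 \<in> (Z_loc p :: rat set)"
    by (rule type_subring.zero_mem[OF type_subring_Z_loc[OF prime_p]])
  then have "?a \<noteq> 0" using assms by auto
  ultimately show ?thesis
    using a of_rat_mem_Z_loc_iff[OF prime_p, of ?a, where 'k = 'k]
      of_rat_mem_Z_loc_iff[OF prime_p, of "inverse ?a", where 'k = 'k]
    by (intro Z_loc_unit_in_U) (auto simp: of_rat_inverse)
qed

lemma card_residues_le_degree:
  "finite (residue_class ` D) \<and> card (residue_class ` D) \<le> Polynomial.degree g"
proof (rule ccontr)
  assume n: "\<not> ?thesis"
  have "\<exists>T. finite T \<and> card T = Suc (Polynomial.degree g) \<and> T \<subseteq> residue_class ` D"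
  proof (cases "finite (residue_class ` D)")
    case True
    then have "Suc (Polynomial.degree g) \<le> card (residue_class ` D)" using n by simp
    then obtain T where "T \<subseteq> residue_class ` D" "card T = Suc (Polynomial.degree g)" "finite T"
      by (rule obtain_subset_with_card_n)
    then show ?thesis by (intro exI[of _ T] conjI)
  next
    case False
    from infinite_arbitrarily_large[OF this, of "Suc (Polynomial.degree g)"]
    show ?thesis .
  qed
  then obtain T where T: "finite T" "card T = Suc (Polynomial.degree g)" "T \<subseteq> residue_class ` D" by auto
  obtain S where S: "S \<subseteq> D" "inj_on residue_class S" "T = residue_class ` S"
    using T(3) subset_image_inj[of T residue_class D] by auto
  have finS: "finite S" "card S = Suc (Polynomial.degree g)"
    using S T finite_image_iff card_image by metis+
  let ?G = "map_poly of_rat g :: 'k poly"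
  have "Polynomial.coeff ?G i\<^sub>0 \<in> P"
  proof (rule coeffs_in_P_if_many_roots[OF finS(1) S(1)])
    show "x - y \<notin> P" if "x \<in> S" "y \<in> S" "x \<noteq> y" for x y
      using that S(2) residue_class_eq_iff[of x y] by (auto simp: inj_on_def)
    show "Polynomial.coeff ?G i \<in> D" for i
      using g of_rat_mem_D by (simp add: coeff_map_poly Z_loc_polys_def)
    have "Polynomial.degree ?G = Polynomial.degree g" by (rule degree_map_poly) simp_all
    then show "Polynomial.degree ?G < card S" using finS by simp
    fix s assume "s \<in> S"
    then have "ev g s / of_nat p \<in> D" using S gD by auto
    then have "ev g s / of_nat p * of_nat p \<in> P" using p_in_P by (rule P_mult)
    then show "poly ?G s \<in> P" by (simp add: ev_def)
  qed
  then have "of_rat (Polynomial.coeff g i\<^sub>0) \<in> M"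
    using mem_M_iff P_subset by (auto simp: coeff_map_poly)
  then show False using coeff_unit_in_U[OF i\<^sub>0] U_D by blast
qed

text \<open>
  Otherwise the term \<open>a\<^sub>i x\<^sup>i\<close>, for the least \<open>i\<close> such that \<open>p\<close> does not divide \<open>a\<^sub>i\<close>,
  would dominate \<open>g(x)\<close>, whose value would be less than that of \<open>p\<close>.
\<close>

lemma p_divides_power_degree_P:
  assumes x: "x \<in> P"
  shows "x ^ Polynomial.degree g / of_nat p \<in> V"
proof (rule ccontr)
  let ?n = "Polynomial.degree g"
  assume n: "x ^ ?n / of_nat p \<notin> V"
  define a where "a i = (of_rat (Polynomial.coeff g i) :: 'k)" for i
  define i where "i = (LEAST i. Polynomial.coeff g i / of_nat p \<notin> Z_loc p)"
  have i: "Polynomial.coeff g i / of_nat p \<notin> Z_loc p"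
    unfolding i_def by (rule LeastI) (rule i\<^sub>0)
  have ai: "a i \<in> U" using coeff_unit_in_U[OF i] by (simp add: a_def)
  have aD: "a j \<in> D" for j using g of_rat_mem_D by (simp add: a_def Z_loc_polys_def)
  have small: "a j / of_nat p \<in> D" if "j < i" for j
  proof -
    have "Polynomial.coeff g j / of_nat p \<in> Z_loc p" using not_less_Least that unfolding i_def by blast
    then have "of_rat (Polynomial.coeff g j / of_nat p) \<in> D" by (rule of_rat_mem_D)
    then show ?thesis by (simp add: a_def of_rat_divide)
  qed
  have "a i \<noteq> 0" using ai U_D by blast
  then have "i \<le> ?n" by (intro le_degree) (auto simp: a_def)
  have xD: "x \<in> D" and xV: "x \<in> V" and xM: "x \<in> M" using x P_subset D_subset_V mem_M_iff by auto
  have gx: "ev g x = (\<Sum>j\<le>?n. a j * x ^ j)" by (simp add: ev_eq_sum[OF order.refl] a_def)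
  have gV: "ev g x / of_nat p \<in> V" using gD[OF xD] D_subset_V by blast
  \<comment> \<open>For \<open>x = 0\<close> the polynomial would have degree \<open>0\<close>, and its constant value is not divisible by \<open>p\<close>.\<close>
  have x0: "x \<noteq> 0"
  proof
    assume "x = 0"
    then have "?n = 0" using n by (cases "?n = 0") (auto simp: power_0_left)
    then have "ev g x = a i" using gx \<open>i \<le> ?n\<close> by simp
    then have "a i / of_nat p * of_nat p \<in> M" using gV p_in_M M_mult by metis
    then show False using ai U_D(2) by auto
  qed
  define w where "w = of_nat p / x ^ ?n"
  have "x ^ ?n / of_nat p \<in> fraction_field D"
    using xD D_subset_K inverse_mem_K by (auto simp: divide_inverse)
  then have "inverse (x ^ ?n / of_nat p) \<in> V" using V_or_inverse n by blast
  then have wV: "w \<in> V" by (simp add: w_def)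
  have wM: "w \<in> M"
  proof (rule ccontr)
    assume "w \<notin> M"
    then have "inverse w \<in> V" using wV U_I U_inverse_mem_V by blast
    then show False using n by (simp add: w_def)
  qed
  have pxi: "of_nat p / x ^ i \<in> M"
  proof -
    have "x ^ ?n = x ^ (?n - i) * x ^ i" using \<open>i \<le> ?n\<close> by (simp flip: power_add)
    then have "of_nat p / x ^ i = x ^ (?n - i) * w" using x0 by (simp add: w_def)
    then show ?thesis using xV wM by (auto intro: M_mult)
  qed
  have sum_M: "sum f A \<in> M" if "\<And>i. i \<in> A \<Longrightarrow> f i \<in> M" for f and A :: "nat set"
    using that by (induction A rule: infinite_finite_induct) (auto simp: zero_in_M M_add)
  have "a j * x ^ j / x ^ i \<in> M" if j: "j \<in> {..?n} - {i}" for j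
  proof (cases "j < i")
    case True
    have "a j * x ^ j / x ^ i = (a j / of_nat p * x ^ j) * (of_nat p / x ^ i)" by simp
    moreover have "a j / of_nat p * x ^ j \<in> V" using small[OF True] xV D_subset_V by blast
    ultimately show ?thesis using pxi M_mult by metis
  next
    case False
    then have "i < j" using j by auto
    then have "x ^ j = x ^ (j - i) * x ^ i" by (simp flip: power_add)
    then have "a j * x ^ j / x ^ i = a j * x ^ (j - i)" using x0 by simp
    then show ?thesis using \<open>i < j\<close> aD D_subset_V xM by (auto intro!: M_mult M_power)
  qed
  then have rest: "(\<Sum>j\<in>{..?n} - {i}. a j * x ^ j / x ^ i) \<in> M" by (rule sum_M)
  have "ev g x / x ^ i = (\<Sum>j\<le>?n. a j * x ^ j / x ^ i)" by (simp add: gx sum_divide_distrib)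
  also have "\<dots> = a i + (\<Sum>j\<in>{..?n} - {i}. a j * x ^ j / x ^ i)"
    using \<open>i \<le> ?n\<close> x0 by (subst sum.remove[of _ i]) auto
  finally have "a i = ev g x / x ^ i - (\<Sum>j\<in>{..?n} - {i}. a j * x ^ j / x ^ i)" by simp
  also have "ev g x / x ^ i = (ev g x / of_nat p) * (of_nat p / x ^ i)" by simp
  also have "\<dots> - (\<Sum>j\<in>{..?n} - {i}. a j * x ^ j / x ^ i) \<in> M"
  proof -
    have "- y \<in> M" if "y \<in> M" for y using M_mult[of "- 1" y] that by auto
    then show ?thesis using M_add[OF M_mult[OF gV pxi]] rest by (metis diff_conv_add_uminus)
  qed
  finally show False using ai U_D(2) by blast
qed

lemma p_divides_power_degree:
  assumes t: "t \<in> M"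
  shows "t ^ Polynomial.degree g / of_nat p \<in> V"
proof -
  obtain x y where xy: "x \<in> P" "y \<in> D" "y \<notin> P" "y \<noteq> 0" "t = x / y" using t by (rule M_E)
  have "t ^ Polynomial.degree g / of_nat p
      = (x ^ Polynomial.degree g / of_nat p) * (1 / y) ^ Polynomial.degree g"
    by (simp add: xy power_divide)
  also have "\<dots> \<in> V"
    by (intro V.mult_mem V.power_mem p_divides_power_degree_P V_I) (use xy in auto)
  finally show ?thesis .
qed

end

end

theorem (in integral_over_Z_loc) bounded_if_nontrivial:
  assumes "Z_loc_polys p \<subset> Int_Q D"
  shows "bounded_enat (F_set D p)" "bounded_enat (E_set D p)"
proof -
  obtain g i where g: "g \<in> Z_loc_polys p" "\<And>d. d \<in> D \<Longrightarrow> ev g d / of_nat p \<in> D"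
    "Polynomial.coeff g i / of_nat p \<notin> Z_loc p" using witness_if_nontrivial[OF assms] by metis
  have "residue_degree D P \<le> enat (Polynomial.degree g)
      \<and> ramification_index D P \<le> enat (Polynomial.degree g)" if "P \<in> primes_above D p" for P
  proof -
    interpret prime_above D p P using that by unfold_locales
    have "residue_degree D P \<le> enat (Polynomial.degree g)"
      by (rule residue_degree_le_if_card_residues) (use card_residues_le_degree[OF g] in simp_all)
    moreover have "ramification_index D P \<le> enat (Polynomial.degree g)"
      by (rule ramification_index_le_if_p_divides_powers) (rule p_divides_power_degree[OF g])
    ultimately show ?thesis by simp
  qed
  then show "bounded_enat (F_set D p)" "bounded_enat (E_set D p)"
    by (auto simp: bounded_enat_def F_set_def E_set_def)
qed

section \<open>Invertible ideals\<close>

lemma genideal_ring_on: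
  assumes "type_subring R" "S \<subseteq> R"
  shows "ideal (genideal (ring_on R) S) (ring_on R)" "S \<subseteq> genideal (ring_on R) S"
    "\<And>I. ideal I (ring_on R) \<Longrightarrow> S \<subseteq> I \<Longrightarrow> genideal (ring_on R) S \<subseteq> I"
proof -
  interpret T: cring "ring_on R" by (rule cring_ring_on[OF assms(1)])
  show "ideal (genideal (ring_on R) S) (ring_on R)"
    by (rule T.genideal_ideal) (use assms in simp)
  show "S \<subseteq> genideal (ring_on R) S"
    by (rule T.genideal_self) (use assms in simp)
  show "genideal (ring_on R) S \<subseteq> I" if "ideal I (ring_on R)" "S \<subseteq> I" for I
    by (rule T.genideal_minimal) (use that in auto)
qed

lemma ideal_prod_subset:
  fixes I J N :: "'k::field set"
  assumes "\<And>x y. x \<in> I \<Longrightarrow> y \<in> J \<Longrightarrow> x * y \<in> N" "\<And>x y. x \<in> N \<Longrightarrow> y \<in> N \<Longrightarrow> x + y \<in> N"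
  shows "ideal_prod (ring_of_type_algebra :: 'k ring) I J \<subseteq> N"
proof
  fix x assume "x \<in> ideal_prod (ring_of_type_algebra :: 'k ring) I J"
  then show "x \<in> N"
    by (induction rule: ideal_prod.induct) (auto simp: ring_of_type_algebra_def assms)
qed

lemma sum_mem_ideal_prod:
  fixes I J :: "'k::field set"
  assumes "finite A" "A \<noteq> {}" "\<And>i. i \<in> A \<Longrightarrow> f i \<in> I" "\<And>i. i \<in> A \<Longrightarrow> g i \<in> J"
  shows "(\<Sum>i\<in>A. f i * g i) \<in> ideal_prod (ring_of_type_algebra :: 'k ring) I J"
  using assms
proof (induction rule: finite_ne_induct)
  case (singleton i)
  then show ?case using ideal_prod.prod[of "f i" I "g i" J ring_of_type_algebra]
    by (simp add: ring_of_type_algebra_def)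
next
  case (insert i A)
  have "f i * g i \<in> ideal_prod (ring_of_type_algebra :: 'k ring) I J"
    using insert.prems ideal_prod.prod[of "f i" I "g i" J ring_of_type_algebra]
    by (simp add: ring_of_type_algebra_def)
  moreover have "(\<Sum>i\<in>A. f i * g i) \<in> ideal_prod (ring_of_type_algebra :: 'k ring) I J"
    using insert by auto
  ultimately show ?case
    using insert.hyps ideal_prod.sum[of "f i * g i" ring_of_type_algebra I J "\<Sum>i\<in>A. f i * g i"]
    by (simp add: ring_of_type_algebra_def)
qed

text \<open>
  Generators \<open>a\<^sub>i\<close> of an ideal and elements \<open>y\<^sub>i\<close> of its inverse with
  \<open>\<Sum> a\<^sub>i y\<^sub>i = 1\<close> witness that the ideal is invertible.
\<close>

lemma invertible_ideal_genidealI: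
  fixes R :: "'k::field set"
  assumes R: "type_subring R" and S: "finite S" "S \<subseteq> R"
    and y: "\<And>s t. s \<in> S \<Longrightarrow> t \<in> S \<Longrightarrow> y s * t \<in> R" and one: "(\<Sum>s\<in>S. s * y s) = 1"
    and K: "\<And>s. s \<in> S \<Longrightarrow> y s \<in> fraction_field R"
  shows "invertible_ideal R (genideal (ring_on R) S)"
proof -
  interpret type_subring R by (rule R)
  let ?I = "genideal (ring_on R) S"
  note I = genideal_ring_on[OF R S(2)]
  note Ii = I(1)[unfolded ideal_ring_on_iff[OF R]]
  let ?J = "fractional_inverse R ?I"
  have yJ: "y s \<in> ?J" if s: "s \<in> S" for s
  proof -
    let ?N = "{t \<in> R. y s * t \<in> R}"
    have "ideal ?N (ring_on R)"
      unfolding ideal_ring_on_iff[OF R]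
    proof (intro conjI ballI)
      fix r x assume "r \<in> R" "x \<in> ?N"
      then have "r * (y s * x) \<in> R" by auto
      then show "r * x \<in> ?N" using \<open>r \<in> R\<close> \<open>x \<in> ?N\<close> by (auto simp: mult_ac)
    qed (auto simp: distrib_left)
    then have "?I \<subseteq> ?N" by (rule I(3)) (use S y s in auto)
    then show ?thesis using K[OF s] by (auto simp: fractional_inverse_def)
  qed
  have "S \<noteq> {}" using one by auto
  then have "1 \<in> ideal_prod (ring_of_type_algebra :: 'k ring) ?I ?J"
    using sum_mem_ideal_prod[of S "\<lambda>s. s" ?I y ?J] S(1) I(2) yJ one by auto
  moreover have "r * x \<in> ideal_prod (ring_of_type_algebra :: 'k ring) ?I ?J"
    if "x \<in> ideal_prod (ring_of_type_algebra :: 'k ring) ?I ?J" "r \<in> R" for r x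
    using that(1)
  proof (induction rule: ideal_prod.induct)
    case (prod i j)
    then have "r * i \<in> ?I" using Ii that(2) by blast
    from ideal_prod.prod[OF this prod(2), of "ring_of_type_algebra :: 'k ring"]
    show ?case by (simp add: ring_of_type_algebra_def mult.assoc)
  next
    case (sum s t)
    from ideal_prod.sum[OF sum.IH] show ?case by (simp add: ring_of_type_algebra_def distrib_left)
  qed
  ultimately have "R \<subseteq> ideal_prod (ring_of_type_algebra :: 'k ring) ?I ?J" by force
  moreover have "ideal_prod (ring_of_type_algebra :: 'k ring) ?I ?J \<subseteq> R"
    by (rule ideal_prod_subset) (auto simp: fractional_inverse_def mult.commute)
  ultimately show ?thesis by (auto simp: invertible_ideal_def)
qed

lemma type_subring_to_fract:
  assumes "type_subring R" shows "type_subring (to_fract ` R)"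
proof -
  interpret type_subring R by (rule assms)
  show ?thesis
  proof
    show "0 \<in> to_fract ` R" "1 \<in> to_fract ` R"
      by (auto intro!: image_eqI[of _ _ 0] image_eqI[of _ _ 1])
  next
    fix x y assume "x \<in> to_fract ` R" "y \<in> to_fract ` R"
    then show "x + y \<in> to_fract ` R" "x * y \<in> to_fract ` R"
      by (auto simp flip: to_fract_add to_fract_mult)
  next
    fix x assume "x \<in> to_fract ` R"
    then show "- x \<in> to_fract ` R" by (auto simp flip: to_fract_uminus)
  qed
qed

section \<open>The trivial ring of integer-valued polynomials\<close>

text \<open>
  In \<open>\<int>\<^bsub>(p)\<^esub>[X]\<close> the ideal \<open>(p, X)\<close> is its own product with its inverse: the inverse is
  the whole ring because \<open>p\<close> and \<open>X\<close> have no common factor.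
\<close>

lemma not_pruefer_domain_Z_loc_polys:
  assumes p: "Factorial_Ring.prime p"
  shows "\<not> pruefer_domain (to_fract ` Z_loc_polys p)"
proof
  assume pr: "pruefer_domain (to_fract ` Z_loc_polys p)"
  interpret Z: type_subring "Z_loc p :: rat set" by (rule type_subring_Z_loc[OF p])
  let ?R = "to_fract ` Z_loc_polys p"
  have R: "type_subring ?R"
    using pr by (simp add: pruefer_domain_def subring_iff_type_subring)
  define N where "N = to_fract ` {f \<in> Z_loc_polys p. Polynomial.coeff f 0 / of_nat p \<in> Z_loc p}"
  let ?c = "[:of_nat p:] :: rat poly"
  let ?x = "[:0, 1:] :: rat poly"
  let ?S = "{to_fract ?c, to_fract ?x}"
  have p0: "p \<noteq> 0" using p by auto
  have mem: "?c \<in> Z_loc_polys p" "?x \<in> Z_loc_polys p"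
    by (auto simp: Z_loc_polys_def coeff_pCons split: nat.split)
  have SR: "?S \<subseteq> ?R" using mem by blast
  note I = genideal_ring_on[OF R SR]
  let ?I = "genideal (ring_on ?R) ?S"
  have "to_fract ?x \<in> ?I" using I(2) by blast
  moreover have "to_fract ?x \<noteq> 0" by simp
  ultimately have "?I \<noteq> {0}" by (metis singletonD)
  then have inv: "ideal_prod (ring_of_type_algebra :: rat poly fract ring) ?I (fractional_inverse ?R ?I) = ?R"
    using pr SR unfolding pruefer_domain_def invertible_ideal_def by simp
  have N_add: "x + y \<in> N" if xy: "x \<in> N" "y \<in> N" for x y
  proof -
    obtain f g where "f \<in> Z_loc_polys p" "g \<in> Z_loc_polys p" "x = to_fract f" "y = to_fract g"
      "Polynomial.coeff f 0 / of_nat p \<in> Z_loc p" "Polynomial.coeff g 0 / of_nat p \<in> Z_loc p"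
      using xy by (auto simp: N_def)
    then show ?thesis unfolding N_def
      by (intro image_eqI[of _ _ "f + g"]) (auto simp: Z_loc_polys_def add_divide_distrib)
  qed
  have N_mult: "x * y \<in> N" if xy: "x \<in> N" "y \<in> ?R" for x y
  proof -
    obtain f g where fg: "f \<in> Z_loc_polys p" "g \<in> Z_loc_polys p" "x = to_fract f" "y = to_fract g"
      "Polynomial.coeff f 0 / of_nat p \<in> Z_loc p"
      using xy by (auto simp: N_def)
    have "Polynomial.coeff f 0 / of_nat p * Polynomial.coeff g 0 \<in> Z_loc p"
      by (rule Z.mult_mem) (use fg in \<open>auto simp: Z_loc_polys_def\<close>)
    then have "Polynomial.coeff (f * g) 0 / of_nat p \<in> Z_loc p" by (simp add: coeff_mult_0)
    moreover have "f * g \<in> Z_loc_polys p"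
      using fg by (auto simp: Z_loc_polys_def coeff_mult)
    ultimately show ?thesis unfolding N_def
      using fg by (intro image_eqI[of _ _ "f * g"]) simp_all
  qed
  have "ideal N (ring_on ?R)"
    unfolding ideal_ring_on_iff[OF R]
  proof (intro conjI ballI)
    show "N \<subseteq> ?R" by (auto simp: N_def)
    show "0 \<in> N" unfolding N_def by (intro image_eqI[of _ _ 0]) (auto simp: Z_loc_polys_def)
    show "r * x \<in> N" if "r \<in> ?R" "x \<in> N" for r x
      using N_mult[OF that(2,1)] by (simp add: mult.commute)
  qed (rule N_add)
  moreover have "?S \<subseteq> N" using mem p0 by (auto simp: N_def)
  ultimately have IN: "?I \<subseteq> N" by (rule I(3))
  have JR: "fractional_inverse ?R ?I \<subseteq> ?R"
  proof
    fix y assume y: "y \<in> fractional_inverse ?R ?I"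
    then have "y * to_fract ?c \<in> ?R" "y * to_fract ?x \<in> ?R"
      using I(2) by (auto simp: fractional_inverse_def)
    then obtain u w where uw: "y * to_fract ?c = to_fract u" "y * to_fract ?x = to_fract w"
      "u \<in> Z_loc_polys p" "w \<in> Z_loc_polys p" by auto
    have "to_fract (?x * u) = to_fract (?c * w)"
      by (simp add: uw(1,2)[symmetric] mult_ac del: mult_pCons_left mult_pCons_right)
    then have e: "?x * u = ?c * w" unfolding to_fract_eq_iff .
    have co: "Polynomial.coeff u i = of_nat p * Polynomial.coeff w (Suc i)" for i
      using arg_cong[OF e, of "\<lambda>f. Polynomial.coeff f (Suc i)"] by simp
    define z where "z = Polynomial.smult (1 / of_nat p) u"
    have "Polynomial.coeff z i = Polynomial.coeff w (Suc i)" for i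
      using p0 by (simp add: z_def co)
    then have "z \<in> Z_loc_polys p" using uw(4) by (simp add: Z_loc_polys_def)
    moreover have "?c * z = u" using p0 by (simp add: z_def)
    then have "y * to_fract ?c = to_fract z * to_fract ?c"
      unfolding uw(1) by (metis mult.commute to_fract_mult)
    then have "y = to_fract z" using p0 by simp
    ultimately show "y \<in> ?R" by blast
  qed
  have "ideal_prod (ring_of_type_algebra :: rat poly fract ring) ?I (fractional_inverse ?R ?I) \<subseteq> N"
    by (rule ideal_prod_subset) (use IN JR N_mult N_add in blast)+
  moreover have "1 \<in> ?R" by (rule type_subring.one_mem[OF R])
  ultimately have "1 \<in> N" using inv by blast
  then obtain f :: "rat poly" where "to_fract f = 1" "Polynomial.coeff f 0 / of_nat p \<in> Z_loc p"
    by (auto simp: N_def)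
  then have "f = 1" by (metis to_fract_1 to_fract_eq_iff)
  then have "inverse (of_nat p) \<in> (Z_loc p :: rat set)"
    using \<open>Polynomial.coeff f 0 / of_nat p \<in> Z_loc p\<close> by (simp add: divide_inverse)
  then show False using inverse_p_notin_Z_loc[OF p, where 'k = rat] by blast
qed

section \<open>Finitely generated ideals\<close>

context type_subring
begin

definition span :: "nat \<Rightarrow> (nat \<Rightarrow> 'a) \<Rightarrow> 'a set" where
  "span r s = {\<Sum>i<r. c i * s i | c. \<forall>i<r. c i \<in> R}"

lemma spanI: "(\<And>i. i < r \<Longrightarrow> c i \<in> R) \<Longrightarrow> (\<Sum>i<r. c i * s i) \<in> span r s"
  unfolding span_def by blast

lemma spanE:
  assumes "x \<in> span r s"
  obtains c where "\<forall>i<r. c i \<in> R" "x = (\<Sum>i<r. c i * s i)"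
  using assms unfolding span_def by blast

lemma span_zero: "0 \<in> span r s"
  using spanI[of r "\<lambda>_. 0" s] by simp

lemma span_add:
  assumes "x \<in> span r s" "y \<in> span r s"
  shows "x + y \<in> span r s"
proof -
  obtain c where c: "\<forall>i<r. c i \<in> R" "x = (\<Sum>i<r. c i * s i)" using assms(1) by (rule spanE)
  obtain d where d: "\<forall>i<r. d i \<in> R" "y = (\<Sum>i<r. d i * s i)" using assms(2) by (rule spanE)
  have "x + y = (\<Sum>i<r. (c i + d i) * s i)" by (simp add: c d sum.distrib distrib_right)
  then show ?thesis using spanI[of r "\<lambda>i. c i + d i" s] c d by auto
qed

lemma span_mult:
  assumes "x \<in> span r s" "a \<in> R"
  shows "a * x \<in> span r s"
proof -
  obtain c where c: "\<forall>i<r. c i \<in> R" "x = (\<Sum>i<r. c i * s i)" using assms(1) by (rule spanE)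
  have "a * x = (\<Sum>i<r. (a * c i) * s i)" by (simp add: c sum_distrib_left mult_ac)
  then show ?thesis using spanI[of r "\<lambda>i. a * c i" s] c assms(2) by auto
qed

lemma span_Suc_mono: "x \<in> span r s \<Longrightarrow> x \<in> span (Suc r) s"
proof -
  assume "x \<in> span r s"
  then obtain c where c: "\<forall>i<r. c i \<in> R" "x = (\<Sum>i<r. c i * s i)" by (rule spanE)
  have "x = (\<Sum>i<Suc r. (if i < r then c i else 0) * s i)" by (simp add: c)
  then show ?thesis using spanI[of "Suc r" "\<lambda>i. if i < r then c i else 0" s] c by auto
qed

lemma span_last: "s r \<in> span (Suc r) s"
proof -
  have "(\<Sum>i<Suc r. (if i = r then 1 else 0) * s i) \<in> span (Suc r) s" by (rule spanI) auto
  then show ?thesis by (simp add: if_distrib sum.delta cong: if_cong)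
qed

lemma power_diff_factor:
  assumes "x \<in> R" "y \<in> R"
  obtains h where "h \<in> R" "x ^ n - y ^ n = (x - y) * h"
proof -
  have "\<exists>h\<in>R. x ^ n - y ^ n = (x - y) * h"
  proof (induction n)
    case (Suc n)
    then obtain h where "h \<in> R" "x ^ n - y ^ n = (x - y) * h" by auto
    moreover have "x ^ Suc n - y ^ Suc n = x * (x ^ n - y ^ n) + (x - y) * y ^ n"
      by (simp add: algebra_simps)
    ultimately have "x ^ Suc n - y ^ Suc n = x * ((x - y) * h) + (x - y) * y ^ n" by simp
    also have "\<dots> = (x - y) * (x * h + y ^ n)" by (simp add: algebra_simps)
    finally show ?case using \<open>h \<in> R\<close> assms by (intro bexI[of _ "x * h + y ^ n"]) auto
  qed (auto intro!: bexI[of _ 0])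
  then show ?thesis using that by blast
qed

text \<open>
  If an ideal contains \<open>a\<^sup>k\<close> and \<open>b\<^sup>E\<close>, then it contains \<open>(a + b)\<^bsup>kE\<^esup>\<close>: the difference of \<open>(a + b)\<^sup>k\<close> and
  \<open>a\<^sup>k\<close> is a multiple of \<open>b\<close>. The summands \<open>c\<^sub>i s\<^sub>i\<close> are added one at a time.
\<close>

lemma power_mem_span_powers:
  assumes s: "\<And>i. i < r \<Longrightarrow> s i \<in> R" and x: "x \<in> span r s" and E: "E > 0"
  obtains k where "x ^ k \<in> span r (\<lambda>i. s i ^ E)"
proof -
  obtain c where c: "\<forall>i<r. c i \<in> R" "x = (\<Sum>i<r. c i * s i)" using x by (rule spanE)
  have "\<exists>k. (\<Sum>i<r. c i * s i) ^ k \<in> span r (\<lambda>i. s i ^ E)"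
    using s c(1)
  proof (induction r)
    case 0
    have "(\<Sum>i<0. c i * s i) ^ 1 = 0" by simp
    then show ?case using span_zero by metis
  next
    case (Suc r)
    let ?J = "span (Suc r) (\<lambda>i. s i ^ E)"
    let ?a = "\<Sum>i<r. c i * s i"
    let ?b = "c r * s r"
    obtain k where k: "?a ^ k \<in> span r (\<lambda>i. s i ^ E)" using Suc by force
    have cs: "c i * s i \<in> R" if "i < Suc r" for i using Suc.prems that by blast
    then have aR: "?a \<in> R" "?b \<in> R" by (intro sum_mem cs, simp) (rule cs, simp)
    obtain h where h: "h \<in> R" "(?a + ?b) ^ k - ?a ^ k = (?a + ?b - ?a) * h"
      using power_diff_factor[of "?a + ?b" ?a k] aR by auto
    have e: "(?a + ?b) ^ k = ?b * h + ?a ^ k" using h(2) by (simp add: algebra_simps)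
    obtain h' where h': "h' \<in> R" "(?b * h + ?a ^ k) ^ E - (?b * h) ^ E = (?b * h + ?a ^ k - ?b * h) * h'"
      using power_diff_factor[of "?b * h + ?a ^ k" "?b * h" E] aR h(1) by auto
    have "(?a + ?b) ^ (k * E) = (?b * h + ?a ^ k) ^ E" by (simp only: power_mult e)
    also have "\<dots> = (?b * h + ?a ^ k - ?b * h) * h' + (?b * h) ^ E"
      unfolding h'(2)[symmetric] by simp
    also have "\<dots> = h' * ?a ^ k + (c r * h) ^ E * s r ^ E"
      by (simp add: power_mult_distrib mult_ac)
    finally have "(?a + ?b) ^ (k * E) = h' * ?a ^ k + (c r * h) ^ E * s r ^ E" .
    moreover have "h' * ?a ^ k \<in> ?J" using span_mult[OF span_Suc_mono[OF k] h'(1)] .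
    moreover have "(c r * h) ^ E * s r ^ E \<in> ?J"
      using span_mult[OF span_last[of "\<lambda>i. s i ^ E" r], of "(c r * h) ^ E"] Suc.prems h by auto
    ultimately have "(?a + ?b) ^ (k * E) \<in> ?J" using span_add by simp
    then show ?case by auto
  qed
  then show ?thesis using that c(2) by blast
qed

text \<open>Each factor is congruent to \<open>1\<close> modulo \<open>s\<^sub>i\<close>.\<close>

lemma one_minus_prod_mem_span:
  assumes "\<And>i. i < r \<Longrightarrow> s i \<in> R" "a > 0"
  shows "1 - (\<Prod>i<r. (1 - s i ^ a) ^ b) \<in> span r s"
  using assms(1)
proof (induction r)
  case 0
  then show ?case using span_zero by simp
next
  case (Suc r)
  let ?q = "\<Prod>i<r. (1 - s i ^ a) ^ b"
  have sr: "s r \<in> R" using Suc.prems by simp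
  obtain h where h: "h \<in> R" "(1 - s r ^ a) ^ b - 1 ^ b = (1 - s r ^ a - 1) * h"
    using power_diff_factor[of "1 - s r ^ a" 1 b] sr by auto
  have a: "s r ^ a = s r ^ (a - 1) * s r" using assms(2) by (cases a) simp_all
  have e: "(1 - s r ^ a) ^ b = 1 - h * s r ^ (a - 1) * s r"
    using h(2) by (simp add: a algebra_simps)
  have "1 - (\<Prod>i<Suc r. (1 - s i ^ a) ^ b) = (1 - ?q) + (?q * (h * s r ^ (a - 1))) * s r"
    unfolding prod.lessThan_Suc e by (simp add: algebra_simps)
  moreover have "?q \<in> R"
    using Suc.prems by (intro prod_mem power_mem diff_mem one_mem) auto
  then have "?q * (h * s r ^ (a - 1)) \<in> R" using h(1) sr by blast
  moreover have "1 - ?q \<in> span (Suc r) s" using Suc by (intro span_Suc_mono) auto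
  ultimately show ?case using span_add span_mult[OF span_last[of s r]] by metis
qed

end

section \<open>Approximately discrete values\<close>

context prime_above
begin

text \<open>Up to \<open>p\<^sup>N\<close>, the value of \<open>x\<close> is an integral multiple of that of \<open>p\<close>.\<close>

definition discrete_upto :: "nat \<Rightarrow> 'k \<Rightarrow> bool" where
  "discrete_upto N x \<longleftrightarrow> (\<exists>k<N. \<exists>u\<in>U. x = of_nat p ^ k * u) \<or> x / of_nat p ^ N \<in> V"

lemma discrete_uptoI: "k < N \<Longrightarrow> u \<in> U \<Longrightarrow> x = of_nat p ^ k * u \<Longrightarrow> discrete_upto N x"
  unfolding discrete_upto_def by blast

lemma discrete_upto_cases:
  assumes "discrete_upto (Suc m) x" "x \<in> D"
  shows "x \<notin> P \<or> x / of_nat p \<in> V"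
  using assms(1) unfolding discrete_upto_def
proof
  assume "\<exists>k<Suc m. \<exists>u\<in>U. x = of_nat p ^ k * u"
  then obtain k u where u: "u \<in> U" "x = of_nat p ^ k * u" by auto
  show ?thesis
  proof (cases k)
    case 0
    then show ?thesis using u U_D mem_M_iff[OF assms(2)] by auto
  next
    case (Suc j)
    then have "x / of_nat p = of_nat p ^ j * u" using u by simp
    then show ?thesis using u U_D by auto
  qed
next
  assume "x / of_nat p ^ Suc m \<in> V"
  then have "of_nat p ^ m * (x / of_nat p ^ Suc m) \<in> V" by blast
  then show ?thesis by simp
qed

lemma U_if_near_one:
  assumes "(y - 1) / of_nat p ^ Suc m \<in> V"
  shows "y \<in> U"
proof -
  have "(y - 1) / of_nat p ^ Suc m * of_nat p ^ Suc m \<in> M"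
    using assms by (intro M_mult M_power p_in_M) auto
  then have *: "y - 1 \<in> M" by (simp del: power_Suc)
  show ?thesis
  proof (rule U_I)
    have "1 + (y - 1) \<in> V" using * M_subset_V by blast
    then show "y \<in> V" by simp
    show "y \<notin> M"
    proof
      assume "y \<in> M"
      moreover have "- (y - 1) \<in> M" using M_mult[OF _ *, of "- 1"] by auto
      ultimately have "y + - (y - 1) \<in> M" by (rule M_add)
      then show False using one_notin_M by simp
    qed
  qed
qed

end

context uniform_prime_above
begin

text \<open>
  The element \<open>(1 - x\<^bsup>\<kappa>l\<^esup>)\<^bsup>El\<^esup>\<close> is an approximate idempotent: if \<open>x\<close> is a unit,
  then \<open>x\<^sup>\<kappa>\<close> is \<open>1\<close> modulo the maximal ideal, whose \<open>E\<close>-th powers are divisible by \<open>p\<close>; this gives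
  \<open>0\<close> modulo \<open>p\<^sup>l\<close>. If \<open>p\<close> divides \<open>x\<close>, then \<open>x\<^bsup>\<kappa>l\<^esup>\<close> is divisible by \<open>p\<^sup>l\<close>, which gives \<open>1\<close>.
\<close>

lemma near_zero_if_unit:
  assumes "x \<in> D" "x \<notin> P"
  shows "(1 - x ^ (\<kappa> * l)) ^ (E * l) / of_nat p ^ l \<in> V"
proof -
  have "(x ^ l) ^ \<kappa> - 1 \<in> P"
    using assms P_prime_power by (intro exponents(1)) auto
  then have "- ((x ^ l) ^ \<kappa> - 1) \<in> P" by (rule P_minus)
  then have "1 - x ^ (\<kappa> * l) \<in> P" by (simp add: mult.commute flip: power_mult)
  then have "((1 - x ^ (\<kappa> * l)) ^ E / of_nat p) ^ l \<in> V" using p_divides_power by blast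
  then show ?thesis by (simp add: power_mult power_divide)
qed

lemma near_one_if_divisible:
  assumes "x \<in> D" "x / of_nat p \<in> V"
  shows "((1 - x ^ (\<kappa> * l)) ^ (E * l) - 1) / of_nat p ^ l \<in> V"
proof -
  have xV: "x \<in> V" using assms D_subset_V by auto
  let ?z = "x ^ (\<kappa> * l)"
  obtain h where h: "h \<in> V" "(1 - ?z) ^ (E * l) - 1 ^ (E * l) = (1 - ?z - 1) * h"
    using V.power_diff_factor[of "1 - ?z" 1 "E * l"] xV by auto
  have "\<kappa> * l = (\<kappa> * l - l) + l" using pos by simp
  then have z: "?z = x ^ (\<kappa> * l - l) * x ^ l" by (metis power_add)
  have "((1 - ?z) ^ (E * l) - 1) / of_nat p ^ l = - (x ^ (\<kappa> * l - l) * (x / of_nat p) ^ l * h)"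
    using h(2) by (simp add: z power_divide)
  also have "\<dots> \<in> V" using assms xV h by (intro V.minus_mem V.mult_mem V.power_mem)
  finally show ?thesis .
qed

lemma prod_near_zero_or_one:
  fixes r l :: nat
  assumes x: "\<And>i. i < r \<Longrightarrow> x i \<in> D" and discr: "\<And>i. i < r \<Longrightarrow> discrete_upto (Suc m) (x i)"
  defines "y \<equiv> \<Prod>i<r. (1 - x i ^ (\<kappa> * l)) ^ (E * l)"
  shows "y / of_nat p ^ l \<in> V \<or> (y - 1) / of_nat p ^ l \<in> V \<and> (\<forall>i<r. x i / of_nat p \<in> V)"
proof (cases "\<exists>i<r. x i \<notin> P")
  case True
  then obtain i where i: "i < r" "x i \<notin> P" by auto
  let ?e = "\<lambda>i. (1 - x i ^ (\<kappa> * l)) ^ (E * l)"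
  have "y = ?e i * (\<Prod>j\<in>{..<r} - {i}. ?e j)"
    unfolding y_def using i by (intro prod.remove) auto
  then have "y / of_nat p ^ l = (?e i / of_nat p ^ l) * (\<Prod>j\<in>{..<r} - {i}. ?e j)" by simp
  moreover have "(\<Prod>j\<in>{..<r} - {i}. ?e j) \<in> V"     using x D_subset_V by (intro V.prod_mem V.power_mem V.diff_mem V.one_mem) blast
  ultimately have "y / of_nat p ^ l \<in> V"
    using near_zero_if_unit[OF x[OF i(1)] i(2), of l] by (simp only: V.mult_mem)
  then show ?thesis by (rule disjI1)
next
  case False
  then have div: "x i / of_nat p \<in> V" if "i < r" for i
    using discrete_upto_cases[OF discr[OF that] x[OF that]] that by auto
  have "(\<Prod>i<n. (1 - x i ^ (\<kappa> * l)) ^ (E * l)) \<in> V \<and>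
      ((\<Prod>i<n. (1 - x i ^ (\<kappa> * l)) ^ (E * l)) - 1) / of_nat p ^ l \<in> V" if "n \<le> r" for n
    using that
  proof (induction n)
    case (Suc n)
    let ?q = "\<Prod>i<n. (1 - x i ^ (\<kappa> * l)) ^ (E * l)"
    let ?e = "(1 - x n ^ (\<kappa> * l)) ^ (E * l)"
    have e: "?e \<in> V" using x[of n] Suc.prems D_subset_V by auto
    have q: "?q \<in> V" "(?q - 1) / of_nat p ^ l \<in> V" using Suc by auto
    have "(?e - 1) / of_nat p ^ l \<in> V"
      using Suc.prems by (intro near_one_if_divisible x div) auto
    then have "?q * ((?e - 1) / of_nat p ^ l) + (?q - 1) / of_nat p ^ l \<in> V" using q by blast
    also have "?q * ((?e - 1) / of_nat p ^ l) + (?q - 1) / of_nat p ^ l = (?q * ?e - 1) / of_nat p ^ l"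
      by (simp add: algebra_simps flip: add_divide_distrib)
    finally have "(?q * ?e - 1) / of_nat p ^ l \<in> V" .
    moreover have "?q * ?e \<in> V" using q e by blast
    ultimately show ?case by simp
  qed simp
  then show ?thesis using div by (auto simp: y_def)
qed

text \<open>
  The step of the induction below at a single place, where \<open>x\<^sub>i\<close> and \<open>y\<close> are the values of \<open>s\<^sub>i\<close>
  and \<open>\<epsilon>\<close>. The precision \<open>p\<^bsup>m+1\<^esup>\<close> of \<open>y\<close> leaves precision \<open>p\<^sup>m\<close> after the division by \<open>p\<close>.
\<close>

lemma discrete_upto_step:
  fixes r :: nat
  assumes x: "\<And>i. i < r \<Longrightarrow> x i \<in> D" and discr: "\<And>i. i < r \<Longrightarrow> discrete_upto (Suc m) (x i)"
  defines "y \<equiv> \<Prod>i<r. (1 - x i ^ (\<kappa> * Suc m)) ^ (E * Suc m)"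
  shows "i < r \<Longrightarrow> y * x i / of_nat p \<in> V" "i < r \<Longrightarrow> discrete_upto m (y * x i / of_nat p)"
    "discrete_upto m (1 - y)"
proof -
  have "y / of_nat p ^ Suc m \<in> V
      \<or> (y - 1) / of_nat p ^ Suc m \<in> V \<and> (\<forall>i<r. x i / of_nat p \<in> V)"
    unfolding y_def by (rule prod_near_zero_or_one[OF x discr])
  then show "i < r \<Longrightarrow> y * x i / of_nat p \<in> V" "i < r \<Longrightarrow> discrete_upto m (y * x i / of_nat p)"
    "discrete_upto m (1 - y)"
  proof (atomize(full), elim disjE conjE)
    assume y: "y / of_nat p ^ Suc m \<in> V"
    have a: "y * x i / of_nat p / of_nat p ^ m \<in> V" if "i < r" for i
    proof -
      have "y * x i / of_nat p / of_nat p ^ m = y / of_nat p ^ Suc m * x i" by simp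
      also have "\<dots> \<in> V" by (intro V.mult_mem y subsetD[OF D_subset_V] x that)
      finally show ?thesis .
    qed
    have "of_nat p ^ m * (y * x i / of_nat p / of_nat p ^ m) \<in> V" if "i < r" for i
      using a[OF that] by blast
    then have b: "y * x i / of_nat p \<in> V" if "i < r" for i using that by simp
    have "((1 - y) - 1) / of_nat p ^ Suc m = - (y / of_nat p ^ Suc m)" by simp
    then have "1 - y \<in> U" using y by (intro U_if_near_one[of _ m]) auto
    then have "discrete_upto m (1 - y)"
    proof (cases "m = 0")
      case True
      then show ?thesis using \<open>1 - y \<in> U\<close> U_D by (simp add: discrete_upto_def)
    next
      case False
      then show ?thesis using \<open>1 - y \<in> U\<close> by (intro discrete_uptoI[of 0]) auto
    qed
    then show "(i < r \<longrightarrow> y * x i / of_nat p \<in> V) \<and>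
        (i < r \<longrightarrow> discrete_upto m (y * x i / of_nat p)) \<and> discrete_upto m (1 - y)"
      using a b by (simp add: discrete_upto_def)
  next
    assume y: "(y - 1) / of_nat p ^ Suc m \<in> V" and div: "\<forall>i<r. x i / of_nat p \<in> V"
    have yU: "y \<in> U" using y by (rule U_if_near_one)
    have a: "y * x i / of_nat p \<in> V" if "i < r" for i
    proof -
      have "y * (x i / of_nat p) \<in> V" using yU U_D div that by blast
      then show ?thesis by simp
    qed
    have b: "discrete_upto m (y * x i / of_nat p)" if i: "i < r" for i
      using discr[OF i] unfolding discrete_upto_def[of "Suc m"]
    proof
      assume "\<exists>k<Suc m. \<exists>u\<in>U. x i = of_nat p ^ k * u"
      then obtain k u where u: "k < Suc m" "u \<in> U" "x i = of_nat p ^ k * u" by auto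
      have "k \<noteq> 0"
      proof
        assume "k = 0"
        moreover have "x i / of_nat p \<in> V" using div i by blast
        ultimately have "u / of_nat p \<in> V" using u(3) by simp
        then have "u / of_nat p * of_nat p \<in> M" using p_in_M by (rule M_mult)
        then show False using u U_D(2) by simp
      qed
      then obtain j where j: "k = Suc j" by (cases k) auto
      show ?thesis
      proof (rule discrete_uptoI)
        show "j < m" using u j by simp
        show "y * u \<in> U" using yU u(2) by (rule U_mult)
        show "y * x i / of_nat p = of_nat p ^ j * (y * u)" by (simp add: u j)
      qed
    next
      assume "x i / of_nat p ^ Suc m \<in> V"
      then have "y * (x i / of_nat p ^ Suc m) \<in> V" using yU U_D by blast
      then show ?thesis by (simp add: discrete_upto_def)
    qed
    have "- (of_nat p * ((y - 1) / of_nat p ^ Suc m)) \<in> V" using y by blast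
    also have "- (of_nat p * ((y - 1) / of_nat p ^ Suc m)) = (1 - y) / of_nat p ^ m"
      by (simp add: minus_divide_left)
    finally have "discrete_upto m (1 - y)" by (simp add: discrete_upto_def)
    then show "(i < r \<longrightarrow> y * x i / of_nat p \<in> V) \<and>
        (i < r \<longrightarrow> discrete_upto m (y * x i / of_nat p)) \<and> discrete_upto m (1 - y)"
      using a b by simp
  qed
qed

lemma discrete_upto_power:
  assumes "x \<in> D"
  shows "discrete_upto N (x ^ E)"
proof (cases "x = 0")
  case True
  then show ?thesis using pos by (simp add: discrete_upto_def power_0_left)
next
  case False
  then obtain k u where u: "u \<in> U" "x ^ E = of_nat p ^ k * u" using exponents(2) assms by blast
  show ?thesis
  proof (cases "k < N")
    case True
    then show ?thesis using u by (intro discrete_uptoI)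
  next
    case False
    then have "of_nat p ^ k = of_nat p ^ (k - N) * (of_nat p ^ N :: 'k)" by (simp flip: power_add)
    then have "x ^ E / of_nat p ^ N = of_nat p ^ (k - N) * u" using u by simp
    moreover have "of_nat p ^ (k - N) * u \<in> V" using U_D(1)[OF u(1)] by blast
    ultimately have "x ^ E / of_nat p ^ N \<in> V" by simp
    then show ?thesis unfolding discrete_upto_def by (rule disjI2)
  qed
qed

end

section \<open>Inverses of ideals of integer-valued polynomials\<close>

lemma (in integral_over_Z_loc) of_rat_mem_K: "of_rat q \<in> fraction_field D"
proof -
  obtain a b where q: "quotient_of q = (a, b)" by (cases "quotient_of q")
  then have "of_rat q = (of_int a / of_int b :: 'k)"
    using quotient_of_div[OF q] by (simp add: of_rat_divide)
  then show ?thesis using D_subset_K inverse_mem_K[of "of_int b"] by (auto simp: divide_inverse)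
qed

text \<open>Integrally closed rings are root closed in their fraction field, which contains the values \<open>f(d)\<close>.\<close>

lemma (in integral_over_Z_loc) Int_Q_root_closed:
  assumes f: "f ^ n \<in> Int_Q D" and n: "n > 0"
  shows "f \<in> Int_Q D"
  unfolding Int_Q_iff
proof
  fix d assume d: "d \<in> D"
  show "ev f d \<in> D"
  proof (rule integrally_closedD[OF closed_D type_subring_axioms, of _ n "\<lambda>i. if i = 0 then - (ev f d ^ n) else 0"])
    show "ev f d \<in> fraction_field D"
      unfolding ev_eq_sum[OF order.refl] using d D_subset_K of_rat_mem_K
      by (intro K.sum_mem K.mult_mem K.power_mem) auto
    have "ev f d ^ n \<in> D" using f d by (simp add: Int_Q_iff)
    then show "(if i = 0 then - (ev f d ^ n) else 0) \<in> D" for i by auto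
    have "(\<Sum>i<n. (if i = 0 then - (ev f d ^ n) else 0) * ev f d ^ i)
        = (\<Sum>i<n. if i = 0 then - (ev f d ^ n) else 0)"
      by (rule sum.cong) auto
    also have "\<dots> = - (ev f d ^ n)" using n by (simp add: sum.delta)
    finally show "ev f d ^ n + (\<Sum>i<n. (if i = 0 then - (ev f d ^ n) else 0) * ev f d ^ i) = 0"
      by simp
  qed
qed

context uniform_exponents
begin

definition discrete_values :: "nat \<Rightarrow> rat poly \<Rightarrow> bool" where
  "discrete_values N f \<longleftrightarrow> (\<forall>d\<in>D. \<forall>P\<in>primes_above D p. prime_above.discrete_upto D p P N (ev f d))"

text \<open>
  The case \<open>m + 1\<close> is reduced to \<open>m\<close> by means of an element \<open>\<epsilon>\<close> that is close to \<open>1\<close> where all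
  the \<open>s\<^sub>i\<close> are divisible by \<open>p\<close> and close to \<open>0\<close> elsewhere. In the first region the ideal is
  \<open>p\<close> times the one generated by the \<open>\<epsilon> s\<^sub>i / p\<close>, in the second it is the unit ideal; both
  are described by the ideal generated by the \<open>\<epsilon> s\<^sub>i / p\<close> and \<open>1 - \<epsilon>\<close>. The identities
  that relate the inverses of the two ideals are exact.
\<close>

lemma inverse_if_discrete_values:
  assumes "\<And>i. i < r \<Longrightarrow> s i \<in> Int_Q D" "\<And>i. i < r \<Longrightarrow> discrete_values m (s i)"
    and "of_nat p ^ m \<in> R.span r s"
  shows "\<exists>y. (\<forall>i<r. \<forall>j<r. y i * s j \<in> Int_Q D) \<and> (\<Sum>i<r. y i * s i) = 1"
  using assms
proof (induction m arbitrary: r s)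
  case 0
  from 0(3) obtain c where c: "\<forall>i<r. c i \<in> Int_Q D" "of_nat p ^ 0 = (\<Sum>i<r. c i * s i)"
    by (rule R.spanE)
  then show ?case using 0(1) by (intro exI[of _ c]) auto
next
  case (Suc m)
  define \<epsilon> where "\<epsilon> = (\<Prod>i<r. (1 - s i ^ (\<kappa> * Suc m)) ^ (E * Suc m))"
  define s' where "s' i = (if i < r then Polynomial.smult (1 / of_nat p) (\<epsilon> * s i) else 1 - \<epsilon>)" for i
  have \<epsilon>: "\<epsilon> \<in> Int_Q D"
    unfolding \<epsilon>_def using Suc.prems(1) by (intro R.prod_mem R.power_mem R.diff_mem R.one_mem) auto
  have p0: "of_nat p \<noteq> (0 :: rat)" using p_nonzero(1) by simp
  have ps': "of_nat p * s' i = \<epsilon> * s i" if "i < r" for i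
    using that p0 by (simp add: s'_def of_nat_poly)
  have ev\<epsilon>: "ev \<epsilon> d = (\<Prod>i<r. (1 - ev (s i) d ^ (\<kappa> * Suc m)) ^ (E * Suc m))" for d :: 'k
    by (simp add: \<epsilon>_def ev_prod del: mult_Suc_right)
  have evs': "ev (s' i) d = ev \<epsilon> d * ev (s i) d / of_nat p" if "i < r" for i and d :: 'k
    using that by (simp add: s'_def of_rat_divide)
  have s'R: "s' i \<in> Int_Q D" if "i < Suc r" for i
  proof (cases "i < r")
    case True
    have "Polynomial.smult (1 / of_nat p ^ 1) (\<epsilon> * s i) \<in> Int_Q D"
    proof (rule Int_Q_divide_p_powerI)
      fix d P assume d: "d \<in> D" and P: "P \<in> primes_above D p"
      interpret uniform_prime_above D p \<kappa> E P using uniform_prime_aboveI[OF P] .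
      have "ev \<epsilon> d * ev (s i) d / of_nat p \<in> V"
        unfolding ev\<epsilon>
        by (rule discrete_upto_step(1)[where m = m])
          (use Suc.prems(1,2) d P True in \<open>auto simp: Int_Q_iff discrete_values_def\<close>)
      then show "ev (\<epsilon> * s i) d / of_nat p ^ 1 \<in> localization_at_prime D P" by (simp add: V_def)
    qed
    then show ?thesis using True by (simp add: s'_def)
  next
    case False
    then show ?thesis using \<epsilon> by (auto simp: s'_def)
  qed
  have s'd: "discrete_values m (s' i)" if "i < Suc r" for i
    unfolding discrete_values_def
  proof (intro ballI)
    fix d P assume d: "d \<in> D" and P: "P \<in> primes_above D p"
    interpret uniform_prime_above D p \<kappa> E P using uniform_prime_aboveI[OF P] .
    have x: "ev (s i) d \<in> D" "discrete_upto (Suc m) (ev (s i) d)" if "i < r" for i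
      using Suc.prems(1,2) d P that by (auto simp: Int_Q_iff discrete_values_def)
    show "discrete_upto m (ev (s' i) d)"
    proof (cases "i < r")
      case True
      show ?thesis unfolding evs'[OF True] ev\<epsilon> by (rule discrete_upto_step(2)[OF x]) (use True in auto)
    next
      case False
      then have "ev (s' i) d = 1 - ev \<epsilon> d" by (simp add: s'_def)
      then show ?thesis unfolding ev\<epsilon> by (simp only:) (rule discrete_upto_step(3)[OF x])
    qed
  qed
  obtain c where c: "\<forall>i<r. c i \<in> Int_Q D" "of_nat p ^ Suc m = (\<Sum>i<r. c i * s i)"
    using Suc.prems(3) by (rule R.spanE)
  have mem: "of_nat p ^ m \<in> R.span (Suc r) s'"
  proof -
    have "of_nat p * (\<Sum>i<r. c i * s' i) = (\<Sum>i<r. c i * (\<epsilon> * s i))"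
      unfolding sum_distrib_left by (rule sum.cong) (auto simp flip: ps' simp: mult_ac)
    also have "\<dots> = \<epsilon> * of_nat p ^ Suc m" by (simp only: c(2) sum_distrib_left mult_ac)
    also have "\<dots> = of_nat p * (\<epsilon> * of_nat p ^ m)" by (simp add: mult_ac)
    finally have "(\<Sum>i<r. c i * s' i) = \<epsilon> * of_nat p ^ m" using p_nonzero(1) by simp
    then have "of_nat p ^ m = (\<Sum>i<Suc r. (if i < r then c i else of_nat p ^ m) * s' i)"
      by (simp add: s'_def algebra_simps)
    also have "\<dots> \<in> R.span (Suc r) s'" by (rule R.spanI) (use c in auto)
    finally show ?thesis .
  qed
  have "\<exists>y. (\<forall>i<Suc r. \<forall>j<Suc r. y i * s' j \<in> Int_Q D) \<and> (\<Sum>i<Suc r. y i * s' i) = 1"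
    by (rule Suc.IH[OF s'R s'd mem])
  then obtain y where y: "\<forall>i<Suc r. \<forall>j<Suc r. y i * s' j \<in> Int_Q D" "(\<Sum>i<Suc r. y i * s' i) = 1"
    by (elim exE conjE)
  have "1 - \<epsilon> \<in> R.span r s"
    unfolding \<epsilon>_def by (rule R.one_minus_prod_mem_span) (use Suc.prems(1) pos in auto)
  then obtain b where b: "\<forall>i<r. b i \<in> Int_Q D" "1 - \<epsilon> = (\<Sum>i<r. b i * s i)" by (rule R.spanE)
  \<comment> \<open>The sum of the \<open>\<epsilon>\<^sup>2 y\<^sub>i s\<^sub>i / p\<close> is \<open>\<epsilon> (1 - y\<^sub>r (1 - \<epsilon>))\<close>; the difference to \<open>1\<close> is \<open>(1 + \<epsilon> y\<^sub>r) (1 - \<epsilon>)\<close>,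
    a multiple of the element \<open>1 - \<epsilon>\<close> of the ideal of the \<open>s\<^sub>i\<close>.\<close>
  define z where "z i = Polynomial.smult (1 / of_nat p) (\<epsilon> * \<epsilon> * y i) + (1 + \<epsilon> * y r) * b i" for i
  have zs: "z i * s j = \<epsilon> * (y i * s' j) + (1 + \<epsilon> * y r) * (b i * s j)" if "j < r" for i j
    using that by (simp add: z_def s'_def algebra_simps)
  show ?case
  proof (intro exI[of _ z] conjI allI impI)
    fix i j assume ij: "i < r" "j < r"
    have "of_nat p * (y r * s' j) \<in> Int_Q D" using y(1) ij by auto
    then have "y r * (\<epsilon> * s j) \<in> Int_Q D" by (simp add: mult_ac flip: ps'[OF ij(2)])
    then have "(s j + y r * (\<epsilon> * s j)) * b i \<in> Int_Q D" using b ij Suc.prems(1) by auto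
    then have "(1 + \<epsilon> * y r) * (b i * s j) \<in> Int_Q D" by (simp add: algebra_simps)
    moreover have "\<epsilon> * (y i * s' j) \<in> Int_Q D" using \<epsilon> y(1) ij by auto
    ultimately show "z i * s j \<in> Int_Q D" unfolding zs[OF ij(2)] by (rule R.add_mem[rotated])
  next
    have "(\<Sum>i<r. y i * s' i) + y r * (1 - \<epsilon>) = 1" using y(2) by (simp add: s'_def)
    then have ys: "(\<Sum>i<r. y i * s' i) = 1 - y r * (1 - \<epsilon>)" by (simp add: algebra_simps)
    have "(\<Sum>i<r. z i * s i) = (\<Sum>i<r. \<epsilon> * (y i * s' i) + (1 + \<epsilon> * y r) * (b i * s i))"
      by (rule sum.cong) (auto simp: zs)
    also have "\<dots> = \<epsilon> * (\<Sum>i<r. y i * s' i) + (1 + \<epsilon> * y r) * (\<Sum>i<r. b i * s i)"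
      by (simp only: sum.distrib sum_distrib_left)
    also have "\<dots> = \<epsilon> * (1 - y r * (1 - \<epsilon>)) + (1 + \<epsilon> * y r) * (1 - \<epsilon>)" by (simp only: ys b(2))
    also have "\<dots> = 1" by (simp add: algebra_simps)
    finally show "(\<Sum>i<r. z i * s i) = 1" .
  qed
qed

text \<open>
  Passing to the powers \<open>s\<^sub>i\<^sup>E\<close> makes the values discrete. If \<open>y\<^sub>i\<close> is an inverse for the
  powers, then \<open>y\<^sub>i s\<^sub>i\<^bsup>E-1\<^esup>\<close> is one for the \<open>s\<^sub>i\<close>, by root closedness.
\<close>

lemma inverse_if_contains_p_power:
  assumes s: "\<And>i. i < r \<Longrightarrow> s i \<in> Int_Q D" and p: "of_nat p ^ m \<in> R.span r s"
  obtains y where "\<forall>i<r. \<forall>j<r. y i * s j \<in> Int_Q D" "(\<Sum>i<r. y i * s i) = 1"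
proof -
  obtain k where k: "(of_nat p ^ m) ^ k \<in> R.span r (\<lambda>i. s i ^ E)"
    using R.power_mem_span_powers[OF s p pos(2)] by blast
  have "discrete_values (m * k) (s i ^ E)" if "i < r" for i
    unfolding discrete_values_def
  proof (intro ballI)
    fix d P assume d: "d \<in> D" and P: "P \<in> primes_above D p"
    interpret uniform_prime_above D p \<kappa> E P using uniform_prime_aboveI[OF P] .
    show "discrete_upto (m * k) (ev (s i ^ E) d)"
      using discrete_upto_power s[OF that] d by (simp add: Int_Q_iff)
  qed
  then obtain y where y: "\<forall>i<r. \<forall>j<r. y i * s j ^ E \<in> Int_Q D" "(\<Sum>i<r. y i * s i ^ E) = 1"
    using inverse_if_discrete_values[of r "\<lambda>i. s i ^ E" "m * k"] s k by (auto simp: power_mult)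
  obtain e where e: "E = Suc e" using pos(2) by (cases E) auto
  show ?thesis
  proof (rule that[of "\<lambda>i. y i * s i ^ e"], intro allI impI)
    fix i j assume ij: "i < r" "j < r"
    have "(y i * s i ^ e * s j) ^ E = (y i * s i ^ E) ^ e * (y i * s j ^ E)"
      by (simp add: e power_mult_distrib mult_ac flip: power_mult power_add)
    also have "\<dots> \<in> Int_Q D" using y(1) ij by auto
    finally show "y i * s i ^ e * s j \<in> Int_Q D" using pos(2) by (rule Int_Q_root_closed)
  next
    show "(\<Sum>i<r. y i * s i ^ e * s i) = 1" using y(2) by (simp add: e mult_ac)
  qed
qed

end

section \<open>The Pruefer property\<close>

lemma bezout_family:
  fixes f :: "nat \<Rightarrow> 'a::euclidean_ring_gcd"
  obtains u where "\<And>i. i < r \<Longrightarrow> (\<Sum>i<r. u i * f i) dvd f i"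
proof -
  have "\<exists>u. \<forall>i<r. (\<Sum>i<r. u i * f i) dvd f i"
  proof (induction r)
    case (Suc r)
    then obtain u where u: "\<forall>i<r. (\<Sum>i<r. u i * f i) dvd f i" by auto
    let ?c = "\<Sum>i<r. u i * f i"
    obtain a b where ab: "a * ?c + b * f r = gcd ?c (f r)"
      using bezout_coefficients_fst_snd by metis
    define w where "w i = (if i < r then a * u i else b)" for i
    have "(\<Sum>i<r. w i * f i) = a * ?c"
      unfolding sum_distrib_left by (rule sum.cong) (auto simp: w_def mult_ac)
    then have w: "(\<Sum>i<Suc r. w i * f i) = gcd ?c (f r)" by (simp add: ab w_def)
    have "gcd ?c (f r) dvd f i" if "i < Suc r" for i
      using u that by (cases "i < r") (auto simp: less_Suc_eq intro: dvd_trans[OF gcd_dvd1])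
    then have "\<forall>i<Suc r. (\<Sum>i<Suc r. w i * f i) dvd f i" unfolding w by blast
    then show ?case by blast
  qed simp
  then show ?thesis using that by blast
qed

lemma clear_denominators:
  fixes f :: "nat \<Rightarrow> rat poly"
  assumes p: "Factorial_Ring.prime p"
  obtains j where "\<forall>i<r. Polynomial.smult (of_nat p ^ j) (f i) \<in> Z_loc_polys p"
proof -
  interpret ZQ: type_subring "Z_loc p :: rat set" by (rule type_subring_Z_loc[OF p])
  have "\<exists>j. \<forall>i<r. Polynomial.smult (of_nat p ^ j) (f i) \<in> Z_loc_polys p"
  proof (induction r)
    case (Suc r)
    then obtain j where j: "\<forall>i<r. Polynomial.smult (of_nat p ^ j) (f i) \<in> Z_loc_polys p" by auto
    obtain k where k: "Polynomial.smult (of_nat p ^ k) (f r) \<in> Z_loc_polys p"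
      using ex_smult_p_power_mem_Z_loc_polys[OF p] by blast
    have step: "Polynomial.smult (of_nat p ^ (a + b)) g \<in> Z_loc_polys p"
      if "Polynomial.smult (of_nat p ^ a) g \<in> Z_loc_polys p" for a b g
    proof -
      have "of_nat p ^ a * Polynomial.coeff g i \<in> Z_loc p" for i
        using that by (simp add: Z_loc_polys_def)
      then have "of_nat p ^ b * (of_nat p ^ a * Polynomial.coeff g i) \<in> Z_loc p" for i by blast
      then show ?thesis by (simp add: Z_loc_polys_def power_add mult_ac)
    qed
    have "Polynomial.smult (of_nat p ^ (j + k)) (f i) \<in> Z_loc_polys p" if "i < Suc r" for i
      using j step[of j "f i" k] step[OF k, of j] that
      by (cases "i < r") (auto simp: less_Suc_eq add.commute)
    then show ?case by blast
  qed simp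
  then show ?thesis using that by blast
qed

text \<open>
  Dividing generators by their greatest common divisor in \<open>\<rat>[X]\<close> and clearing denominators
  yields generators in \<open>\<int>\<^bsub>(p)\<^esub>[X]\<close> of an ideal that contains a power of \<open>p\<close>.
\<close>

theorem (in uniform_exponents) pruefer_domain_Int_Q:
  "pruefer_domain (to_fract ` Int_Q D)"
  unfolding pruefer_domain_def
proof (intro conjI allI impI)
  let ?R = "to_fract ` Int_Q D"
  have R: "type_subring ?R" by (rule type_subring_to_fract) (rule R.type_subring_axioms)
  then show "subring ?R ring_of_type_algebra" by (simp add: subring_iff_type_subring)
  fix S assume "finite S \<and> S \<subseteq> ?R \<and> genideal (ring_on ?R) S \<noteq> {0}"
  then have S: "finite S" "S \<subseteq> ?R" and nz: "genideal (ring_on ?R) S \<noteq> {0}" by auto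
  obtain r and h :: "nat \<Rightarrow> rat poly fract" where h: "bij_betw h {..<r} S"
    using S(1) by (metis atLeast0LessThan ex_bij_betw_nat_finite)
  have "\<exists>f. f \<in> Int_Q D \<and> h i = to_fract f" if "i < r" for i
    using h S(2) that unfolding bij_betw_def by (metis image_eqI image_iff lessThan_iff subsetD)
  then obtain f where f: "\<And>i. i < r \<Longrightarrow> f i \<in> Int_Q D" "\<And>i. i < r \<Longrightarrow> h i = to_fract (f i)" by metis
  have "\<exists>i<r. f i \<noteq> 0"
  proof (rule ccontr)
    assume "\<not> ?thesis"
    then have "S \<subseteq> {0}" using h f(2) by (auto simp: bij_betw_def)
    moreover have "ideal {0} (ring_on ?R)"
      unfolding ideal_ring_on_iff[OF R] using type_subring.zero_mem[OF R] by simp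
    ultimately have "genideal (ring_on ?R) S \<subseteq> {0}" using genideal_ring_on(3)[OF R S(2)] by blast
    moreover have "0 \<in> genideal (ring_on ?R) S"
      using genideal_ring_on(1)[OF R S(2)] unfolding ideal_ring_on_iff[OF R] by simp
    ultimately show False using nz by blast
  qed
  then obtain i\<^sub>0 where i\<^sub>0: "i\<^sub>0 < r" "f i\<^sub>0 \<noteq> 0" by auto
  obtain u where u: "\<And>i. i < r \<Longrightarrow> (\<Sum>i<r. u i * f i) dvd f i" using bezout_family[of r f] by metis
  define c where "c = (\<Sum>i<r. u i * f i)"
  have "c \<noteq> 0" using u[OF i\<^sub>0(1)] i\<^sub>0(2) by (auto simp: c_def)
  have "\<forall>i<r. \<exists>g. f i = c * g" using u by (auto simp: c_def dvd_def)
  then obtain g where g: "\<And>i. i < r \<Longrightarrow> f i = c * g i" by metis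
  have "c * (\<Sum>i<r. u i * g i) = (\<Sum>i<r. u i * f i)"
    unfolding sum_distrib_left by (rule sum.cong) (auto simp: g mult_ac)
  then have ug: "(\<Sum>i<r. u i * g i) = 1" using \<open>c \<noteq> 0\<close> by (simp add: c_def)
  obtain j where j: "\<forall>i<r. Polynomial.smult (of_nat p ^ j) (g i) \<in> Z_loc_polys p"
    by (rule clear_denominators[OF prime_p])
  obtain k where k: "\<forall>i<r. Polynomial.smult (of_nat p ^ k) (u i) \<in> Z_loc_polys p"
    by (rule clear_denominators[OF prime_p])
  define a where "a i = of_nat p ^ j * g i" for i
  have sm: "Polynomial.smult (of_nat p ^ n) q = of_nat p ^ n * q" for n and q :: "rat poly"
    by (simp add: of_nat_poly poly_const_pow)
  have a: "a i \<in> Int_Q D" if "i < r" for i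
    using j that Z_loc_polys_subset by (auto simp: a_def sm)
  have "(\<Sum>i<r. (of_nat p ^ k * u i) * a i) = of_nat p ^ (k + j) * (\<Sum>i<r. u i * g i)"
    unfolding sum_distrib_left by (rule sum.cong) (auto simp: a_def power_add mult_ac)
  then have "of_nat p ^ (k + j) = (\<Sum>i<r. (of_nat p ^ k * u i) * a i)" by (simp add: ug)
  also have "\<dots> \<in> R.span r a"
    by (rule R.spanI) (use k Z_loc_polys_subset in \<open>auto simp: sm\<close>)
  finally have mem: "of_nat p ^ (k + j) \<in> R.span r a" .
  obtain y where y: "\<forall>i<r. \<forall>j<r. y i * a j \<in> Int_Q D" "(\<Sum>i<r. y i * a i) = 1"
    by (rule inverse_if_contains_p_power[OF a mem])
  define z where "z i = to_fract (y i * of_nat p ^ j) / to_fract c" for i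
  have zf: "z i * h l = to_fract (y i * a l)" if "l < r" for i l
    using \<open>c \<noteq> 0\<close> by (simp add: z_def f(2)[OF that] g[OF that] a_def)
  define y' where "y' t = z (inv_into {..<r} h t)" for t
  have y'h: "y' (h i) = z i" if "i < r" for i
    using h that by (auto simp: y'_def bij_betw_def inv_into_f_f)
  have S_eq: "S = h ` {..<r}" using h by (simp add: bij_betw_def)
  show "invertible_ideal ?R (genideal (ring_on ?R) S)"
  proof (rule invertible_ideal_genidealI[OF R S, of y'])
    show "y' t * t' \<in> ?R" if "t \<in> S" "t' \<in> S" for t t'
      using that y(1) unfolding S_eq by (auto simp: y'h zf simp del: to_fract_mult)
    have "(\<Sum>t\<in>S. t * y' t) = (\<Sum>i<r. h i * y' (h i))"
      by (rule sum.reindex_bij_betw[OF h, symmetric])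
    also have "\<dots> = (\<Sum>i<r. to_fract (y i * a i))"
    proof (rule sum.cong)
      fix i assume "i \<in> {..<r}"
      then have i: "i < r" by simp
      show "h i * y' (h i) = to_fract (y i * a i)"
        by (simp only: y'h[OF i] mult.commute[of "h i"] zf[OF i])
    qed simp
    also have "\<dots> = 1" using y(2) by (simp flip: to_fract_sum to_fract_mult)
    finally show "(\<Sum>t\<in>S. t * y' t) = 1" .
    show "y' t \<in> fraction_field ?R" if "t \<in> S" for t
    proof -
      obtain i where i: "i < r" "t = h i" using \<open>t \<in> S\<close> unfolding S_eq by auto
      \<comment> \<open>One power of \<open>p\<close> clears the denominators of both parts of the fraction \<open>z\<^sub>i\<close>.\<close>
      obtain n where n: "\<forall>l<(2::nat).
          Polynomial.smult (of_nat p ^ n) (if l = 0 then y i * of_nat p ^ j else c) \<in> Z_loc_polys p"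
        by (rule clear_denominators[OF prime_p])
      have "of_nat p ^ n * (y i * of_nat p ^ j) \<in> Int_Q D" "of_nat p ^ n * c \<in> Int_Q D"
        using n[rule_format, of 0] n[rule_format, of 1] Z_loc_polys_subset by (auto simp: sm)
      moreover have "to_fract (of_nat p ^ n * c) \<noteq> 0" using \<open>c \<noteq> 0\<close> p_nonzero(1) by simp
      ultimately have "to_fract (of_nat p ^ n * (y i * of_nat p ^ j)) / to_fract (of_nat p ^ n * c)
          \<in> fraction_field ?R" by (intro fraction_fieldI imageI)
      also have "to_fract (of_nat p ^ n * (y i * of_nat p ^ j)) / to_fract (of_nat p ^ n * c) = z i"
      proof -
        have "of_nat p ^ n \<noteq> (0 :: rat poly)" using p_nonzero(1) by simp
        then have "to_fract (of_nat p ^ n :: rat poly) \<noteq> 0" unfolding to_fract_eq_0_iff .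
        then show ?thesis
          unfolding z_def to_fract_mult[of "of_nat p ^ n"] by (rule mult_divide_mult_cancel_left)
      qed
      finally show ?thesis by (simp only: i(2) y'h[OF i(1)])
    qed
  qed
qed

theorem theorem5p18:
  fixes p :: nat and D :: "'k::{alg_closed_field, field_char_0} set"
  assumes "Factorial_Ring.prime p"
    and "subring D ring_of_type_algebra"
    and "integrally_closed D"
    and "Z_loc p \<subseteq> D" and "D \<subseteq> Z_loc_bar p"
  shows "(pruefer_domain (to_fract ` Int_Q D) \<longleftrightarrow> Z_loc_polys p \<subset> Int_Q D) \<and>
         (Z_loc_polys p \<subset> Int_Q D \<longleftrightarrow> bounded_enat (F_set D p) \<and> bounded_enat (E_set D p))"
proof -
  interpret type_subring D using assms(2) by (simp add: subring_iff_type_subring)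
  interpret integral_over_Z_loc D p
    by unfold_locales (use assms in \<open>auto simp: Z_loc_bar_def\<close>)
  have "Z_loc_polys p \<subset> Int_Q D" if "pruefer_domain (to_fract ` Int_Q D)"
    using that not_pruefer_domain_Z_loc_polys[OF prime_p] Z_loc_polys_subset by (metis psubsetI)
  moreover have "pruefer_domain (to_fract ` Int_Q D) \<and> Z_loc_polys p \<subset> Int_Q D"
    if bounded: "bounded_enat (F_set D p)" "bounded_enat (E_set D p)"
  proof -
    obtain \<kappa> E where "uniform_exponents D p \<kappa> E" by (rule uniform_exponents_if_bounded[OF bounded])
    then interpret uniform_exponents D p \<kappa> E .
    show ?thesis using pruefer_domain_Int_Q Int_Q_nontrivial by blast
  qed
  ultimately show ?thesis using bounded_if_nontrivial by blast
qed

end
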